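(* Let $J$ and $\Lambda$ be infinite sets and let $p,q\in(1,\infty)$. For $C\subset J$ let $P_C:\ell^p(J)\to\ell^p(J)$ be the canonical projection annihilating coordinates outside $C$, and for $D\subset\Lambda$ let $Q_D:\ell^q(\Lambda)\to\ell^q(\Lambda)$ be the canonical projection annihilating coordinates outside $D$. Write $Z=N(\ell^q(\Lambda),\ell^p(J))$ for the space of nuclear operators from $\ell^q(\Lambda)$ to $\ell^p(J)$ with the nuclear norm $\|\cdot\|_N$, and let $I$ denote the identity operator (on the appropriate space). (a) If $p>q$, then $Z$ is reflexive, and hence all the measures of weak non-compactness $\omega(A)$, $\operatorname{wk}_Z(A)$, $\operatorname{wck}_Z(A)$ vanish for any nonempty bounded set $A\subset Z$. (b) If $p\le q$, then $Z$ is not reflexive, and for any nonempty bounded set $A\subset Z$ we have $$\omega(A)=\operatorname{wk}_Z(A)=\operatorname{wck}_Z(A)=\inf\left\{\sup_{T\in A}\|(I-P_C)T(I-Q_D)\|_N : C\subset J,\ D\subset\Lambda \text{ finite}\right\}.$$ (c) For any nonempty bounded set $A\subset Z$ (with no relation between $p$ and $q$ assumed) we have $$\chi(A)\le\inf\left\{\sup_{T\in A}\|T-P_CTQ_D\|_N : C\subset J,\ D\subset\Lambda\text{ finite}\right\}\le 2\chi(A).$$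
   Context: Nuclear operators: a linear operator $T:X\to Y$ between Banach spaces is nuclear if there are sequences $(x_n^* )$ in $X^*$ and $(y_n)$ in $Y$ with $\sum_{n}\|x_n^*\|\,\|y_n\|<\infty$ and $Tx=\sum_{n} x_n^*(x)y_n$ for all $x\in X$. The nuclear norm $\|T\|_N$ is the infimum of $\sum_n\|x_n^*\|\,\|y_n\|$ over all such representations. $N(X,Y)$ is the space of nuclear operators from $X$ to $Y$ with this norm. Measures of non-compactness: for nonempty subsets $A,B$ of a Banach space put $\widehat{\operatorname{d}}(A,B)=\sup\{\operatorname{dist}(a,B): a\in A\}$. For a nonempty bounded set $A$ in a Banach space $X$ (canonically embedded in $X^{**}$), define: - $\chi(A)=\inf\{\widehat{\operatorname{d}}(A,F): F\subset X\text{ finite}\}$ (Hausdorff measure of norm non-compactness); - $\omega(A)=\inf\{\widehat{\operatorname{d}}(A,K): K\subset X\text{ weakly compact}\}$ (De Blasi measure); - $\operatorname{wk}_X(A)=\widehat{\operatorname{d}}(\overline{A}^{w^*},X)$, where $\overline{A}^{w^*}$ is the closure of $A$ in $(X^{**},w^* )$ and distances are taken in $X^{**}$; - $\operatorname{wck}_X(A)=\sup\{\operatorname{dist}(\operatorname{clust}_{w^*}(x_n),X): (x_n)\text{ a sequence in }A\}$, where $\operatorname{clust}_{w^*}(x_n)$ is the set of all weak$^*$ cluster points of $(x_n)$ in $X^{**}$, and the distance between two sets is the infimum $\operatorname{dist}(S,X)=\inf\{\|s-x\|: s\in S,\ x\in X\}$. *)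

theory Defs
  imports "HOL-Analysis.Analysis" "HOL-Library.Function_Algebras"
begin

text \<open>
  The scalar field is \<open>\<real>\<close> or \<open>\<complex>\<close>: up to isometric isomorphism these are the only instances of
  the following class, with \<open>i = 0\<close> in the real case and \<open>i\<close> the imaginary unit in the complex one.
\<close>

class rc_scalar = real_normed_field + complete_space +
  assumes rc_scalar_cases:
    "\<exists>i. (i = 0 \<or> (i * i = - 1 \<and> (\<forall>a b. norm (a *\<^sub>R 1 + b *\<^sub>R i) = sqrt (a\<^sup>2 + b\<^sup>2))))
       \<and> (\<forall>z. \<exists>a b. z = a *\<^sub>R 1 + b *\<^sub>R i)"

instance real :: rc_scalar
  by standard (rule exI[of _ 0], auto)

instance complex :: rc_scalar
proof
  have "norm (a *\<^sub>R 1 + b *\<^sub>R \<i>) = sqrt (a\<^sup>2 + b\<^sup>2)" for a b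
    by (simp add: cmod_def)
  moreover have "\<exists>a b. z = a *\<^sub>R 1 + b *\<^sub>R \<i>" for z
    by (rule exI[of _ "Re z"], rule exI[of _ "Im z"]) (simp add: complex_eq_iff)
  ultimately show "\<exists>i::complex. (i = 0 \<or> (i * i = - 1 \<and>
      (\<forall>a b. norm (a *\<^sub>R 1 + b *\<^sub>R i) = sqrt (a\<^sup>2 + b\<^sup>2)))) \<and> (\<forall>z. \<exists>a b. z = a *\<^sub>R 1 + b *\<^sub>R i)"
    by (intro exI[of _ \<i>]) auto
qed

text \<open>
  The exponents and index sets of the spaces below are parameters, so normed spaces are given by a
  carrier inside an ambient abelian group. For spaces of functions and of operators this group is
  the full function space with pointwise addition (theory \<open>Function_Algebras\<close>). Maps defined on a
  carrier are extended by zero outside it, so that distinct maps are distinct functions.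
\<close>

record ('k, 'v) nspace =
  carrier :: "'v set"
  smul :: "'k \<Rightarrow> 'v \<Rightarrow> 'v"
  nrm :: "'v \<Rightarrow> real"

definition bounded_in :: "('k, 'v) nspace \<Rightarrow> 'v set \<Rightarrow> bool" where
  "bounded_in V A \<longleftrightarrow> A \<subseteq> carrier V \<and> (\<exists>M. \<forall>a\<in>A. nrm V a \<le> M)"

subsection \<open>Duals, weak topologies, reflexivity\<close>

definition dual :: "('k::rc_scalar, 'v::ab_group_add) nspace \<Rightarrow> ('k, 'v \<Rightarrow> 'k) nspace" where
  "dual V =
    \<lparr> carrier = {f. (\<forall>x. x \<notin> carrier V \<longrightarrow> f x = 0) \<and>
                    (\<forall>x\<in>carrier V. \<forall>y\<in>carrier V. f (x + y) = f x + f y) \<and>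
                    (\<forall>c. \<forall>x\<in>carrier V. f (smul V c x) = c * f x) \<and>
                    (\<exists>M. \<forall>x\<in>carrier V. norm (f x) \<le> M * nrm V x)},
      smul = (\<lambda>c f x. c * f x),
      nrm = (\<lambda>f. SUP x\<in>{x \<in> carrier V. nrm V x \<le> 1}. norm (f x)) \<rparr>"

definition canon :: "('k::rc_scalar, 'v::ab_group_add) nspace \<Rightarrow> 'v \<Rightarrow> ('v \<Rightarrow> 'k) \<Rightarrow> 'k" where
  "canon V x = (\<lambda>f. if f \<in> carrier (dual V) then f x else 0)"

definition reflexive :: "('k::rc_scalar, 'v::ab_group_add) nspace \<Rightarrow> bool" where
  "reflexive V \<longleftrightarrow> canon V ` carrier V = carrier (dual (dual V))"

text \<open>The coarsest topology on \<open>S\<close> making all members of \<open>F\<close> continuous.\<close>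

definition initial_topology :: "'a set \<Rightarrow> ('a \<Rightarrow> 'k::topological_space) set \<Rightarrow> 'a topology" where
  "initial_topology S F = topology_generated_by {{x \<in> S. f x \<in> U} | f U. f \<in> F \<and> open U}"

definition weak_topology :: "('k::rc_scalar, 'v::ab_group_add) nspace \<Rightarrow> 'v topology" where
  "weak_topology V = initial_topology (carrier V) (carrier (dual V))"

text \<open>\<open>weak_star_topology V\<close> is a topology on the dual of \<open>V\<close>.\<close>

definition weak_star_topology ::
  "('k::rc_scalar, 'v::ab_group_add) nspace \<Rightarrow> ('v \<Rightarrow> 'k) topology" where
  "weak_star_topology V = initial_topology (carrier (dual V)) ((\<lambda>x f. f x) ` carrier V)"

definition cluster_points :: "'a topology \<Rightarrow> (nat \<Rightarrow> 'a) \<Rightarrow> 'a set" where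
  "cluster_points T s =
    {a \<in> topspace T. \<forall>U. openin T U \<and> a \<in> U \<longrightarrow> (\<exists>\<^sub>\<infinity>n. s n \<in> U)}"

subsection \<open>Measures of non-compactness\<close>

text \<open>
  For nonempty bounded \<open>A\<close> all suprema and infima below are taken over nonempty sets of reals that
  are bounded on the relevant side, so the values of \<open>Sup\<close> and \<open>Inf\<close> on other sets do not matter.
\<close>

definition pt_dist :: "('k, 'v::ab_group_add) nspace \<Rightarrow> 'v \<Rightarrow> 'v set \<Rightarrow> real" where
  "pt_dist V a B = (INF b\<in>B. nrm V (a - b))"

definition set_dist :: "('k, 'v::ab_group_add) nspace \<Rightarrow> 'v set \<Rightarrow> 'v set \<Rightarrow> real" where
  "set_dist V A B = Inf {nrm V (a - b) | a b. a \<in> A \<and> b \<in> B}"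

definition dhat :: "('k, 'v::ab_group_add) nspace \<Rightarrow> 'v set \<Rightarrow> 'v set \<Rightarrow> real" where
  "dhat V A B = (SUP a\<in>A. pt_dist V a B)"

definition chi_nc :: "('k, 'v::ab_group_add) nspace \<Rightarrow> 'v set \<Rightarrow> real" where
  "chi_nc V A = (INF F\<in>{F. F \<subseteq> carrier V \<and> finite F \<and> F \<noteq> {}}. dhat V A F)"

definition omega_nc :: "('k::rc_scalar, 'v::ab_group_add) nspace \<Rightarrow> 'v set \<Rightarrow> real" where
  "omega_nc V A =
    (INF K\<in>{K. K \<subseteq> carrier V \<and> compactin (weak_topology V) K \<and> K \<noteq> {}}. dhat V A K)"

definition wk_nc :: "('k::rc_scalar, 'v::ab_group_add) nspace \<Rightarrow> 'v set \<Rightarrow> real" where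
  "wk_nc V A =
    dhat (dual (dual V)) (weak_star_topology (dual V) closure_of (canon V ` A))
      (canon V ` carrier V)"

definition wck_nc :: "('k::rc_scalar, 'v::ab_group_add) nspace \<Rightarrow> 'v set \<Rightarrow> real" where
  "wck_nc V A =
    (SUP s\<in>{s. \<forall>n::nat. s n \<in> A}.
      set_dist (dual (dual V)) (cluster_points (weak_star_topology (dual V)) (\<lambda>n. canon V (s n)))
        (canon V ` carrier V))"

subsection \<open>Nuclear operators\<close>

definition linear_ops ::
  "('k, 'v::ab_group_add) nspace \<Rightarrow> ('k, 'w::ab_group_add) nspace \<Rightarrow> ('v \<Rightarrow> 'w) set" where
  "linear_ops X Y =
    {T. (\<forall>x\<in>carrier X. T x \<in> carrier Y) \<and> (\<forall>x. x \<notin> carrier X \<longrightarrow> T x = 0) \<and>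
        (\<forall>x\<in>carrier X. \<forall>y\<in>carrier X. T (x + y) = T x + T y) \<and>
        (\<forall>c. \<forall>x\<in>carrier X. T (smul X c x) = smul Y c (T x))}"

definition nuclear_rep ::
  "('k::rc_scalar, 'v::ab_group_add) nspace \<Rightarrow> ('k, 'w::ab_group_add) nspace \<Rightarrow> ('v \<Rightarrow> 'w) \<Rightarrow>
    (nat \<Rightarrow> 'v \<Rightarrow> 'k) \<Rightarrow> (nat \<Rightarrow> 'w) \<Rightarrow> bool" where
  "nuclear_rep X Y T f y \<longleftrightarrow>
    (\<forall>n. f n \<in> carrier (dual X)) \<and> (\<forall>n. y n \<in> carrier Y) \<and>
    summable (\<lambda>n. nrm (dual X) (f n) * nrm Y (y n)) \<and>
    (\<forall>x\<in>carrier X. (\<lambda>m. nrm Y (T x - (\<Sum>n<m. smul Y (f n x) (y n)))) \<longlonglongrightarrow> 0)"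

definition nuclear_norm ::
  "('k::rc_scalar, 'v::ab_group_add) nspace \<Rightarrow> ('k, 'w::ab_group_add) nspace \<Rightarrow> ('v \<Rightarrow> 'w) \<Rightarrow> real"
  where
  "nuclear_norm X Y T = Inf {\<Sum>n. nrm (dual X) (f n) * nrm Y (y n) | f y. nuclear_rep X Y T f y}"

definition nuclear_space ::
  "('k::rc_scalar, 'v::ab_group_add) nspace \<Rightarrow> ('k, 'w::ab_group_add) nspace \<Rightarrow>
    ('k, 'v \<Rightarrow> 'w) nspace" where
  "nuclear_space X Y =
    \<lparr> carrier = {T \<in> linear_ops X Y. \<exists>f y. nuclear_rep X Y T f y},
      smul = (\<lambda>c T x. smul Y c (T x)),
      nrm = nuclear_norm X Y \<rparr>"

definition id_op :: "('k, 'v::ab_group_add) nspace \<Rightarrow> 'v \<Rightarrow> 'v" where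
  "id_op X = (\<lambda>x. if x \<in> carrier X then x else 0)"

subsection \<open>The spaces \<open>\<ell>\<^sup>p(J)\<close>\<close>

definition ell :: "real \<Rightarrow> 'j set \<Rightarrow> ('k::rc_scalar, 'j \<Rightarrow> 'k) nspace" where
  "ell p J =
    \<lparr> carrier = {x. (\<forall>j. j \<notin> J \<longrightarrow> x j = 0) \<and> (\<lambda>j. norm (x j) powr p) summable_on J},
      smul = (\<lambda>c x j. c * x j),
      nrm = (\<lambda>x. (\<Sum>\<^sub>\<infinity>j\<in>J. norm (x j) powr p) powr (1 / p)) \<rparr>"

definition coord_proj :: "real \<Rightarrow> 'j set \<Rightarrow> 'j set \<Rightarrow> ('j \<Rightarrow> 'k::rc_scalar) \<Rightarrow> ('j \<Rightarrow> 'k)" where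
  "coord_proj p J C = (\<lambda>x. if x \<in> carrier (ell p J) then (\<lambda>j. if j \<in> C then x j else 0) else 0)"

end

theory Submission
  imports Defs
begin

text \<open>
  With \<open>r\<close> conjugate to \<open>q\<close>, the dual of \<open>\<ell>\<^sup>q(L)\<close> is \<open>\<ell>\<^sup>r(L)\<close> and the nuclear norm is the largest
  seminorm on \<open>Z\<close> that is at most \<open>\<parallel>a\<parallel> \<parallel>y\<parallel>\<close> on the elementary tensors \<open>a \<otimes> y\<close>. Estimating on
  elementary tensors bounds the sum of the norms of disjoint diagonal blocks \<open>P C\<^sub>n T Q D\<^sub>n\<close> of an
  operator: by \<open>\<parallel>T\<parallel>\<close> itself if \<open>p \<le> q\<close>, and sublinearly in the number of blocks always. Hence bounded
  finite matrices converge in norm, so every \<open>\<psi>\<close> in the bidual of \<open>Z\<close> has a matrix belonging to an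
  operator \<open>S\<close> in \<open>Z\<close>, and \<open>\<psi>\<close> agrees with \<open>S\<close> on all functionals that do not see the corner
  outside finitely many rows and columns. Therefore bounded sets of operators with vanishing corner
  \<open>(I - P C) T (I - Q D)\<close> are relatively weakly compact, which bounds \<open>\<omega>\<close> from above.

  If \<open>q < p\<close>, a gliding hump shows that the corners of any functional tend to zero (this is Pitt's
  theorem, as the dual of \<open>Z\<close> consists of the operators from \<open>\<ell>\<^sup>p(J)\<close> to \<open>\<ell>\<^sup>q(L)\<close>), so \<open>Z\<close> is
  reflexive. If \<open>p \<le> q\<close> and the corners of \<open>A\<close> exceed \<open>d\<close>, a gliding hump produces functionals
  supported on disjoint blocks, whose sums have norm one, that keep all weak\<open>*\<close> cluster points of
  a suitable sequence in \<open>A\<close> at distance nearly \<open>d\<close> from \<open>Z\<close>.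
\<close>

section \<open>Seminormed spaces on a carrier\<close>

text \<open>The dual of Z is never described explicitly: functionals are handled through their
  values on elementary tensors. With one factor restricted to finitely many coordinates, such a
  value is a functional of the other factor alone, and since r and p lie strictly between 1 and
  infinity it has small tails. So finite matrices determine everything except the corner, where both
  factors escape to infinity at once; there the relation between p and q decides. For p \<le> q
  normalised disjoint diagonal blocks behave like the unit vectors of l^1, which is the obstruction
  to reflexivity. The factor 2 in (c) is the norm bound for T \<mapsto> T - P_C T Q_D, whereas T
  \<mapsto> (I - P_C) T (I - Q_D) is a contraction. Norms on carriers are treated as seminorms, so
  weak compactness is transported up to distance zero, which is all that the measures can
  see.\<close>

locale seminormed =
  fixes V :: "('k::rc_scalar, 'v::ab_group_add) nspace"
  assumes zero_mem: "0 \<in> carrier V"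
    and add_mem: "x \<in> carrier V \<Longrightarrow> y \<in> carrier V \<Longrightarrow> x + y \<in> carrier V"
    and smul_mem: "x \<in> carrier V \<Longrightarrow> smul V c x \<in> carrier V"
    and smul_add_right: "x \<in> carrier V \<Longrightarrow> y \<in> carrier V \<Longrightarrow> smul V c (x + y) = smul V c x + smul V c y"
    and smul_add_left: "x \<in> carrier V \<Longrightarrow> smul V (c + d) x = smul V c x + smul V d x"
    and smul_smul: "x \<in> carrier V \<Longrightarrow> smul V c (smul V d x) = smul V (c * d) x"
    and smul_one: "x \<in> carrier V \<Longrightarrow> smul V 1 x = x"
    and nrm_nonneg: "x \<in> carrier V \<Longrightarrow> 0 \<le> nrm V x"
    and nrm_triangle: "x \<in> carrier V \<Longrightarrow> y \<in> carrier V \<Longrightarrow> nrm V (x + y) \<le> nrm V x + nrm V y"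
    and nrm_smul_le: "x \<in> carrier V \<Longrightarrow> nrm V (smul V c x) \<le> norm c * nrm V x"
begin

lemma smul_zero_left: "x \<in> carrier V \<Longrightarrow> smul V 0 x = 0"
  using smul_add_left[of x 0 0] by simp

lemma smul_zero_right: "smul V c 0 = 0"
  using smul_add_right[of 0 0 c] zero_mem by simp

lemma smul_minus_one: "x \<in> carrier V \<Longrightarrow> smul V (- 1) x = - x"
  using smul_add_left[of x 1 "-1"] smul_one[of x] smul_zero_left[of x]
  by (simp add: eq_neg_iff_add_eq_0 add.commute)

lemma uminus_mem: "x \<in> carrier V \<Longrightarrow> - x \<in> carrier V"
  using smul_mem[of x "-1"] smul_minus_one by simp

lemma diff_mem: "x \<in> carrier V \<Longrightarrow> y \<in> carrier V \<Longrightarrow> x - y \<in> carrier V"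
  using add_mem[of x "-y"] uminus_mem by simp

lemma nrm_zero: "nrm V 0 = 0"
  using nrm_smul_le[of 0 0] nrm_nonneg[of 0] zero_mem smul_zero_right by simp

text \<open>The reverse of the assumed inequality is that inequality for \<open>inverse c\<close>,
  so instances of the locale have to prove one direction only.\<close>

lemma nrm_smul:
  assumes "x \<in> carrier V" shows "nrm V (smul V c x) = norm c * nrm V x"
proof (cases "c = 0")
  case True
  then show ?thesis using assms by (simp add: smul_zero_left nrm_zero)
next
  case False
  have "nrm V x = nrm V (smul V (inverse c) (smul V c x))"
    using assms False by (simp add: smul_smul smul_one)
  also have "\<dots> \<le> norm (inverse c) * nrm V (smul V c x)"
    using assms by (intro nrm_smul_le smul_mem)
  finally have "norm c * nrm V x \<le> norm c * (norm (inverse c) * nrm V (smul V c x))"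
    by (simp add: mult_left_mono)
  also have "\<dots> = nrm V (smul V c x)"
    using False by (simp add: norm_inverse)
  finally show ?thesis using nrm_smul_le[OF assms, of c] by simp
qed

lemma nrm_uminus: "x \<in> carrier V \<Longrightarrow> nrm V (- x) = nrm V x"
  using nrm_smul[of x "-1"] smul_minus_one by simp

lemma nrm_diff_le: "x \<in> carrier V \<Longrightarrow> y \<in> carrier V \<Longrightarrow> nrm V (x - y) \<le> nrm V x + nrm V y"
  using nrm_triangle[of x "-y"] uminus_mem nrm_uminus by simp

lemma nrm_triangle_sub: "x \<in> carrier V \<Longrightarrow> y \<in> carrier V \<Longrightarrow> nrm V x \<le> nrm V y + nrm V (x - y)"
  using nrm_triangle[of y "x - y"] diff_mem by simp

lemma sum_mem: "(\<And>i. i \<in> S \<Longrightarrow> f i \<in> carrier V) \<Longrightarrow> (\<Sum>i\<in>S. f i) \<in> carrier V"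
  by (induction S rule: infinite_finite_induct) (auto intro: zero_mem add_mem)

lemma nrm_sum: "(\<And>i. i \<in> S \<Longrightarrow> f i \<in> carrier V) \<Longrightarrow> nrm V (\<Sum>i\<in>S. f i) \<le> (\<Sum>i\<in>S. nrm V (f i))"
proof (induction S rule: infinite_finite_induct)
  case (insert i S)
  have "nrm V (f i + sum f S) \<le> nrm V (f i) + nrm V (sum f S)"
    using insert by (intro nrm_triangle sum_mem) auto
  with insert show ?case by auto
qed (auto simp: nrm_zero)

text \<open>Meant for functionals \<rho> on Z such as sums of block norms;
  \<open>\<rho> 0 \<le> 0\<close> covers the empty sum.\<close>

lemma sum_subadditive:
  fixes \<rho> :: "'v \<Rightarrow> real"
  assumes "\<rho> 0 \<le> 0" "\<And>x y. x \<in> carrier V \<Longrightarrow> y \<in> carrier V \<Longrightarrow> \<rho> (x + y) \<le> \<rho> x + \<rho> y"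
  shows "(\<And>i. i \<in> S \<Longrightarrow> f i \<in> carrier V) \<Longrightarrow> \<rho> (\<Sum>i\<in>S. f i) \<le> (\<Sum>i\<in>S. \<rho> (f i))"
proof (induction S rule: infinite_finite_induct)
  case (insert i S)
  then show ?case using assms(2)[of "f i" "sum f S"] sum_mem[of S f] by auto
qed (use assms(1) in auto)

lemma sum_additive:
  fixes h :: "'v \<Rightarrow> 'b::comm_monoid_add"
  assumes "h 0 = 0" "\<And>x y. x \<in> carrier V \<Longrightarrow> y \<in> carrier V \<Longrightarrow> h (x + y) = h x + h y"
  shows "(\<And>i. i \<in> S \<Longrightarrow> f i \<in> carrier V) \<Longrightarrow> h (\<Sum>i\<in>S. f i) = (\<Sum>i\<in>S. h (f i))"
proof (induction S rule: infinite_finite_induct)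
  case (insert i S)
  then show ?case using assms(2)[of "f i" "sum f S"] sum_mem[of S f] by auto
qed (use assms(1) in auto)

subsection \<open>The dual space\<close>

lemma dual_outside: "f \<in> carrier (dual V) \<Longrightarrow> x \<notin> carrier V \<Longrightarrow> f x = 0"
  by (simp add: dual_def)

lemma dual_add: "f \<in> carrier (dual V) \<Longrightarrow> x \<in> carrier V \<Longrightarrow> y \<in> carrier V \<Longrightarrow> f (x + y) = f x + f y"
  by (simp add: dual_def)

lemma dual_smul: "f \<in> carrier (dual V) \<Longrightarrow> x \<in> carrier V \<Longrightarrow> f (smul V c x) = c * f x"
  by (simp add: dual_def)

lemma dual_diff: "f \<in> carrier (dual V) \<Longrightarrow> x \<in> carrier V \<Longrightarrow> y \<in> carrier V \<Longrightarrow> f (x - y) = f x - f y"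
  using dual_add[of f "x - y" y] diff_mem[of x y] by simp

lemma dual_zero: "f \<in> carrier (dual V) \<Longrightarrow> f 0 = 0"
  using dual_add[of f 0 0] zero_mem by simp

lemma dual_sum:
  assumes "f \<in> carrier (dual V)" "\<And>i. i \<in> S \<Longrightarrow> g i \<in> carrier V"
  shows "f (\<Sum>i\<in>S. g i) = (\<Sum>i\<in>S. f (g i))"
  using assms dual_zero dual_add by (intro sum_additive[of f]) auto

lemma dualI:
  assumes "\<And>x. x \<notin> carrier V \<Longrightarrow> f x = 0"
    and "\<And>x y. x \<in> carrier V \<Longrightarrow> y \<in> carrier V \<Longrightarrow> f (x + y) = f x + f y"
    and "\<And>c x. x \<in> carrier V \<Longrightarrow> f (smul V c x) = c * f x"
    and "\<And>x. x \<in> carrier V \<Longrightarrow> norm (f x) \<le> M * nrm V x"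
  shows "f \<in> carrier (dual V)"
  unfolding dual_def using assms by (auto intro!: exI[of _ M])

lemma dual_nrm_eq: "nrm (dual V) f = (SUP x\<in>{x \<in> carrier V. nrm V x \<le> 1}. norm (f x))"
  by (simp add: dual_def)

lemma dual_bdd:
  assumes "f \<in> carrier (dual V)"
  shows "bdd_above ((\<lambda>x. norm (f x)) ` {x \<in> carrier V. nrm V x \<le> 1})"
proof -
  obtain M where M: "\<And>x. x \<in> carrier V \<Longrightarrow> norm (f x) \<le> M * nrm V x"
    using assms unfolding dual_def by auto blast
  show ?thesis
  proof (intro bdd_aboveI2)
    fix x assume "x \<in> {x \<in> carrier V. nrm V x \<le> 1}"
    then have x: "x \<in> carrier V" "nrm V x \<le> 1" by auto
    have "norm (f x) \<le> M * nrm V x" using M x by auto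
    also have "\<dots> \<le> \<bar>M\<bar> * nrm V x" using nrm_nonneg[OF x(1)] by (intro mult_right_mono) auto
    also have "\<dots> \<le> \<bar>M\<bar>" using x nrm_nonneg[OF x(1)] by (simp add: mult_left_le)
    finally show "norm (f x) \<le> \<bar>M\<bar>" .
  qed
qed

lemma dual_nrm_nonneg:
  assumes "f \<in> carrier (dual V)" shows "0 \<le> nrm (dual V) f"
proof -
  have "norm (f 0) \<le> nrm (dual V) f"
    unfolding dual_nrm_eq using zero_mem nrm_zero by (intro cSUP_upper dual_bdd[OF assms]) auto
  then show ?thesis using norm_ge_zero[of "f 0"] by linarith
qed

lemma dual_bound:
  assumes f: "f \<in> carrier (dual V)" and x: "x \<in> carrier V"
  shows "norm (f x) \<le> nrm (dual V) f * nrm V x"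
proof (cases "nrm V x = 0")
  case True
  \<comment> \<open>A vector of norm zero cannot be normalised; the boundedness constant in the
    definition of \<open>dual\<close> gives \<open>f x = 0\<close> directly.\<close>
  obtain M where "norm (f x) \<le> M * nrm V x" using f x by (auto simp: dual_def)
  with True show ?thesis by simp
next
  case False
  define c :: 'k where "c = of_real (inverse (nrm V x))"
  have pos: "nrm V x > 0" using False nrm_nonneg[OF x] by simp
  have "nrm V (smul V c x) = 1" using x False pos by (simp add: nrm_smul c_def norm_inverse)
  then have "norm (f (smul V c x)) \<le> nrm (dual V) f"
    unfolding dual_nrm_eq using x by (intro cSUP_upper dual_bdd[OF f]) (auto intro: smul_mem)
  then have "inverse (nrm V x) * norm (f x) \<le> nrm (dual V) f"
    using pos by (simp add: dual_smul[OF f x] norm_mult norm_inverse c_def)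
  then show ?thesis using pos by (simp add: field_simps)
qed

lemma dual_nrm_le:
  assumes "0 \<le> M" and "\<And>x. x \<in> carrier V \<Longrightarrow> norm (f x) \<le> M * nrm V x"
  shows "nrm (dual V) f \<le> M"
  unfolding dual_nrm_eq
proof (rule cSUP_least)
  show "{x \<in> carrier V. nrm V x \<le> 1} \<noteq> {}" using zero_mem nrm_zero by auto
next
  fix x assume "x \<in> {x \<in> carrier V. nrm V x \<le> 1}"
  then have x: "x \<in> carrier V" "nrm V x \<le> 1" by auto
  have "norm (f x) \<le> M * nrm V x" using assms x by auto
  also have "\<dots> \<le> M" using x assms(1) nrm_nonneg[OF x(1)] by (simp add: mult_left_le)
  finally show "norm (f x) \<le> M" .
qed

lemma dual_smul_eq: "smul (dual V) = (\<lambda>c f x. c * f x)"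
  by (simp add: dual_def)

lemma dual_seminormed: "seminormed (dual V)"
proof
  show "0 \<in> carrier (dual V)" by (rule dualI[where M = 0]) auto
next
  fix f g assume f: "f \<in> carrier (dual V)" and g: "g \<in> carrier (dual V)"
  have le: "norm ((f + g) x) \<le> (nrm (dual V) f + nrm (dual V) g) * nrm V x" if "x \<in> carrier V" for x
    using dual_bound[OF f that] dual_bound[OF g that] norm_triangle_ineq[of "f x" "g x"]
    by (simp add: algebra_simps)
  show "f + g \<in> carrier (dual V)"
    by (rule dualI[OF _ _ _ le])
      (auto simp: dual_outside[OF f] dual_outside[OF g] dual_add[OF f] dual_add[OF g]
        dual_smul[OF f] dual_smul[OF g] algebra_simps)
  show "nrm (dual V) (f + g) \<le> nrm (dual V) f + nrm (dual V) g"
    using le dual_nrm_nonneg[OF f] dual_nrm_nonneg[OF g] by (intro dual_nrm_le) auto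
next
  fix f c assume f: "f \<in> carrier (dual V)"
  have le: "norm (smul (dual V) c f x) \<le> norm c * nrm (dual V) f * nrm V x" if "x \<in> carrier V" for x
    using mult_left_mono[OF dual_bound[OF f that], of "norm c"]
    by (simp add: dual_smul_eq norm_mult mult.assoc)
  show "smul (dual V) c f \<in> carrier (dual V)"
    by (rule dualI[OF _ _ _ le])
      (auto simp: dual_outside[OF f] dual_add[OF f] dual_smul_eq dual_smul[OF f] algebra_simps)
  show "nrm (dual V) (smul (dual V) c f) \<le> norm c * nrm (dual V) f"
    using le dual_nrm_nonneg[OF f] by (intro dual_nrm_le) auto
qed (auto simp: dual_smul_eq fun_eq_iff algebra_simps intro: dual_nrm_nonneg)

lemma canon_mem:
  assumes x: "x \<in> carrier V"
  shows "canon V x \<in> carrier (dual (dual V))" and "nrm (dual (dual V)) (canon V x) \<le> nrm V x"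
proof -
  interpret D: seminormed "dual V" by (rule dual_seminormed)
  have le: "norm (canon V x f) \<le> nrm V x * nrm (dual V) f" if "f \<in> carrier (dual V)" for f
    using dual_bound[OF that x] that by (simp add: canon_def mult.commute)
  show "canon V x \<in> carrier (dual (dual V))"
    by (rule D.dualI[OF _ _ _ le])
      (auto simp: canon_def D.add_mem D.smul_mem[unfolded dual_smul_eq] dual_smul_eq)
  show "nrm (dual (dual V)) (canon V x) \<le> nrm V x"
    using le nrm_nonneg[OF x] by (intro D.dual_nrm_le) auto
qed

lemma canon_apply: "f \<in> carrier (dual V) \<Longrightarrow> canon V x f = f x"
  by (simp add: canon_def)

end

subsection \<open>The Hahn--Banach theorem\<close>

text \<open>A minimal sublinear functional \<open>q\<close> is linear: replacing \<open>q\<close> by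
  \<open>y \<mapsto> inf\<^sub>t\<^sub>\<ge>\<^sub>0 q (y + t x) - t q x\<close> cannot lower it, so \<open>q (- x) \<le> - q x\<close>.\<close>

context seminormed
begin

abbreviation rsm :: "real \<Rightarrow> 'v \<Rightarrow> 'v" where
  "rsm t x \<equiv> smul V (of_real t) x"

text \<open>The value 0 outside the carrier makes comparison of two such functionals as functions
  the same as comparison on the carrier, so Zorn's lemma can use the pointwise order.\<close>

definition sublin :: "('v \<Rightarrow> real) \<Rightarrow> bool" where
  "sublin q \<longleftrightarrow> (\<forall>x. x \<notin> carrier V \<longrightarrow> q x = 0) \<and>
     (\<forall>x\<in>carrier V. \<forall>y\<in>carrier V. q (x + y) \<le> q x + q y) \<and>
     (\<forall>x\<in>carrier V. \<forall>t\<ge>0. q (rsm t x) = t * q x)"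

definition lower :: "('v \<Rightarrow> real) \<Rightarrow> 'v \<Rightarrow> 'v \<Rightarrow> real" where
  "lower q x y = (if y \<in> carrier V then INF t\<in>{0..}. q (y + rsm t x) - t * q x else 0)"

lemma sublinD:
  assumes "sublin q"
  shows "x \<notin> carrier V \<Longrightarrow> q x = 0"
    and "x \<in> carrier V \<Longrightarrow> y \<in> carrier V \<Longrightarrow> q (x + y) \<le> q x + q y"
    and "x \<in> carrier V \<Longrightarrow> 0 \<le> t \<Longrightarrow> q (rsm t x) = t * q x"
  using assms by (auto simp: sublin_def)

lemma sublin_zero: "sublin q \<Longrightarrow> q 0 = 0"
  using sublinD(3)[of q 0 0] zero_mem smul_zero_right by auto

lemma sublin_neg: "sublin q \<Longrightarrow> x \<in> carrier V \<Longrightarrow> - q (- x) \<le> q x"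
  using sublinD(2)[of q x "-x"] uminus_mem[of x] sublin_zero[of q] by auto

context
  fixes q x assumes q: "sublin q" and x: "x \<in> carrier V"
begin

text \<open>Subadditivity for \<open>(y + t x) + (- y) = t x\<close>. This keeps the infimum in
  \<open>lower\<close> finite.\<close>

lemma lower_lb:
  assumes "y \<in> carrier V" "0 \<le> t"
  shows "- q (- y) \<le> q (y + rsm t x) - t * q x"
  using sublinD(2)[OF q, of "y + rsm t x" "- y"] sublinD(3)[OF q x assms(2)] assms x
  by (simp add: add_mem smul_mem uminus_mem)

lemma lower_bdd:
  assumes "y \<in> carrier V"
  shows "bdd_below ((\<lambda>t. q (y + rsm t x) - t * q x) ` {0..})"
  using lower_lb[OF assms] by (intro bdd_belowI2) auto

lemma lower_upper:
  assumes "y \<in> carrier V" "0 \<le> t"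
  shows "lower q x y \<le> q (y + rsm t x) - t * q x"
  using assms lower_bdd by (auto simp: lower_def intro!: cINF_lower)

lemma lower_less_witness:
  assumes "y \<in> carrier V" "lower q x y < e"
  obtains t where "0 \<le> t" "q (y + rsm t x) - t * q x < e"
  using assms cINF_less_iff[OF _ lower_bdd, of y e] by (auto simp: lower_def)

lemma lower_le: "lower q x y \<le> q y"
  using lower_upper[of y 0] x sublinD(1)[OF q, of y] by (auto simp: smul_zero_left lower_def)

lemma lower_neg: "lower q x (- x) \<le> - q x"
  using lower_upper[of "- x" 1] x by (simp add: smul_one uminus_mem sublin_zero[OF q])

lemma lower_add:
  assumes y: "y \<in> carrier V" and z: "z \<in> carrier V"
  shows "lower q x (y + z) \<le> lower q x y + lower q x z"
proof (rule field_le_epsilon)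
  fix e :: real assume e: "0 < e"
  obtain s where s: "0 \<le> s" "q (y + rsm s x) - s * q x < lower q x y + e / 2"
    using lower_less_witness[OF y, of "lower q x y + e / 2"] e by auto
  obtain t where t: "0 \<le> t" "q (z + rsm t x) - t * q x < lower q x z + e / 2"
    using lower_less_witness[OF z, of "lower q x z + e / 2"] e by auto
  \<comment> \<open>The sum of two near-optimal parameters is a competitor for y + z.\<close>
  have eq: "y + z + rsm (s + t) x = (y + rsm s x) + (z + rsm t x)"
    using x by (simp add: smul_add_left algebra_simps)
  have "lower q x (y + z) \<le> q (y + z + rsm (s + t) x) - (s + t) * q x"
    using s t y z by (intro lower_upper add_mem) auto
  also have "\<dots> \<le> q (y + rsm s x) + q (z + rsm t x) - (s + t) * q x"
    unfolding eq using x y z by (intro diff_right_mono sublinD(2)[OF q] add_mem smul_mem) auto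
  also have "\<dots> \<le> lower q x y + lower q x z + e"
    using s t by (simp add: algebra_simps)
  finally show "lower q x (y + z) \<le> lower q x y + lower q x z + e" .
qed

lemma lower_smul_le:
  assumes y: "y \<in> carrier V" and t: "0 < t"
  shows "lower q x (rsm t y) \<le> t * lower q x y"
proof (rule field_le_epsilon)
  fix e :: real assume e: "0 < e"
  obtain s where s: "0 \<le> s" "q (y + rsm s x) - s * q x < lower q x y + e / t"
    using lower_less_witness[OF y, of "lower q x y + e / t"] e t by auto
  have eq: "rsm t y + rsm (t * s) x = rsm t (y + rsm s x)"
    using x y by (simp add: smul_add_right smul_smul smul_mem)
  have "lower q x (rsm t y) \<le> q (rsm t y + rsm (t * s) x) - (t * s) * q x"
    using s t y by (intro lower_upper smul_mem) auto
  also have "\<dots> = t * (q (y + rsm s x) - s * q x)"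
    unfolding eq using x y t sublinD(3)[OF q, of "y + rsm s x" t]
    by (simp add: add_mem smul_mem algebra_simps)
  also have "\<dots> \<le> t * (lower q x y + e / t)"
    using s t by (intro mult_left_mono) auto
  also have "\<dots> = t * lower q x y + e" using t by (simp add: field_simps)
  finally show "lower q x (rsm t y) \<le> t * lower q x y + e" .
qed

lemma lower_zero: "lower q x 0 = 0"
proof (rule antisym)
  show "lower q x 0 \<le> 0" using lower_le[of 0] sublin_zero[OF q] by simp
  show "0 \<le> lower q x 0"
    unfolding lower_def using lower_lb[of 0] zero_mem sublin_zero[OF q]
    by (auto intro!: cINF_greatest)
qed

lemma sublin_lower: "sublin (lower q x)"
  unfolding sublin_def
proof (intro conjI ballI allI impI)
  fix y t assume y: "y \<in> carrier V" and t: "(0::real) \<le> t"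
  show "lower q x (rsm t y) = t * lower q x y"
  proof (cases "t = 0")
    case True then show ?thesis using y by (simp add: smul_zero_left lower_zero)
  next
    case False
    with t have t: "0 < t" by simp
    have "lower q x y = lower q x (rsm (inverse t) (rsm t y))"
      using y t by (simp add: smul_smul smul_one flip: of_real_mult)
    also have "\<dots> \<le> inverse t * lower q x (rsm t y)"
      using y t by (intro lower_smul_le smul_mem) auto
    finally have "t * lower q x y \<le> lower q x (rsm t y)"
      using t by (simp add: field_simps)
    with lower_smul_le[OF y t] show ?thesis by simp
  qed
qed (auto simp: lower_add, simp add: lower_def)

end

text \<open>Zorn's lemma for the reversed order, with the pointwise infimum as bound of a chain. The
  infimum is finite because every \<open>a \<le> p\<close> satisfies
  \<open>- p (- y) \<le> a y\<close>, and subadditive because near-optimal members for y and for z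
  are comparable, so the smaller one serves both.\<close>

lemma sublin_minimal_exists:
  assumes "sublin p"
  shows "\<exists>q. sublin q \<and> q \<le> p \<and> (\<forall>q'. sublin q' \<and> q' \<le> q \<longrightarrow> q' = q)"
proof -
  let ?A = "{q. sublin q \<and> q \<le> p}"
  let ?P = "\<lambda>a b :: 'v \<Rightarrow> real. b \<le> a"
  have "\<exists>m\<in>?A. \<forall>a\<in>?A. ?P m a \<longrightarrow> a = m"
  proof (rule predicate_Zorn)
    show "partial_order_on ?A (relation_of ?P ?A)"
      by (rule partial_order_on_relation_ofI) auto
  next
    fix C assume "C \<in> Chains (relation_of ?P ?A)"
    then have C: "\<And>a. a \<in> C \<Longrightarrow> sublin a \<and> a \<le> p" "\<And>a b. a \<in> C \<Longrightarrow> b \<in> C \<Longrightarrow> a \<le> b \<or> b \<le> a"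
      by (auto simp: Chains_def relation_of_def)
    show "\<exists>u\<in>?A. \<forall>a\<in>C. ?P a u"
    proof (cases "C = {}")
      case True then show ?thesis using assms by auto
    next
      case False
      define u where "u = (\<lambda>y. if y \<in> carrier V then INF a\<in>C. a y else 0)"
      have bdd: "bdd_below ((\<lambda>a. a y) ` C)" if "y \<in> carrier V" for y
      proof (rule bdd_belowI2)
        fix a assume "a \<in> C"
        then have "- p (- y) \<le> - a (- y)" "- a (- y) \<le> a y"
          using C(1)[of a] sublin_neg[of a y] that by (auto simp: le_fun_def)
        then show "- p (- y) \<le> a y" by simp
      qed
      have le: "u y \<le> a y" if "a \<in> C" for a y
        using that bdd C(1)[OF that] sublinD(1)[of a y] by (auto simp: u_def intro!: cINF_lower)
      have wit: "\<exists>a\<in>C. a y < e" if "y \<in> carrier V" "u y < e" for y e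
        using cINF_less_iff[OF False bdd[OF that(1)], of e] that by (auto simp: u_def)
      have add: "u (y + z) \<le> u y + u z" if yz: "y \<in> carrier V" "z \<in> carrier V" for y z
      proof (rule field_le_epsilon)
        fix e :: real assume e: "0 < e"
        obtain a where a: "a \<in> C" "a y < u y + e / 2" using wit[OF yz(1), of "u y + e / 2"] e by auto
        obtain b where b: "b \<in> C" "b z < u z + e / 2" using wit[OF yz(2), of "u z + e / 2"] e by auto
        obtain c where c: "c \<in> C" "c \<le> a" "c \<le> b" using C(2)[OF a(1) b(1)] a b by auto
        have "u (y + z) \<le> c (y + z)" using le c by auto
        also have "\<dots> \<le> c y + c z" using C(1)[OF c(1)] yz by (auto intro: sublinD)
        also have "\<dots> \<le> a y + b z" using c by (auto simp: le_fun_def intro: add_mono)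
        also have "\<dots> \<le> u y + u z + e" using a b by simp
        finally show "u (y + z) \<le> u y + u z + e" .
      qed
      have hom: "u (rsm t y) = t * u y" if y: "y \<in> carrier V" and t: "0 \<le> t" for y t
      proof (cases "t = 0")
        case True
        have "(\<lambda>a. a 0) ` C = {0}" using False C(1) sublin_zero by force
        then have "u 0 = 0" using zero_mem by (simp add: u_def)
        with True y show ?thesis by (simp add: smul_zero_left)
      next
        case False
        with t have t: "0 < t" by simp
        have *: "u (rsm t y) \<le> t * u y" if y: "y \<in> carrier V" and t: "0 < t" for y t
        proof (rule field_le_epsilon)
          fix e :: real assume e: "0 < e"
          obtain a where a: "a \<in> C" "a y < u y + e / t" using wit[OF y, of "u y + e / t"] e t by auto
          have "u (rsm t y) \<le> a (rsm t y)" using le a by auto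
          also have "\<dots> = t * a y" using C(1)[OF a(1)] y t by (auto intro: sublinD)
          also have "\<dots> \<le> t * (u y + e / t)" using a t by (intro mult_left_mono) auto
          also have "\<dots> = t * u y + e" using t by (simp add: field_simps)
          finally show "u (rsm t y) \<le> t * u y + e" .
        qed
        have "u y = u (rsm (inverse t) (rsm t y))"
          using y t by (simp add: smul_smul smul_one flip: of_real_mult)
        also have "\<dots> \<le> inverse t * u (rsm t y)" using y t by (intro * smul_mem) auto
        finally have "t * u y \<le> u (rsm t y)" using t by (simp add: field_simps)
        with *[OF y t] show ?thesis by simp
      qed
      have "sublin u" unfolding sublin_def using add hom by (auto simp: u_def)
      moreover obtain a where "a \<in> C" using False by auto
      then have "u \<le> p" using le[of a] C(1)[of a] by (auto simp: le_fun_def intro: order_trans)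
      ultimately show ?thesis using le by (intro bexI[of _ u]) (auto simp: le_fun_def)
    qed
  qed
  then show ?thesis by (auto intro: order_trans)
qed

lemma sublin_minimal_linear:
  assumes q: "sublin q" and min: "\<And>q'. sublin q' \<Longrightarrow> q' \<le> q \<Longrightarrow> q' = q"
  shows "x \<in> carrier V \<Longrightarrow> q (- x) = - q x"
    and "x \<in> carrier V \<Longrightarrow> y \<in> carrier V \<Longrightarrow> q (x + y) = q x + q y"
    and "x \<in> carrier V \<Longrightarrow> q (rsm t x) = t * q x"
proof -
  have neg: "q (- x) = - q x" if x: "x \<in> carrier V" for x
  proof -
    have "lower q x = q"
      using sublin_lower[OF q x] lower_le[OF q x] by (intro min) (auto simp: le_fun_def)
    then show ?thesis using lower_neg[OF q x] sublin_neg[OF q x] by simp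
  qed
  show "x \<in> carrier V \<Longrightarrow> q (- x) = - q x" by (rule neg)
  show "q (x + y) = q x + q y" if x: "x \<in> carrier V" and y: "y \<in> carrier V"
  proof (rule antisym)
    have "q x \<le> q (x + y) + q (- y)"
      using sublinD(2)[OF q, of "x + y" "- y"] x y by (simp add: add_mem uminus_mem)
    then show "q x + q y \<le> q (x + y)" using neg[OF y] by simp
  qed (use sublinD(2)[OF q x y] in simp)
  show "q (rsm t x) = t * q x" if x: "x \<in> carrier V"
  proof (cases "0 \<le> t")
    case True then show ?thesis using sublinD(3)[OF q x] by simp
  next
    case False
    have "rsm t x = - rsm (- t) x"
      using smul_minus_one[of "rsm (- t) x"] x by (simp add: smul_smul smul_mem)
    then show ?thesis using neg[of "rsm (- t) x"] sublinD(3)[OF q x, of "- t"] x False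
      by (simp add: smul_mem)
  qed
qed

text \<open>Minimality is taken below \<open>lower p x\<close> rather than below \<open>p\<close>:
  since \<open>lower p x (- x) \<le> - p x\<close>, the resulting linear functional is forced to
  attain \<open>nrm V x\<close> at x.\<close>

lemma hahn_banach_real:
  assumes x: "x \<in> carrier V"
  obtains g where "\<And>y z. y \<in> carrier V \<Longrightarrow> z \<in> carrier V \<Longrightarrow> g (y + z) = g y + g z"
    and "\<And>y t. y \<in> carrier V \<Longrightarrow> g (rsm t y) = t * g y"
    and "\<And>y. y \<in> carrier V \<Longrightarrow> g y \<le> nrm V y"
    and "g x = nrm V x"
proof -
  define p where "p y = (if y \<in> carrier V then nrm V y else 0)" for y
  have p: "sublin p"
    unfolding sublin_def p_def by (auto simp: add_mem smul_mem nrm_triangle nrm_smul)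
  obtain q where q: "sublin q" "q \<le> lower p x" and min: "\<And>q'. sublin q' \<Longrightarrow> q' \<le> q \<Longrightarrow> q' = q"
    using sublin_minimal_exists[OF sublin_lower[OF p x]] by auto
  have le: "q y \<le> nrm V y" if "y \<in> carrier V" for y
    using q(2) lower_le[OF p x, of y] that by (auto simp: le_fun_def p_def intro: order_trans)
  have "q (- x) \<le> - nrm V x"
    using q(2) lower_neg[OF p x] x by (auto simp: le_fun_def p_def intro: order_trans)
  then have "q x = nrm V x" using sublin_minimal_linear(1)[OF q(1) min x] le[OF x] by simp
  then show ?thesis using sublin_minimal_linear(2,3)[OF q(1) min] le by (intro that[of q]) auto
qed

lemma hahn_banach:
  assumes x0: "x0 \<in> carrier V"
  obtains f where "f \<in> carrier (dual V)" "nrm (dual V) f \<le> 1" "f x0 = of_real (nrm V x0)"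
proof -
  obtain g where g_add: "\<And>y z. y \<in> carrier V \<Longrightarrow> z \<in> carrier V \<Longrightarrow> g (y + z) = g y + g z"
    and g_sm: "\<And>y t. y \<in> carrier V \<Longrightarrow> g (rsm t y) = t * g y"
    and g_le: "\<And>y. y \<in> carrier V \<Longrightarrow> g y \<le> nrm V y"
    and g_x0: "g x0 = nrm V x0"
    using hahn_banach_real[OF x0] by metis
  obtain i :: 'k where i: "i = 0 \<or> (i * i = - 1 \<and> (\<forall>a b. norm (a *\<^sub>R 1 + b *\<^sub>R i) = sqrt (a\<^sup>2 + b\<^sup>2)))"
    and gen: "\<And>z. \<exists>a b. z = a *\<^sub>R 1 + b *\<^sub>R i"
    using rc_scalar_cases by blast
  \<comment> \<open>The usual complexification of a real functional; for i = 0 the second term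
    vanishes, so one formula serves both scalar fields.\<close>
  define f where "f y = (if y \<in> carrier V then of_real (g y) - i * of_real (g (smul V i y)) else 0)" for y
  have g0: "g 0 = 0" using g_sm[of 0 0] zero_mem by (simp add: smul_zero_right)
  have g_neg: "g (- y) = - g y" if "y \<in> carrier V" for y
    using g_sm[OF that, of "-1"] smul_minus_one[OF that] by simp
  have f_add: "f (y + z) = f y + f z" if "y \<in> carrier V" "z \<in> carrier V" for y z
    using that by (simp add: f_def add_mem smul_mem g_add smul_add_right algebra_simps)
  have f_real: "f (rsm t y) = of_real t * f y" if y: "y \<in> carrier V" for y t
  proof -
    have "smul V i (rsm t y) = rsm t (smul V i y)" using y by (simp add: smul_smul mult.commute)
    then show ?thesis using y by (simp add: f_def smul_mem g_sm algebra_simps)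
  qed
  have f_i: "f (smul V i y) = i * f y" if y: "y \<in> carrier V" for y
  proof (cases "i = 0")
    case True then show ?thesis using y by (simp add: f_def smul_zero_left smul_mem g0 zero_mem)
  next
    case False
    with i have ii: "i * i = - 1" by auto
    have "smul V i (smul V i y) = - y" using y by (simp add: smul_smul ii smul_minus_one)
    moreover have "i * (i * of_real (g (smul V i y))) = - of_real (g (smul V i y))"
      by (simp add: ii flip: mult.assoc)
    ultimately show ?thesis using y by (simp add: f_def smul_mem g_neg algebra_simps)
  qed
  have f_smul: "f (smul V c y) = c * f y" if y: "y \<in> carrier V" for y c
  proof -
    obtain a b where c: "c = a *\<^sub>R 1 + b *\<^sub>R i" using gen by blast
    then have c: "c = of_real a + of_real b * i" by (simp add: scaleR_conv_of_real)
    have "smul V c y = rsm a y + rsm b (smul V i y)"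
      using y by (simp add: c smul_add_left smul_smul)
    then show ?thesis using y f_real[of "smul V i y" b]
      by (simp add: f_add f_real f_i smul_mem c algebra_simps)
  qed
  \<comment> \<open>Comparison of real parts: for i \<noteq> 0 the norm formula makes 1 and i
    linearly independent over the reals.\<close>
  have real_val: "g y = r" if y: "y \<in> carrier V" and fy: "f y = of_real r" for y r
  proof (cases "i = 0")
    case True
    then have "f y = of_real (g y)" using y by (simp add: f_def)
    then show ?thesis using fy by (metis of_real_eq_iff)
  next
    case False
    with i have nn: "norm (a *\<^sub>R 1 + b *\<^sub>R i) = sqrt (a\<^sup>2 + b\<^sup>2)" for a b by auto
    have "of_real (g y) - i * of_real (g (smul V i y)) = of_real r" using fy y by (simp add: f_def)
    then have "(g y - r) *\<^sub>R 1 + (- g (smul V i y)) *\<^sub>R i = 0"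
      by (simp add: scaleR_conv_of_real algebra_simps)
    then have "sqrt ((g y - r)\<^sup>2 + (- g (smul V i y))\<^sup>2) = 0" using nn[of "g y - r" "- g (smul V i y)"] by simp
    then show ?thesis by (simp add: sum_power2_eq_zero_iff)
  qed
  have f_le: "norm (f y) \<le> 1 * nrm V y" if y: "y \<in> carrier V" for y
  proof (cases "f y = 0")
    case True then show ?thesis using nrm_nonneg[OF y] by simp
  next
    case False
    \<comment> \<open>A unimodular factor rotates \<open>f y\<close> onto the nonnegative reals,
      where f coincides with g and the bound for g applies.\<close>
    define u where "u = of_real (norm (f y)) / f y"
    have nu: "norm u = 1" using False by (simp add: u_def norm_divide)
    have "f (smul V u y) = of_real (norm (f y))" using False y by (simp add: f_smul u_def)
    then have "norm (f y) = g (smul V u y)" using real_val[of "smul V u y"] y by (simp add: smul_mem)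
    also have "\<dots> \<le> nrm V (smul V u y)" using y by (intro g_le smul_mem)
    also have "\<dots> = nrm V y" using nu y by (simp add: nrm_smul)
    finally show ?thesis by simp
  qed
  have f: "f \<in> carrier (dual V)"
    using f_add f_smul f_le by (intro dualI[where M = 1]) (auto simp: f_def)
  have "f x0 = of_real (nrm V x0)"
  proof -
    \<comment> \<open>The real part of \<open>f x0\<close> already has modulus
      \<open>nrm V x0\<close>, so this bound leaves no room for an imaginary part.\<close>
    have 1: "norm (f x0) \<le> nrm V x0" using f_le[OF x0] by simp
    show ?thesis
    proof (cases "i = 0")
      case True then show ?thesis using x0 by (simp add: f_def g_x0)
    next
      case False
      with i have nn: "norm (a *\<^sub>R 1 + b *\<^sub>R i) = sqrt (a\<^sup>2 + b\<^sup>2)" for a b by auto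
      have eq: "f x0 = g x0 *\<^sub>R 1 + (- g (smul V i x0)) *\<^sub>R i"
        using x0 by (simp add: f_def scaleR_conv_of_real mult.commute)
      have "sqrt ((nrm V x0)\<^sup>2 + (- g (smul V i x0))\<^sup>2) \<le> nrm V x0"
        using 1 unfolding eq nn by (simp add: g_x0)
      then have "(nrm V x0)\<^sup>2 + (- g (smul V i x0))\<^sup>2 \<le> (nrm V x0)\<^sup>2"
        using nrm_nonneg[OF x0] by (metis real_sqrt_le_iff real_sqrt_unique)
      then have "g (smul V i x0) = 0" by simp
      then show ?thesis using x0 by (simp add: f_def g_x0)
    qed
  qed
  moreover have "nrm (dual V) f \<le> 1" using f_le by (intro dual_nrm_le) auto
  ultimately show ?thesis using f that by blast
qed

end

section \<open>Weak topologies and measures of weak non-compactness\<close>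

text \<open>The ball is a closed part of the image of a square under (a, b) \<mapsto> a + b i. For i
  = 0 the coordinate b of a scalar is arbitrary and is replaced by 0.\<close>

lemma compact_cball_rc_scalar: "compact (cball (0::'k::rc_scalar) M)"
proof -
  obtain i :: 'k where i: "i = 0 \<or> (i * i = - 1 \<and> (\<forall>a b. norm (a *\<^sub>R 1 + b *\<^sub>R i) = sqrt (a\<^sup>2 + b\<^sup>2)))"
    and gen: "\<And>z. \<exists>a b. z = a *\<^sub>R 1 + b *\<^sub>R i"
    using rc_scalar_cases by blast
  define h where "h = (\<lambda>(a::real, b::real). a *\<^sub>R 1 + b *\<^sub>R i)"
  have "compact (h ` ({-M..M} \<times> {-M..M}))"
    unfolding h_def split_def
    by (intro compact_continuous_image continuous_intros compact_Times compact_Icc)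
  moreover have "cball 0 M \<subseteq> h ` ({-M..M} \<times> {-M..M})"
  proof
    fix z :: 'k assume "z \<in> cball 0 M"
    then have z: "norm z \<le> M" by simp
    obtain a b where ab: "z = a *\<^sub>R 1 + b *\<^sub>R i" using gen by blast
    show "z \<in> h ` ({-M..M} \<times> {-M..M})"
    proof (cases "i = 0")
      case True
      then have "\<bar>a\<bar> \<le> M" "0 \<le> M" using z ab by (auto intro: order_trans[OF norm_ge_zero])
      then show ?thesis using True ab by (intro image_eqI[of _ _ "(a, 0)"]) (auto simp: h_def)
    next
      case False
      then have "sqrt (a\<^sup>2 + b\<^sup>2) \<le> M" using i z ab by auto
      moreover have "\<bar>a\<bar> \<le> sqrt (a\<^sup>2 + b\<^sup>2)" "\<bar>b\<bar> \<le> sqrt (a\<^sup>2 + b\<^sup>2)" by auto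
      ultimately have "\<bar>a\<bar> \<le> M" "\<bar>b\<bar> \<le> M" by linarith+
      then show ?thesis using ab by (intro image_eqI[of _ _ "(a, b)"]) (auto simp: h_def)
    qed
  qed
  ultimately show ?thesis
    using closed_Int_compact[OF closed_cball, of _ 0 M] by (metis inf.absorb_iff1)
qed

section \<open>Initial topologies and cluster points\<close>

lemma openin_initial_topology:
  "f \<in> F \<Longrightarrow> open U \<Longrightarrow> openin (initial_topology S F) {x \<in> S. f x \<in> U}"
  unfolding initial_topology_def by (rule topology_generated_by_Basis) auto

lemma topspace_initial_topology:
  assumes "F \<noteq> {}" shows "topspace (initial_topology S F) = S"
proof -
  obtain f where "f \<in> F" using assms by auto
  then have "S \<in> {{x \<in> S. f x \<in> U} | f U. f \<in> F \<and> open U}"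
    by (auto intro!: exI[of _ f] exI[of _ UNIV])
  then have "S \<subseteq> \<Union>{{x \<in> S. f x \<in> U} | f U. f \<in> F \<and> open U}"
    by (rule Union_upper)
  moreover have "\<Union>{{x \<in> S. f x \<in> U} | f U. f \<in> F \<and> open U} \<subseteq> S"
    by (intro Union_least subsetI) (elim CollectE exE conjE, simp)
  ultimately show ?thesis
    unfolding initial_topology_def topology_generated_by_topspace by simp
qed

lemma closedin_initial_topology:
  assumes "f \<in> F" "closed C"
  shows "closedin (initial_topology S F) {x \<in> S. f x \<in> C}"
proof -
  have "openin (initial_topology S F) {x \<in> S. f x \<in> - C}"
    using assms by (intro openin_initial_topology) auto
  moreover have "{x \<in> S. f x \<in> - C} = S - {x \<in> S. f x \<in> C}" by auto
  moreover have "topspace (initial_topology S F) = S"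
    using assms(1) by (intro topspace_initial_topology) auto
  ultimately show ?thesis unfolding closedin_def by auto
qed

lemma continuous_map_initial_topology:
  assumes "F \<noteq> {}" "\<And>x. x \<in> topspace T \<Longrightarrow> h x \<in> S"
    and "\<And>f U. f \<in> F \<Longrightarrow> open U \<Longrightarrow> openin T {x \<in> topspace T. f (h x) \<in> U}"
  shows "continuous_map T (initial_topology S F) h"
  unfolding initial_topology_def
proof (rule continuous_on_generated_topo)
  fix U assume "U \<in> {{x \<in> S. f x \<in> U} | f U. f \<in> F \<and> open U}"
  then obtain f W where fW: "U = {x \<in> S. f x \<in> W}" "f \<in> F" "open W" by auto
  have "h -` U \<inter> topspace T = {x \<in> topspace T. f (h x) \<in> W}" using assms(2) fW by auto
  then show "openin T (h -` U \<inter> topspace T)" using assms(3)[OF fW(2,3)] by simp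
next
  have "\<Union>{{x \<in> S. f x \<in> U} | f U. f \<in> F \<and> open U} = S"
    using topspace_initial_topology[OF assms(1)]
    unfolding initial_topology_def topology_generated_by_topspace .
  then show "h ` topspace T \<subseteq> \<Union>{{x \<in> S. f x \<in> U} | f U. f \<in> F \<and> open U}"
    using assms(2) by auto
qed

lemma compactin_fipD:
  assumes "compactin X S" "\<And>C. C \<in> \<U> \<Longrightarrow> closedin X C"
    and "\<And>\<F>. finite \<F> \<Longrightarrow> \<F> \<subseteq> \<U> \<Longrightarrow> S \<inter> \<Inter>\<F> \<noteq> {}"
  shows "S \<inter> \<Inter>\<U> \<noteq> {}"
  using assms by (simp add: compactin_fip)

text \<open>The closures of the tails of the sequence have the finite intersection property on K,
  and a point common to all of them is a cluster point.\<close>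

lemma cluster_points_nonempty:
  assumes K: "compactin T K" and s: "\<And>n. s n \<in> K"
  shows "cluster_points T s \<noteq> {}"
proof -
  define cl where "cl m = T closure_of (s ` {m..})" for m :: nat
  have sub: "s ` {m..} \<subseteq> topspace T" for m
    using compactin_subset_topspace[OF K] s by auto
  have ne: "K \<inter> \<Inter>\<F> \<noteq> {}" if fin: "finite \<F>" and F: "\<F> \<subseteq> range cl" for \<F>
  proof -
    obtain I where I: "finite I" "\<F> = cl ` I"
      using finite_subset_image[OF fin F] by blast
    define m where "m = Max (insert 0 I)"
    have "s m \<in> cl i" if "i \<in> I" for i
    proof -
      have "i \<le> m" unfolding m_def using I that by (intro Max_ge) auto
      then show ?thesis unfolding cl_def using closure_of_subset[OF sub[of i]] by auto
    qed
    then show ?thesis using I s by auto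
  qed
  have "K \<inter> \<Inter>(range cl) \<noteq> {}"
    by (rule compactin_fipD[OF K _ ne]) (auto simp: cl_def)
  then obtain a where a: "a \<in> K" "\<And>m. a \<in> cl m" by auto
  have "\<exists>\<^sub>\<infinity>n. s n \<in> U" if "openin T U" "a \<in> U" for U
    unfolding INFM_nat_le using a(2) that by (auto simp: cl_def in_closure_of)
  then have "a \<in> cluster_points T s"
    using a compactin_subset_topspace[OF K] by (auto simp: cluster_points_def)
  then show ?thesis by auto
qed

context seminormed
begin

lemma weak_star_nonempty: "(\<lambda>x f. f x) ` carrier V \<noteq> {}"
  using zero_mem by auto

lemma topspace_weak_star: "topspace (weak_star_topology V) = carrier (dual V)"
  unfolding weak_star_topology_def by (rule topspace_initial_topology[OF weak_star_nonempty])

lemma openin_weak_star: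
  "x \<in> carrier V \<Longrightarrow> open U \<Longrightarrow> openin (weak_star_topology V) {f \<in> carrier (dual V). f x \<in> U}"
  unfolding weak_star_topology_def
  using openin_initial_topology[of "\<lambda>f. f x" "(\<lambda>x f. f x) ` carrier V"] by auto

text \<open>The ball is a closed subset, cut out by the linearity equations, of a product of discs.
  Outside the carrier the factor is {0}, so the total functions representing functionals live in one
  product over the whole type. Evaluations are continuous for the product topology, hence the
  identity carries compactness over to the weak-star topology.\<close>

theorem banach_alaoglu:
  "compactin (weak_star_topology V) {f \<in> carrier (dual V). nrm (dual V) f \<le> M}"
proof (cases "0 \<le> M")
  case False
  then have "{f \<in> carrier (dual V). nrm (dual V) f \<le> M} = {}"
    using dual_nrm_nonneg by fastforce
  then show ?thesis by (simp only: compactin_empty)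
next
  case M: True
  let ?B = "{f \<in> carrier (dual V). nrm (dual V) f \<le> M}"
  define S where "S x = (if x \<in> carrier V then cball (0::'k) (M * nrm V x) else {0})" for x
  define A where "A = (\<Inter>x\<in>carrier V. \<Inter>y\<in>carrier V. {f :: 'v \<Rightarrow> 'k. f (x + y) = f x + f y})"
  define H where "H = (\<Inter>c. \<Inter>x\<in>carrier V. {f :: 'v \<Rightarrow> 'k. f (smul V c x) = c * f x})"
  have coord: "continuous_on UNIV (\<lambda>f :: 'v \<Rightarrow> 'k. f x)" for x
    by (rule continuous_on_product_coordinates)
  have "closed A" "closed H"
    unfolding A_def H_def
    by (intro closed_INT ballI closed_Collect_eq continuous_on_add continuous_on_mult
        continuous_on_const coord)+
  moreover have "compactin (product_topology (\<lambda>_. euclidean) UNIV) (PiE UNIV S)"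
    unfolding compactin_PiE by (auto simp: S_def compact_cball_rc_scalar)
  then have "compact (PiE UNIV S)"
    by (simp add: euclidean_product_topology)
  ultimately have "compact (PiE UNIV S \<inter> A \<inter> H)"
    by (intro compact_Int_closed)
  moreover have "PiE UNIV S \<inter> A \<inter> H = ?B"
  proof (intro equalityI subsetI)
    fix f assume f: "f \<in> PiE UNIV S \<inter> A \<inter> H"
    then have S: "\<And>x. f x \<in> S x" by auto
    have le: "norm (f x) \<le> M * nrm V x" if "x \<in> carrier V" for x
      using S[of x] that by (simp add: S_def)
    have "f \<in> carrier (dual V)"
    proof (rule dualI[OF _ _ _ le])
      show "f x = 0" if "x \<notin> carrier V" for x using S[of x] that by (simp add: S_def)
    qed (use f in \<open>auto simp: A_def H_def\<close>)
    then show "f \<in> ?B" using le M by (auto intro: dual_nrm_le)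
  next
    fix f assume f: "f \<in> ?B"
    have "f x \<in> S x" for x
    proof (cases "x \<in> carrier V")
      case True
      have "norm (f x) \<le> nrm (dual V) f * nrm V x" using f True by (intro dual_bound) auto
      also have "\<dots> \<le> M * nrm V x" using f nrm_nonneg[OF True] by (intro mult_right_mono) auto
      finally show ?thesis using True by (simp add: S_def)
    qed (use f dual_outside in \<open>auto simp: S_def\<close>)
    then show "f \<in> PiE UNIV S \<inter> A \<inter> H" using f by (auto simp: A_def H_def dual_add dual_smul)
  qed
  ultimately have B: "compact ?B" by simp
  have "continuous_map (subtopology euclidean (carrier (dual V))) (weak_star_topology V) (\<lambda>f. f)"
    unfolding weak_star_topology_def
  proof (rule continuous_map_initial_topology[OF weak_star_nonempty])
    fix g :: "('v \<Rightarrow> 'k) \<Rightarrow> 'k" and U :: "'k set"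
    assume "g \<in> (\<lambda>x f. f x) ` carrier V" and U: "open U"
    then obtain x where g: "g = (\<lambda>f. f x)" by auto
    have "open ((\<lambda>f :: 'v \<Rightarrow> 'k. f x) -` U)" by (rule open_vimage[OF U coord])
    then have "openin (subtopology euclidean (carrier (dual V))) (carrier (dual V) \<inter> (\<lambda>f. f x) -` U)"
      by (rule openin_open_Int)
    then show "openin (subtopology euclidean (carrier (dual V)))
        {f \<in> topspace (subtopology euclidean (carrier (dual V))). g f \<in> U}"
      by (simp add: g Int_def vimage_def)
  qed simp
  moreover have "compactin (subtopology euclidean (carrier (dual V))) ?B"
    using B by (auto simp: compactin_subtopology)
  ultimately have "compactin (weak_star_topology V) ((\<lambda>f. f) ` ?B)"
    by (rule image_compactin[rotated])
  then show ?thesis by simp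
qed

lemma topspace_weak: "topspace (weak_topology V) = carrier V"
proof -
  have "carrier (dual V) \<noteq> {}"
    using seminormed.zero_mem[OF dual_seminormed] by auto
  then show ?thesis unfolding weak_topology_def by (rule topspace_initial_topology)
qed

lemma weakly_compact_singleton: "x \<in> carrier V \<Longrightarrow> compactin (weak_topology V) {x}"
  by (simp add: compactin_sing topspace_weak)

text \<open>The weak topology is the weak\<open>*\<close> topology of the bidual pulled back along \<open>canon V\<close>, so
  subsets of the bidual inside the range of \<open>canon V\<close> transport compactness; as the seminorm may
  have a kernel, \<open>canon V\<close> is only injective up to norm zero.\<close>

lemma weakly_compact_annihilator:
  assumes G: "G \<subseteq> carrier (dual V)"
    and canon: "\<And>\<psi>. \<psi> \<in> carrier (dual (dual V)) \<Longrightarrow> (\<forall>\<phi>\<in>G. \<psi> \<phi> = 0) \<Longrightarrow> \<psi> \<in> canon V ` carrier V"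
  obtains K where "K \<subseteq> carrier V" "compactin (weak_topology V) K"
    "\<And>v. v \<in> carrier V \<Longrightarrow> nrm V v \<le> M \<Longrightarrow> (\<And>\<phi>. \<phi> \<in> G \<Longrightarrow> \<phi> v = 0) \<Longrightarrow> \<exists>k\<in>K. nrm V (v - k) = 0"
proof -
  interpret D: seminormed "dual V" by (rule dual_seminormed)
  let ?W = "weak_star_topology (dual V)"
  \<comment> \<open>Intersecting with \<open>topspace ?W\<close> keeps the second factor a closed
    set also when G is empty.\<close>
  define B where "B = {\<psi> \<in> carrier (dual (dual V)). nrm (dual (dual V)) \<psi> \<le> M} \<inter>
    (topspace ?W \<inter> (\<Inter>\<phi>\<in>G. {\<psi> \<in> carrier (dual (dual V)). \<psi> \<phi> \<in> {0}}))"
  have "closedin ?W {\<psi> \<in> carrier (dual (dual V)). \<psi> \<phi> \<in> {0}}" if "\<phi> \<in> G" for \<phi>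
    unfolding weak_star_topology_def using that G
    by (intro closedin_initial_topology[where f = "\<lambda>\<psi>. \<psi> \<phi>"]) auto
  then have "closedin ?W (topspace ?W \<inter> (\<Inter>\<phi>\<in>G. {\<psi> \<in> carrier (dual (dual V)). \<psi> \<phi> \<in> {0}}))"
    by (cases "G = {}") (auto intro!: closedin_Int closedin_INT)
  then have B: "compactin ?W B"
    unfolding B_def by (rule compact_Int_closedin[OF D.banach_alaoglu])
  define r where "r \<psi> = (SOME x. x \<in> carrier V \<and> canon V x = \<psi>)" for \<psi>
  have r: "r \<psi> \<in> carrier V \<and> canon V (r \<psi>) = \<psi>" if "\<psi> \<in> B" for \<psi>
  proof -
    have "\<psi> \<in> canon V ` carrier V" using that by (intro canon) (auto simp: B_def)
    then show ?thesis unfolding r_def by (intro someI_ex[of "\<lambda>x. x \<in> carrier V \<and> canon V x = \<psi>"]) auto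
  qed
  \<comment> \<open>Whichever preimage r picks, \<open>\<phi> (r \<psi>) = \<psi> \<phi>\<close>;
    weak continuity depends on these values alone.\<close>
  have "continuous_map (subtopology ?W B) (weak_topology V) r"
    unfolding weak_topology_def
  proof (rule continuous_map_initial_topology)
    show "carrier (dual V) \<noteq> {}" using D.zero_mem by auto
  next
    fix \<phi> and U :: "'k set" assume \<phi>: "\<phi> \<in> carrier (dual V)" and U: "open U"
    have BS: "B \<subseteq> carrier (dual (dual V))" by (auto simp: B_def)
    have "openin (subtopology ?W B) ({\<psi> \<in> carrier (dual (dual V)). \<psi> \<phi> \<in> U} \<inter> B)"
      by (rule openin_subtopology_Int[OF D.openin_weak_star[OF \<phi> U]])
    moreover have "{\<psi> \<in> carrier (dual (dual V)). \<psi> \<phi> \<in> U} \<inter> B = {\<psi> \<in> topspace (subtopology ?W B). \<phi> (r \<psi>) \<in> U}"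
    proof -
      have "\<phi> (r \<psi>) = \<psi> \<phi>" if "\<psi> \<in> B" for \<psi> using r[OF that] canon_apply[OF \<phi>] by metis
      then show ?thesis using BS by (auto simp: D.topspace_weak_star)
    qed
    ultimately show "openin (subtopology ?W B) {\<psi> \<in> topspace (subtopology ?W B). \<phi> (r \<psi>) \<in> U}"
      by simp
  qed (use r in auto)
  moreover have "compactin (subtopology ?W B) B" using B by (simp add: compactin_subtopology)
  ultimately have K: "compactin (weak_topology V) (r ` B)" by (rule image_compactin[rotated])
  show thesis
  proof (rule that[OF _ K])
    show "r ` B \<subseteq> carrier V" using r by auto
  next
    fix v assume v: "v \<in> carrier V" "nrm V v \<le> M" "\<And>\<phi>. \<phi> \<in> G \<Longrightarrow> \<phi> v = 0"
    have vB: "canon V v \<in> B"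
      using v canon_mem[OF v(1)] G by (auto simp: B_def D.topspace_weak_star canon_def)
    have "nrm V (v - r (canon V v)) = 0"
    proof -
      have mem: "v - r (canon V v) \<in> carrier V" using r[OF vB] v by (auto intro: diff_mem)
      \<comment> \<open>A norming functional of the difference vanishes on it, because both vectors
        have the same canonical image.\<close>
      obtain \<phi> where \<phi>: "\<phi> \<in> carrier (dual V)" "\<phi> (v - r (canon V v)) = of_real (nrm V (v - r (canon V v)))"
        using hahn_banach[OF mem] by metis
      have "\<phi> (r (canon V v)) = \<phi> v"
        using r[OF vB] canon_apply[OF \<phi>(1)] by metis
      then show ?thesis using \<phi> dual_diff[OF \<phi>(1) v(1), of "r (canon V v)"] r[OF vB] by simp
    qed
    then show "\<exists>k\<in>r ` B. nrm V (v - k) = 0" using vB by auto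
  qed
qed

subsection \<open>Distances\<close>

lemma pt_dist_le:
  assumes "a \<in> carrier V" "B \<subseteq> carrier V" "b \<in> B"
  shows "pt_dist V a B \<le> nrm V (a - b)"
  unfolding pt_dist_def using assms
  by (intro cINF_lower bdd_belowI2[where m = 0]) (auto intro!: nrm_nonneg diff_mem)

lemma pt_dist_nonneg:
  assumes "a \<in> carrier V" "B \<subseteq> carrier V" "B \<noteq> {}"
  shows "0 \<le> pt_dist V a B"
  unfolding pt_dist_def using assms by (intro cINF_greatest) (auto intro!: nrm_nonneg diff_mem)

lemma pt_dist_less:
  assumes "a \<in> carrier V" "B \<subseteq> carrier V" "B \<noteq> {}" "pt_dist V a B < e"
  obtains b where "b \<in> B" "nrm V (a - b) < e"
proof -
  have "bdd_below ((\<lambda>b. nrm V (a - b)) ` B)"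
    using assms by (intro bdd_belowI2[where m = 0]) (auto intro!: nrm_nonneg diff_mem)
  then show ?thesis using assms that unfolding pt_dist_def by (auto simp: cINF_less_iff)
qed

lemma bdd_dhat:
  assumes A: "bounded_in V A" and B: "B \<subseteq> carrier V" "B \<noteq> {}"
  shows "bdd_above ((\<lambda>a. pt_dist V a B) ` A)"
proof -
  obtain M where M: "A \<subseteq> carrier V" "\<And>a. a \<in> A \<Longrightarrow> nrm V a \<le> M" using A by (auto simp: bounded_in_def)
  obtain b where b: "b \<in> B" using B by auto
  show ?thesis
  proof (rule bdd_aboveI2)
    fix a assume a: "a \<in> A"
    have "pt_dist V a B \<le> nrm V (a - b)" using a b B M by (intro pt_dist_le) auto
    also have "\<dots> \<le> M + nrm V b" using nrm_diff_le[of a b] a b B M by fastforce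
    finally show "pt_dist V a B \<le> M + nrm V b" .
  qed
qed

lemma pt_dist_le_dhat:
  "bounded_in V A \<Longrightarrow> B \<subseteq> carrier V \<Longrightarrow> B \<noteq> {} \<Longrightarrow> a \<in> A \<Longrightarrow> pt_dist V a B \<le> dhat V A B"
  unfolding dhat_def by (intro cSUP_upper bdd_dhat)

lemma dhat_le: "A \<noteq> {} \<Longrightarrow> (\<And>a. a \<in> A \<Longrightarrow> pt_dist V a B \<le> c) \<Longrightarrow> dhat V A B \<le> c"
  unfolding dhat_def by (intro cSUP_least)

lemma dhat_nonneg:
  assumes "bounded_in V A" "A \<noteq> {}" "B \<subseteq> carrier V" "B \<noteq> {}"
  shows "0 \<le> dhat V A B"
proof -
  obtain a where "a \<in> A" using assms by auto
  then show ?thesis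
    using pt_dist_le_dhat[OF assms(1,3,4)] pt_dist_nonneg[OF _ assms(3,4)] assms(1)
    by (force simp: bounded_in_def)
qed

section \<open>Inequalities between the measures of weak non-compactness\<close>

context
  fixes A assumes A: "bounded_in V A" "A \<noteq> {}"
begin

lemma omega_nc_le:
  assumes "K \<subseteq> carrier V" "compactin (weak_topology V) K" "K \<noteq> {}"
  shows "omega_nc V A \<le> dhat V A K"
  unfolding omega_nc_def using assms A
  by (intro cINF_lower bdd_belowI2[where m = 0]) (auto intro!: dhat_nonneg)

lemma omega_nc_ge:
  assumes "\<And>K. K \<subseteq> carrier V \<Longrightarrow> compactin (weak_topology V) K \<Longrightarrow> K \<noteq> {} \<Longrightarrow> c \<le> dhat V A K"
  shows "c \<le> omega_nc V A"
  unfolding omega_nc_def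
proof (rule cINF_greatest)
  show "{K. K \<subseteq> carrier V \<and> compactin (weak_topology V) K \<and> K \<noteq> {}} \<noteq> {}"
    using weakly_compact_singleton[OF zero_mem] zero_mem by (auto intro!: exI[of _ "{0}"])
qed (use assms in auto)

lemma canon_image_subset: "canon V ` carrier V \<subseteq> carrier (dual (dual V))"
  using canon_mem by auto

lemma canon_image_nonempty: "canon V ` carrier V \<noteq> {}"
  using zero_mem by auto

lemma A_subset: "A \<subseteq> carrier V"
  using A by (simp add: bounded_in_def)

abbreviation wcl :: "(('v \<Rightarrow> 'k) \<Rightarrow> 'k) set" where
  "wcl \<equiv> weak_star_topology (dual V) closure_of (canon V ` A)"

text \<open>Each pair in G is a functional with a tolerance; finitely many of them cut out a basic
  weak-star neighbourhood of \<psi>, which must meet the canonical image of A.\<close>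

lemma wcl_approx:
  assumes \<psi>: "\<psi> \<in> wcl" and G: "finite G" "\<And>\<phi> d. (\<phi>, d) \<in> G \<Longrightarrow> \<phi> \<in> carrier (dual V) \<and> 0 < d"
  obtains a where "a \<in> A" "\<And>\<phi> d. (\<phi>, d) \<in> G \<Longrightarrow> norm (\<psi> \<phi> - \<phi> a) < d"
proof -
  interpret D: seminormed "dual V" by (rule dual_seminormed)
  let ?W = "weak_star_topology (dual V)"
  define U where "U = (\<Inter>(\<phi>, d)\<in>G. {\<psi>' \<in> carrier (dual (dual V)). \<psi>' \<phi> \<in> ball (\<psi> \<phi>) d}) \<inter> topspace ?W"
  have "openin ?W U"
    unfolding U_def
  proof (rule openin_INT[OF G(1)])
    fix x assume x: "x \<in> G"
    obtain \<phi> d where "x = (\<phi>, d)" by force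
    then show "openin ?W (case x of (\<phi>, d) \<Rightarrow> {\<psi>' \<in> carrier (dual (dual V)). \<psi>' \<phi> \<in> ball (\<psi> \<phi>) d})"
      using x G(2)[of \<phi> d] D.openin_weak_star[of \<phi> "ball (\<psi> \<phi>) d"] by (simp del: mem_ball)
  qed
  moreover have "\<psi> \<in> U" using \<psi> G by (auto simp: U_def in_closure_of D.topspace_weak_star)
  ultimately obtain a where a: "a \<in> A" "canon V a \<in> U" using \<psi> by (auto simp: in_closure_of)
  have "norm (\<psi> \<phi> - \<phi> a) < d" if "(\<phi>, d) \<in> G" for \<phi> d
  proof -
    have "canon V a \<phi> \<in> ball (\<psi> \<phi>) d" using a(2) that unfolding U_def by blast
    then show ?thesis using G(2)[OF that] by (simp add: canon_apply dist_norm)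
  qed
  then show ?thesis using a that by auto
qed

lemma wcl_mem: "\<psi> \<in> wcl \<Longrightarrow> \<psi> \<in> carrier (dual (dual V))"
  using seminormed.topspace_weak_star[OF dual_seminormed] by (auto simp: in_closure_of)

lemma wcl_bounded: "bounded_in (dual (dual V)) wcl"
proof -
  interpret D: seminormed "dual V" by (rule dual_seminormed)
  obtain M where M: "\<And>a. a \<in> A \<Longrightarrow> nrm V a \<le> M" using A by (auto simp: bounded_in_def)
  have M0: "0 \<le> M" using M A nrm_nonneg A_subset by (meson ex_in_conv order_trans subsetD)
  have "nrm (dual (dual V)) \<psi> \<le> M" if \<psi>: "\<psi> \<in> wcl" for \<psi>
  proof (rule D.dual_nrm_le[OF M0], rule field_le_epsilon)
    fix \<phi> and e :: real assume \<phi>: "\<phi> \<in> carrier (dual V)" and e: "0 < e"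
    obtain a where a: "a \<in> A" "norm (\<psi> \<phi> - \<phi> a) < e"
      using wcl_approx[OF \<psi>, of "{(\<phi>, e)}"] \<phi> e by auto
    have "norm (\<psi> \<phi>) \<le> norm (\<phi> a) + e" using a(2) norm_triangle_sub[of "\<psi> \<phi>" "\<phi> a"] by linarith
    also have "norm (\<phi> a) \<le> nrm (dual V) \<phi> * nrm V a" using \<phi> a A_subset by (intro dual_bound) auto
    also have "\<dots> \<le> M * nrm (dual V) \<phi>"
      using mult_left_mono[OF M[OF a(1)] dual_nrm_nonneg[OF \<phi>]] by (simp add: mult.commute)
    finally show "norm (\<psi> \<phi>) \<le> M * nrm (dual V) \<phi> + e" by simp
  qed
  then show ?thesis unfolding bounded_in_def using wcl_mem by auto
qed

lemma wcl_superset: "canon V ` A \<subseteq> wcl"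
  using canon_mem A_subset seminormed.topspace_weak_star[OF dual_seminormed]
  by (intro closure_of_subset) auto

text \<open>A point of the weak\<open>*\<close> closure of \<open>A\<close> is, by compactness of \<open>K\<close>, as close to some point of
  \<open>K\<close> as the points of \<open>A\<close> are: each functional imposes a weakly closed condition on \<open>k \<in> K\<close>.\<close>

lemma wk_le_omega: "wk_nc V A \<le> omega_nc V A"
proof (rule omega_nc_ge)
  interpret D: seminormed "dual V" by (rule dual_seminormed)
  interpret DD: seminormed "dual (dual V)" by (rule D.dual_seminormed)
  fix K assume K: "K \<subseteq> carrier V" "compactin (weak_topology V) K" "K \<noteq> {}"
  define r where "r = dhat V A K"
  have r0: "0 \<le> r" unfolding r_def using A K by (intro dhat_nonneg)
  have "pt_dist (dual (dual V)) \<psi> (canon V ` carrier V) \<le> r" if \<psi>: "\<psi> \<in> wcl" for \<psi>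
  proof (rule field_le_epsilon)
    fix e :: real assume e: "0 < e"
    \<comment> \<open>Two slacks occur: d, because a point of A matches \<psi> on \<phi> only
      approximately, and e, because its distance to K need not be attained. The first disappears for
      each \<phi> as d tends to 0, the second at the end.\<close>
    define C where "C = (\<lambda>(\<phi>, d). {k \<in> carrier V. \<phi> k \<in> cball (\<psi> \<phi>) (d + (r + e) * nrm (dual V) \<phi>)})"
    let ?\<U> = "C ` (carrier (dual V) \<times> {0<..})"
    have ne: "K \<inter> \<Inter>\<F> \<noteq> {}" if fin: "finite \<F>" and F: "\<F> \<subseteq> ?\<U>" for \<F>
    proof -
      obtain G where G: "G \<subseteq> carrier (dual V) \<times> {0<..}" "finite G" "\<F> = C ` G"
        using finite_subset_image[OF fin F] by blast
      obtain a where a: "a \<in> A" "\<And>\<phi> d. (\<phi>, d) \<in> G \<Longrightarrow> norm (\<psi> \<phi> - \<phi> a) < d"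
      proof (rule wcl_approx[OF \<psi> G(2)])
        show "\<phi> \<in> carrier (dual V) \<and> 0 < d" if "(\<phi>, d) \<in> G" for \<phi> d using G(1) that by auto
      qed blast
      have aV: "a \<in> carrier V" using a A_subset by auto
      have "pt_dist V a K < r + e" using pt_dist_le_dhat[OF A(1) K(1,3) a(1)] e by (simp add: r_def)
      then obtain k where k: "k \<in> K" "nrm V (a - k) < r + e" using pt_dist_less[OF aV K(1,3)] by metis
      have kV: "k \<in> carrier V" using k K by auto
      have "k \<in> C x" if x: "x \<in> G" for x
      proof -
        obtain \<phi> d where xd: "x = (\<phi>, d)" by force
        have \<phi>: "\<phi> \<in> carrier (dual V)" using G x xd by auto
        have "norm (\<psi> \<phi> - \<phi> k) \<le> norm (\<psi> \<phi> - \<phi> a) + norm (\<phi> a - \<phi> k)"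
          using norm_triangle_ineq[of "\<psi> \<phi> - \<phi> a" "\<phi> a - \<phi> k"] by simp
        also have "norm (\<phi> a - \<phi> k) \<le> nrm (dual V) \<phi> * nrm V (a - k)"
          using dual_bound[OF \<phi> diff_mem[OF aV kV]] dual_diff[OF \<phi> aV kV] by simp
        also have "\<dots> \<le> nrm (dual V) \<phi> * (r + e)"
          using k dual_nrm_nonneg[OF \<phi>] by (intro mult_left_mono) auto
        finally have "norm (\<psi> \<phi> - \<phi> k) \<le> d + (r + e) * nrm (dual V) \<phi>"
          using a(2)[of \<phi> d] x xd by (simp add: mult.commute)
        then show ?thesis using kV by (simp add: C_def xd dist_norm)
      qed
      then show ?thesis using k G by auto
    qed
    have "closedin (weak_topology V) (C x)" if "x \<in> carrier (dual V) \<times> {0<..}" for x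
    proof -
      obtain \<phi> d where "x = (\<phi>, d)" by force
      then show ?thesis
        using that by (simp add: weak_topology_def C_def closedin_initial_topology del: mem_cball)
    qed
    then have "K \<inter> \<Inter>?\<U> \<noteq> {}"
      using ne by (rule_tac compactin_fipD[OF K(2)]) blast+
    then obtain k where k: "k \<in> K" "\<And>\<phi> d. \<phi> \<in> carrier (dual V) \<Longrightarrow> 0 < d \<Longrightarrow> k \<in> C (\<phi>, d)" by auto
    have kV: "k \<in> carrier V" using k K by auto
    have "nrm (dual (dual V)) (\<psi> - canon V k) \<le> r + e"
    proof (rule D.dual_nrm_le)
      fix \<phi> assume \<phi>: "\<phi> \<in> carrier (dual V)"
      show "norm ((\<psi> - canon V k) \<phi>) \<le> (r + e) * nrm (dual V) \<phi>"
      proof (rule field_le_epsilon)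
        fix d :: real assume "0 < d"
        then show "norm ((\<psi> - canon V k) \<phi>) \<le> (r + e) * nrm (dual V) \<phi> + d"
          using k(2)[OF \<phi>, of d] by (simp add: C_def canon_apply[OF \<phi>] dist_norm algebra_simps)
      qed
    qed (use r0 e in simp)
    moreover have "pt_dist (dual (dual V)) \<psi> (canon V ` carrier V) \<le> nrm (dual (dual V)) (\<psi> - canon V k)"
      using kV wcl_mem[OF \<psi>] canon_image_subset by (intro DD.pt_dist_le) auto
    ultimately show "pt_dist (dual (dual V)) \<psi> (canon V ` carrier V) \<le> r + e" by simp
  qed
  then show "wk_nc V A \<le> dhat V A K"
    unfolding wk_nc_def r_def[symmetric] using wcl_superset A(2) by (intro DD.dhat_le) auto
qed

text \<open>Inclusion in the weak-star closure is what compares \<open>wck_nc\<close> with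
  \<open>wk_nc\<close>; nonemptiness, from Banach-Alaoglu, makes the distances in
  \<open>wck_nc\<close> infima over nonempty sets.\<close>

lemma cluster_points_canon:
  assumes "\<And>n. s n \<in> A"
  shows "cluster_points (weak_star_topology (dual V)) (\<lambda>n. canon V (s n)) \<subseteq> wcl"
    and "cluster_points (weak_star_topology (dual V)) (\<lambda>n. canon V (s n)) \<noteq> {}"
proof -
  interpret D: seminormed "dual V" by (rule dual_seminormed)
  show "cluster_points (weak_star_topology (dual V)) (\<lambda>n. canon V (s n)) \<subseteq> wcl"
  proof
    fix \<psi> assume \<psi>: "\<psi> \<in> cluster_points (weak_star_topology (dual V)) (\<lambda>n. canon V (s n))"
    have "\<exists>y. y \<in> canon V ` A \<and> y \<in> U" if "\<psi> \<in> U" "openin (weak_star_topology (dual V)) U" for U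
    proof -
      have "\<exists>\<^sub>\<infinity>n. canon V (s n) \<in> U" using \<psi> that by (auto simp: cluster_points_def)
      then obtain n where "canon V (s n) \<in> U" by (auto simp: INFM_nat)
      then show ?thesis using assms by auto
    qed
    then show "\<psi> \<in> wcl" using \<psi> by (auto simp: in_closure_of cluster_points_def)
  qed
  obtain M where M: "\<And>a. a \<in> A \<Longrightarrow> nrm V a \<le> M" using A by (auto simp: bounded_in_def)
  show "cluster_points (weak_star_topology (dual V)) (\<lambda>n. canon V (s n)) \<noteq> {}"
  proof (rule cluster_points_nonempty[OF D.banach_alaoglu])
    fix n
    show "canon V (s n) \<in> {f \<in> carrier (dual (dual V)). nrm (dual (dual V)) f \<le> M}"
      using canon_mem[of "s n"] assms[of n] A_subset M[of "s n"] by auto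
  qed
qed

lemma set_dist_bounds:
  assumes "\<And>n. s n \<in> A"
  defines "d \<equiv> set_dist (dual (dual V)) (cluster_points (weak_star_topology (dual V)) (\<lambda>n. canon V (s n)))
    (canon V ` carrier V)"
  shows "d \<le> wk_nc V A"
    and "(\<And>\<psi> x. \<psi> \<in> cluster_points (weak_star_topology (dual V)) (\<lambda>n. canon V (s n)) \<Longrightarrow>
            x \<in> carrier V \<Longrightarrow> c \<le> nrm (dual (dual V)) (\<psi> - canon V x)) \<Longrightarrow> c \<le> d"
proof -
  interpret D: seminormed "dual V" by (rule dual_seminormed)
  interpret DD: seminormed "dual (dual V)" by (rule D.dual_seminormed)
  let ?C = "cluster_points (weak_star_topology (dual V)) (\<lambda>n. canon V (s n))"
  note C = cluster_points_canon[of s, OF assms(1)]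
  have CD: "\<psi> \<in> carrier (dual (dual V))" if "\<psi> \<in> ?C" for \<psi>
    using C(1) that wcl_mem by auto
  obtain \<psi> where \<psi>: "\<psi> \<in> ?C" using C(2) by auto
  have "d \<le> nrm (dual (dual V)) (\<psi> - canon V x)" if "x \<in> carrier V" for x
    unfolding d_def set_dist_def
  proof (rule cInf_lower)
    show "nrm (dual (dual V)) (\<psi> - canon V x)
      \<in> {nrm (dual (dual V)) (a - b) |a b. a \<in> ?C \<and> b \<in> canon V ` carrier V}" using \<psi> that by blast
    show "bdd_below {nrm (dual (dual V)) (a - b) |a b. a \<in> ?C \<and> b \<in> canon V ` carrier V}"
      using CD canon_image_subset by (intro bdd_belowI[where m = 0]) (auto intro!: DD.nrm_nonneg DD.diff_mem)
  qed
  then have "d \<le> pt_dist (dual (dual V)) \<psi> (canon V ` carrier V)"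
    unfolding pt_dist_def using canon_image_nonempty by (intro cINF_greatest) auto
  also have "\<dots> \<le> wk_nc V A"
    unfolding wk_nc_def using \<psi> C canon_image_nonempty canon_image_subset
    by (intro DD.pt_dist_le_dhat wcl_bounded) auto
  finally show "d \<le> wk_nc V A" .
  show "c \<le> d" if "\<And>\<psi> x. \<psi> \<in> ?C \<Longrightarrow> x \<in> carrier V \<Longrightarrow> c \<le> nrm (dual (dual V)) (\<psi> - canon V x)"
    unfolding d_def set_dist_def using that \<psi> zero_mem by (intro cInf_greatest) blast+
qed

lemma wck_le_wk: "wck_nc V A \<le> wk_nc V A"
proof -
  obtain a where "a \<in> A" using A by auto
  then have "{s. \<forall>n::nat. s n \<in> A} \<noteq> {}" by auto
  then show ?thesis unfolding wck_nc_def using set_dist_bounds(1) by (intro cSUP_least) auto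
qed

lemma wck_nc_ge:
  assumes s: "\<And>n. s n \<in> A"
    and "\<And>\<psi> x. \<psi> \<in> cluster_points (weak_star_topology (dual V)) (\<lambda>n. canon V (s n)) \<Longrightarrow>
            x \<in> carrier V \<Longrightarrow> c \<le> nrm (dual (dual V)) (\<psi> - canon V x)"
  shows "c \<le> wck_nc V A"
proof -
  have "c \<le> set_dist (dual (dual V)) (cluster_points (weak_star_topology (dual V)) (\<lambda>n. canon V (s n)))
      (canon V ` carrier V)"
    using assms by (intro set_dist_bounds(2)) auto
  also have "\<dots> \<le> wck_nc V A"
    unfolding wck_nc_def using s set_dist_bounds(1)
    by (intro cSUP_upper bdd_aboveI2[where M = "wk_nc V A"]) auto
  finally show ?thesis .
qed

lemma wck_nc_nonneg: "0 \<le> wck_nc V A"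
proof -
  interpret D: seminormed "dual V" by (rule dual_seminormed)
  interpret DD: seminormed "dual (dual V)" by (rule D.dual_seminormed)
  obtain a where a: "a \<in> A" using A by auto
  show ?thesis
  proof (rule wck_nc_ge[where s = "\<lambda>_. a"])
    fix \<psi> x assume "\<psi> \<in> cluster_points (weak_star_topology (dual V)) (\<lambda>n::nat. canon V a)" "x \<in> carrier V"
    then show "0 \<le> nrm (dual (dual V)) (\<psi> - canon V x)"
      using cluster_points_canon(1)[of "\<lambda>_. a"] a wcl_mem canon_mem(1)
      by (intro DD.nrm_nonneg DD.diff_mem) auto
  qed (rule a)
qed

text \<open>With \<open>G = {}\<close> the hypothesis of \<open>weakly_compact_annihilator\<close>
  is reflexivity itself; the compact set K so obtained lies at distance zero from every point of
  A.\<close>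

lemma omega_nc_reflexive:
  assumes "reflexive V"
  shows "omega_nc V A \<le> 0"
proof -
  obtain M where M: "\<And>a. a \<in> A \<Longrightarrow> nrm V a \<le> M" using A by (auto simp: bounded_in_def)
  obtain K where K: "K \<subseteq> carrier V" "compactin (weak_topology V) K"
    "\<And>v. v \<in> carrier V \<Longrightarrow> nrm V v \<le> M \<Longrightarrow> \<exists>k\<in>K. nrm V (v - k) = 0"
    using weakly_compact_annihilator[of "{}" M] assms by (auto simp: reflexive_def)
  have near: "\<exists>k\<in>K. nrm V (a - k) = 0" if "a \<in> A" for a using K(3) M A_subset that by auto
  then have ne: "K \<noteq> {}" using A by auto
  have "pt_dist V a K \<le> 0" if "a \<in> A" for a
    using near[OF that] pt_dist_le[of a K] A_subset K(1) that by force
  then have "dhat V A K \<le> 0" using A by (intro dhat_le)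
  then show ?thesis using omega_nc_le[OF K(1,2) ne] by simp
qed

end

end

section \<open>The spaces \<open>\<ell>\<^sup>p(J)\<close>\<close>

instance rc_scalar \<subseteq> banach ..

text \<open>Convexity of the power function on the open half-line; when u or v vanishes the claim
  reduces to \<open>t powr p \<le> t\<close> for t in [0, 1].\<close>

lemma powr_convex_combination:
  fixes s u v p :: real
  assumes p: "1 \<le> p" and s: "0 \<le> s" "s \<le> 1" and u: "0 \<le> u" and v: "0 \<le> v"
  shows "(s * u + (1 - s) * v) powr p \<le> s * u powr p + (1 - s) * v powr p"
proof (cases "u = 0 \<or> v = 0")
  case True
  have *: "(t * w) powr p \<le> t * w powr p" if "0 \<le> t" "t \<le> 1" "0 \<le> w" for t w :: real
  proof (cases "t = 0")
    case False
    then have "t powr p \<le> t powr 1" using p that by (intro powr_mono') auto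
    then have "t powr p \<le> t" using that False by simp
    then show ?thesis using that by (simp add: powr_mult mult_right_mono)
  qed auto
  show ?thesis using True *[of s u] *[of "1 - s" v] s u v by auto
next
  case False
  then have "u \<in> {0<..}" "v \<in> {0<..}" using u v by auto
  then show ?thesis
    using convex_onD[OF powr_convex[OF p], of "1 - s" u v] s by (simp add: algebra_simps)
qed

text \<open>Bounds a and b replace the norms, so the lemma applies to any finite partial sum with
  the full norms as bounds. After division by a and b the sum is a + b times a convex combination
  with weights a / (a + b) and b / (a + b), and convexity of the power finishes; a vanishing bound
  kills its summand.\<close>

lemma minkowski_finite:
  fixes x y :: "'a \<Rightarrow> 'k::real_normed_vector"
  assumes p: "1 \<le> p" and F: "finite F" and a: "0 \<le> a" and b: "0 \<le> b"
    and x: "(\<Sum>j\<in>F. norm (x j) powr p) \<le> a powr p" and y: "(\<Sum>j\<in>F. norm (y j) powr p) \<le> b powr p"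
  shows "(\<Sum>j\<in>F. norm (x j + y j) powr p) \<le> (a + b) powr p"
proof -
  have vanish: "z j = 0" if "(\<Sum>j\<in>F. norm (z j) powr p) \<le> 0 powr p" "j \<in> F" for z :: "'a \<Rightarrow> 'k" and j
  proof -
    have "(\<Sum>j\<in>F. norm (z j) powr p) = 0" using that p by (intro antisym sum_nonneg) auto
    then show ?thesis using that F by (simp add: sum_nonneg_eq_0_iff)
  qed
  consider "a = 0" | "b = 0" | "0 < a" "0 < b" using a b by linarith
  then show ?thesis
  proof cases
    case 1
    then have "(\<Sum>j\<in>F. norm (x j + y j) powr p) = (\<Sum>j\<in>F. norm (y j) powr p)"
      using vanish[of x] x by (intro sum.cong) auto
    then show ?thesis using 1 y by simp
  next
    case 2
    then have "(\<Sum>j\<in>F. norm (x j + y j) powr p) = (\<Sum>j\<in>F. norm (x j) powr p)"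
      using vanish[of y] y by (intro sum.cong) auto
    then show ?thesis using 2 x by simp
  next
    case 3
    define s where "s = a / (a + b)"
    have s: "0 \<le> s" "s \<le> 1" "1 - s = b / (a + b)" using 3 by (auto simp: s_def field_simps)
    have "norm (x j + y j) powr p \<le>
        (a + b) powr p * (s * (norm (x j) powr p / a powr p) + (1 - s) * (norm (y j) powr p / b powr p))" for j
    proof -
      have "norm (x j + y j) \<le> norm (x j) + norm (y j)" by (rule norm_triangle_ineq)
      also have "\<dots> = (a + b) * (s * (norm (x j) / a) + (1 - s) * (norm (y j) / b))"
      proof -
        have "(a + b) * s = a" using 3 by (simp add: s_def)
        moreover have "(a + b) * (1 - s) = b" using 3 by (simp add: s(3))
        ultimately show ?thesis using 3 by (simp add: distrib_left flip: mult.assoc)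
      qed
      finally have "norm (x j + y j) powr p \<le>
          ((a + b) * (s * (norm (x j) / a) + (1 - s) * (norm (y j) / b))) powr p"
        using p by (intro powr_mono2) auto
      also have "\<dots> = (a + b) powr p * (s * (norm (x j) / a) + (1 - s) * (norm (y j) / b)) powr p"
        by (rule powr_mult)
      also have "\<dots> \<le> (a + b) powr p * (s * (norm (x j) / a) powr p + (1 - s) * (norm (y j) / b) powr p)"
        using 3 s p by (intro mult_left_mono powr_convex_combination) auto
      finally show ?thesis using 3 by (simp add: powr_divide)
    qed
    then have "(\<Sum>j\<in>F. norm (x j + y j) powr p) \<le>
      (\<Sum>j\<in>F. (a + b) powr p * (s * (norm (x j) powr p / a powr p) + (1 - s) * (norm (y j) powr p / b powr p)))"
      by (intro sum_mono)
    also have "\<dots> = (a + b) powr p * (s * ((\<Sum>j\<in>F. norm (x j) powr p) / a powr p)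
        + (1 - s) * ((\<Sum>j\<in>F. norm (y j) powr p) / b powr p))"
      by (simp add: sum_distrib_left sum_divide_distrib flip: sum.distrib)
    also have "\<dots> \<le> (a + b) powr p * (s * 1 + (1 - s) * 1)"
      using 3 s x y by (intro mult_left_mono add_mono) auto
    finally show ?thesis by simp
  qed
qed

lemma powr_le_imp_le_base:
  fixes x y p :: real
  assumes "0 < p" "0 \<le> x" "0 \<le> y" "x powr p \<le> y powr p"
  shows "x \<le> y"
  using assms powr_less_mono2[of p y x] by linarith

lemma ell_smul: "smul (ell p J) = (\<lambda>c x j. c * x j)"
  by (simp add: ell_def)

context
  fixes p :: real and J :: "'j set"
  assumes p: "1 \<le> p"
begin

lemma ell_outside: "x \<in> carrier (ell p J) \<Longrightarrow> j \<notin> J \<Longrightarrow> x j = 0"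
  by (simp add: ell_def)

lemma ell_summable: "x \<in> carrier (ell p J) \<Longrightarrow> (\<lambda>j. norm (x j) powr p) summable_on J"
  by (simp add: ell_def)

lemma ell_nrm_nonneg: "0 \<le> nrm (ell p J) x"
  by (simp add: ell_def)

lemma ell_nrm_powr: "nrm (ell p J) x powr p = (\<Sum>\<^sub>\<infinity>j\<in>J. norm (x j) powr p)"
  using p by (simp add: ell_def powr_powr infsum_nonneg)

lemma ell_sum_le:
  assumes x: "x \<in> carrier (ell p J)" and F: "finite F"
  shows "(\<Sum>j\<in>F. norm (x j) powr p) \<le> nrm (ell p J) x powr p"
proof -
  have "(\<Sum>j\<in>F. norm (x j) powr p) = (\<Sum>j\<in>F \<inter> J. norm (x j) powr p)"
    using F ell_outside[OF x] by (intro sum.mono_neutral_right) auto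
  also have "\<dots> \<le> nrm (ell p J) x powr p"
    unfolding ell_nrm_powr using F ell_summable[OF x] by (intro finite_sum_le_infsum) auto
  finally show ?thesis .
qed

lemma ell_coord_le:
  assumes "x \<in> carrier (ell p J)"
  shows "norm (x j) \<le> nrm (ell p J) x"
  using ell_sum_le[OF assms, of "{j}"] p ell_nrm_nonneg by (rule_tac powr_le_imp_le_base[of p]) auto

text \<open>Membership and norm bound follow together from finite partial sums, so all later
  estimates in \<open>ell\<close> are finite ones.\<close>

lemma ellI:
  assumes "\<And>j. j \<notin> J \<Longrightarrow> x j = 0" and M: "0 \<le> M"
    and "\<And>F. finite F \<Longrightarrow> F \<subseteq> J \<Longrightarrow> (\<Sum>j\<in>F. norm (x j) powr p) \<le> M powr p"
  shows "x \<in> carrier (ell p J)" and "nrm (ell p J) x \<le> M"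
proof -
  have s: "(\<lambda>j. norm (x j) powr p) summable_on J"
    using assms(3) by (intro nonneg_bdd_above_summable_on bdd_aboveI2) auto
  then show "x \<in> carrier (ell p J)" using assms(1) by (simp add: ell_def)
  have "nrm (ell p J) x powr p \<le> M powr p"
    unfolding ell_nrm_powr by (intro infsum_le_finite_sums s assms(3))
  then show "nrm (ell p J) x \<le> M"
    using p M ell_nrm_nonneg by (rule_tac powr_le_imp_le_base[of p]) auto
qed

lemma ell_seminormed: "seminormed (ell p J :: ('k::rc_scalar, 'j \<Rightarrow> 'k) nspace)"
proof
  show "0 \<in> carrier (ell p J :: ('k, 'j \<Rightarrow> 'k) nspace)" by (rule ellI[where M = 0]) (use p in auto)
next
  fix x y :: "'j \<Rightarrow> 'k" assume x: "x \<in> carrier (ell p J)" and y: "y \<in> carrier (ell p J)"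
  have le: "(\<Sum>j\<in>F. norm ((x + y) j) powr p) \<le> (nrm (ell p J) x + nrm (ell p J) y) powr p"
    if "finite F" for F
    using minkowski_finite[OF p that ell_nrm_nonneg ell_nrm_nonneg ell_sum_le[OF x that] ell_sum_le[OF y that]]
    by simp
  show "x + y \<in> carrier (ell p J)" "nrm (ell p J) (x + y) \<le> nrm (ell p J) x + nrm (ell p J) y"
    by (rule ellI[OF _ _ le]; simp add: ell_outside[OF x] ell_outside[OF y] ell_nrm_nonneg)+
next
  fix x :: "'j \<Rightarrow> 'k" and c assume x: "x \<in> carrier (ell p J)"
  have le: "(\<Sum>j\<in>F. norm (smul (ell p J) c x j) powr p) \<le> (norm c * nrm (ell p J) x) powr p"
    if "finite F" for F
    using ell_sum_le[OF x that] ell_nrm_nonneg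
    by (simp add: ell_smul norm_mult powr_mult mult_left_mono flip: sum_distrib_left)
  show "smul (ell p J) c x \<in> carrier (ell p J)" "nrm (ell p J) (smul (ell p J) c x) \<le> norm c * nrm (ell p J) x"
    by (rule ellI[OF _ _ le]; simp add: ell_smul ell_outside[OF x] ell_nrm_nonneg)+
qed (auto simp: ell_smul ell_nrm_nonneg fun_eq_iff algebra_simps)

text \<open>A Fatou property: the estimate on each finite coordinate set survives the limit. It
  later turns coordinatewise convergence of nuclear representations into norm estimates.\<close>

lemma ell_limit:
  assumes x: "\<And>n::nat. x n \<in> carrier (ell p J)" "\<And>n. nrm (ell p J) (x n) \<le> M"
    and lim: "\<And>j. (\<lambda>n. x n j) \<longlonglongrightarrow> y j"
  shows "y \<in> carrier (ell p J)" and "nrm (ell p J) y \<le> M"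
proof -
  have M: "0 \<le> M" using x(2)[of 0] ell_nrm_nonneg[of "x 0"] by linarith
  have le: "(\<Sum>j\<in>F. norm (y j) powr p) \<le> M powr p" if F: "finite F" for F
  proof (rule LIMSEQ_le_const2)
    show "(\<lambda>n. \<Sum>j\<in>F. norm (x n j) powr p) \<longlonglongrightarrow> (\<Sum>j\<in>F. norm (y j) powr p)"
      using p by (intro tendsto_sum tendsto_powr2 tendsto_norm lim tendsto_const) auto
    have "(\<Sum>j\<in>F. norm (x n j) powr p) \<le> M powr p" for n
      using ell_sum_le[OF x(1) F, of n] powr_mono2[OF _ ell_nrm_nonneg x(2)[of n], of p] p by linarith
    then show "\<exists>N. \<forall>n\<ge>N. (\<Sum>j\<in>F. norm (x n j) powr p) \<le> M powr p" by auto
  qed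
  have out: "y j = 0" if "j \<notin> J" for j
    using lim[of j] ell_outside[OF x(1) that] by (simp add: LIMSEQ_const_iff)
  show "y \<in> carrier (ell p J)" "nrm (ell p J) y \<le> M"
    by (rule ellI[OF _ M le]; simp add: out)+
qed

end

subsection \<open>Restriction to coordinate sets\<close>

text \<open>\<open>coord_proj\<close> without the membership test, hence additive on all functions;
  on the carrier both agree (\<open>coord_proj_eq\<close>).\<close>

definition res :: "'j set \<Rightarrow> ('j \<Rightarrow> 'k::zero) \<Rightarrow> 'j \<Rightarrow> 'k" where
  "res C x = (\<lambda>j. if j \<in> C then x j else 0)"

definition unit :: "'j \<Rightarrow> 'j \<Rightarrow> 'k::zero_neq_one" where
  "unit j = (\<lambda>i. if i = j then 1 else 0)"

lemma res_res: "res C (res D x) = res (C \<inter> D) x"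
  by (auto simp: res_def)

lemma res_add: "res C (x + y) = res C x + res C (y :: 'j \<Rightarrow> 'k::rc_scalar)"
  by (auto simp: res_def)

lemma res_diff: "res C (x - y) = res C x - res C (y :: 'j \<Rightarrow> 'k::rc_scalar)"
  by (auto simp: res_def)

lemma res_Un: "C \<inter> D = {} \<Longrightarrow> res (C \<union> D) x = res C x + res D (x :: 'j \<Rightarrow> 'k::rc_scalar)"
  by (auto simp: res_def fun_eq_iff)

lemma res_diff_set: "x - res C x = res (- C) (x :: 'j \<Rightarrow> 'k::rc_scalar)"
  by (auto simp: res_def fun_eq_iff)

lemma sum_fun_apply: "(\<Sum>i\<in>S. f i) x = (\<Sum>i\<in>S. f i x)"
  for f :: "'i \<Rightarrow> 'x \<Rightarrow> 'b::ab_group_add"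
  by (induction S rule: infinite_finite_induct) auto

lemma coord_proj_eq: "x \<in> carrier (ell p J) \<Longrightarrow> coord_proj p J C x = res C x"
  by (simp add: coord_proj_def res_def)

context
  fixes p :: real and J :: "'j set"
  assumes p: "1 \<le> p"
begin

lemma res_mem:
  fixes x :: "'j \<Rightarrow> 'k::rc_scalar"
  assumes x: "x \<in> carrier (ell p J)"
  shows "res C x \<in> carrier (ell p J)" and "nrm (ell p J) (res C x) \<le> nrm (ell p J) x"
proof -
  have le: "(\<Sum>j\<in>F. norm (res C x j) powr p) \<le> nrm (ell p J) x powr p" if F: "finite F" for F
  proof -
    have "(\<Sum>j\<in>F. norm (res C x j) powr p) \<le> (\<Sum>j\<in>F. norm (x j) powr p)"
      by (intro sum_mono) (auto simp: res_def)
    then show ?thesis using ell_sum_le[OF p x F] by simp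
  qed
  show "res C x \<in> carrier (ell p J)" "nrm (ell p J) (res C x) \<le> nrm (ell p J) x"
    by (rule ellI[OF p _ _ le]; simp add: res_def ell_outside[OF p x] ell_nrm_nonneg[OF p])+
qed

lemma unit_mem:
  assumes "j \<in> J"
  shows "(unit j :: 'j \<Rightarrow> 'k::rc_scalar) \<in> carrier (ell p J)"
    and "nrm (ell p J) (unit j :: 'j \<Rightarrow> 'k) \<le> 1"
proof -
  have le: "(\<Sum>i\<in>F. norm (unit j i :: 'k) powr p) \<le> 1 powr p" if F: "finite F" for F
  proof -
    have "(\<Sum>i\<in>F. norm (unit j i :: 'k) powr p) = (\<Sum>i\<in>F. if i = j then 1 else 0)"
      by (intro sum.cong) (auto simp: unit_def)
    then show ?thesis using F by (simp add: sum.delta)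
  qed
  show "(unit j :: 'j \<Rightarrow> 'k) \<in> carrier (ell p J)" "nrm (ell p J) (unit j :: 'j \<Rightarrow> 'k) \<le> 1"
    by (rule ellI[OF p _ _ le]; use assms in \<open>auto simp: unit_def\<close>)+
qed

lemma ell_tail:
  fixes x :: "'j \<Rightarrow> 'k::rc_scalar"
  assumes x: "x \<in> carrier (ell p J)" and e: "0 < e"
  obtains F where "finite F" "F \<subseteq> J" "\<And>C. C \<inter> F = {} \<Longrightarrow> nrm (ell p J) (res C x) \<le> e"
proof -
  let ?g = "\<lambda>j. norm (x j) powr p"
  have sm: "(?g has_sum infsum ?g J) J" using ell_summable[OF p x] by simp
  obtain F where F: "finite F" "F \<subseteq> J" "dist (sum ?g F) (infsum ?g J) \<le> e powr p"
    using has_sum_finite_approximation[OF sm, of "e powr p"] e by auto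
  have "nrm (ell p J) (res C x) \<le> e" if C: "C \<inter> F = {}" for C
  proof (rule ellI(2)[OF p])
    fix G assume G: "finite G" "G \<subseteq> J"
    have "(\<Sum>j\<in>G. norm (res C x j) powr p) = sum ?g (G \<inter> C)"
      using G by (simp add: res_def sum.inter_restrict if_distrib[of norm] if_distrib[of "\<lambda>t. t powr p"] cong: if_cong)
    \<comment> \<open>F already carries the total mass up to \<open>e powr p\<close>, so a finite
      set disjoint from F can carry no more than that.\<close>
    also have "\<dots> = sum ?g (F \<union> (G \<inter> C)) - sum ?g F"
      using F G C by (subst sum.union_disjoint) auto
    also have "sum ?g (F \<union> (G \<inter> C)) \<le> infsum ?g J"
      using F G ell_summable[OF p x] by (intro finite_sum_le_infsum) auto
    finally show "(\<Sum>j\<in>G. norm (res C x j) powr p) \<le> e powr p"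
      using F(3) by (simp add: dist_real_def)
  qed (use e in \<open>auto simp: res_def ell_outside[OF p x]\<close>)
  then show ?thesis using F that by blast
qed

lemma ell_disjoint_sum:
  fixes x :: "'j \<Rightarrow> 'k::rc_scalar"
  assumes x: "x \<in> carrier (ell p J)" and C: "\<And>m n. m < n \<Longrightarrow> n < N \<Longrightarrow> C m \<inter> C n = {}"
  shows "nrm (ell p J) (res (\<Union>n<N. C n) x) powr p = (\<Sum>n<(N::nat). nrm (ell p J) (res (C n) x) powr p)"
  using C
proof (induction N)
  case 0
  have "res {} x = 0" by (auto simp: res_def)
  then have "nrm (ell p J) (res {} x) = 0"
    by (simp only: seminormed.nrm_zero[OF ell_seminormed[OF p]])
  then show ?case using p by simp
next
  case (Suc N)
  let ?U = "\<Union>n<N. C n"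
  have disj: "C N \<inter> ?U = {}" using Suc.prems by fastforce
  have "nrm (ell p J) (res (C N \<union> ?U) x) powr p =
      (\<Sum>\<^sub>\<infinity>j\<in>J. norm (res (C N) x j) powr p + norm (res ?U x j) powr p)"
    unfolding ell_nrm_powr[OF p] using disj p by (intro infsum_cong) (auto simp: res_def)
  also have "\<dots> = nrm (ell p J) (res (C N) x) powr p + nrm (ell p J) (res ?U x) powr p"
    unfolding ell_nrm_powr[OF p] using x by (intro infsum_add ell_summable[OF p] res_mem)
  also have "\<dots> = (\<Sum>n<Suc N. nrm (ell p J) (res (C n) x) powr p)"
    using Suc by simp
  finally show ?case by (simp add: lessThan_Suc)
qed

lemma ell_disjoint_le:
  fixes x :: "'j \<Rightarrow> 'k::rc_scalar"
  assumes x: "x \<in> carrier (ell p J)" and C: "\<And>m n. m < n \<Longrightarrow> n < N \<Longrightarrow> C m \<inter> C n = {}"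
  shows "(\<Sum>n<(N::nat). nrm (ell p J) (res (C n) x) powr p) \<le> nrm (ell p J) x powr p"
  using powr_mono2[OF _ ell_nrm_nonneg[OF p] res_mem(2)[OF x], of p "\<Union>n<N. C n"] p
    ell_disjoint_sum[OF x, of N C] C by simp

lemma res_finite_expand:
  fixes x :: "'j \<Rightarrow> 'k::rc_scalar"
  assumes "finite F"
  shows "res F x = (\<Sum>j\<in>F. smul (ell p J) (x j) (unit j))"
proof
  fix i
  have "(\<Sum>j\<in>F. smul (ell p J) (x j) (unit j)) i = (\<Sum>j\<in>F. if i = j then x j else 0)"
    by (auto simp: sum_fun_apply ell_smul unit_def intro!: sum.cong)
  also have "\<dots> = res F x i" using assms by (simp add: res_def sum.delta)
  finally show "res F x i = (\<Sum>j\<in>F. smul (ell p J) (x j) (unit j)) i" ..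
qed

end

subsection \<open>Duality of \<open>\<ell>\<^sup>r\<close> and \<open>\<ell>\<^sup>q\<close> for conjugate exponents\<close>

text \<open>Bilinear, without complex conjugation, so that \<open>\<ell>^r\<close> embeds linearly
  into the dual of \<open>\<ell>^q\<close>.\<close>

definition pair :: "'l set \<Rightarrow> ('l \<Rightarrow> 'k) \<Rightarrow> ('l \<Rightarrow> 'k) \<Rightarrow> 'k::rc_scalar" where
  "pair L a x = (\<Sum>\<^sub>\<infinity>l\<in>L. a l * x l)"

lemma pair_commute: "pair L a x = pair L x a"
  by (simp add: pair_def mult.commute)

lemma pair_res: "pair L (res D a) x = pair L a (res D x)"
  unfolding pair_def by (intro infsum_cong) (auto simp: res_def)

definition dual_of :: "real \<Rightarrow> 'l set \<Rightarrow> ('l \<Rightarrow> 'k::rc_scalar) \<Rightarrow> ('l \<Rightarrow> 'k) \<Rightarrow> 'k" where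
  "dual_of q L a x = (if x \<in> carrier (ell q L) then pair L a x else 0)"

locale conjugate_exponents =
  fixes r q :: real
  assumes r: "1 < r" and q: "1 < q" and rq: "1 / r + 1 / q = 1"
begin

lemma exponents_le: "1 \<le> r" "1 \<le> q"
  using r q by auto

lemma flip: "conjugate_exponents q r"
  by unfold_locales (use r q rq in auto)

text \<open>Young's inequality for the normalised factors \<open>norm (a l) / A\<close> and
  \<open>norm (x l) / X\<close>, summed over F; as in \<open>minkowski_finite\<close>, bounds stand
  in for the norms.\<close>

lemma holder_finite:
  fixes a x :: "'l \<Rightarrow> 'k::real_normed_algebra"
  assumes F: "finite F" and A: "0 \<le> A" and X: "0 \<le> X"
    and a: "(\<Sum>l\<in>F. norm (a l) powr r) \<le> A powr r" and x: "(\<Sum>l\<in>F. norm (x l) powr q) \<le> X powr q"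
  shows "(\<Sum>l\<in>F. norm (a l) * norm (x l)) \<le> A * X"
proof -
  have vanish: "z l = 0" if "(\<Sum>j\<in>F. norm (z j) powr s) \<le> 0 powr s" "1 < s" "l \<in> F" for z :: "'l \<Rightarrow> 'k" and l s
  proof -
    have "(\<Sum>j\<in>F. norm (z j) powr s) = 0" using that by (intro antisym sum_nonneg) auto
    then show ?thesis using that F by (simp add: sum_nonneg_eq_0_iff)
  qed
  consider "A = 0" | "X = 0" | "0 < A" "0 < X" using A X by linarith
  then show ?thesis
  proof cases
    case 1
    then have "a l = 0" if "l \<in> F" for l using vanish[of a r l] a r that by simp
    then show ?thesis using 1 by simp
  next
    case 2
    then have "x l = 0" if "l \<in> F" for l using vanish[of x q l] x q that by simp
    then show ?thesis using 2 by simp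
  next
    case 3
    have "norm (a l) * norm (x l) \<le>
        A * X * (norm (a l) powr r / A powr r / r + norm (x l) powr q / X powr q / q)" for l
    proof -
      have "norm (a l) / A * (norm (x l) / X) \<le> (norm (a l) / A) powr r / r + (norm (x l) / X) powr q / q"
        using 3 by (intro Youngs_inequality r q rq) auto
      then have "A * X * (norm (a l) / A * (norm (x l) / X)) \<le>
          A * X * ((norm (a l) / A) powr r / r + (norm (x l) / X) powr q / q)"
        using 3 by (intro mult_left_mono) auto
      then show ?thesis using 3 by (simp add: powr_divide)
    qed
    then have "(\<Sum>l\<in>F. norm (a l) * norm (x l)) \<le>
       (\<Sum>l\<in>F. A * X * (norm (a l) powr r / A powr r / r + norm (x l) powr q / X powr q / q))"
      by (intro sum_mono)
    also have "\<dots> = A * X * ((\<Sum>l\<in>F. norm (a l) powr r) / A powr r / r + (\<Sum>l\<in>F. norm (x l) powr q) / X powr q / q)"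
      by (simp add: sum_distrib_left sum_divide_distrib flip: sum.distrib)
    also have "\<dots> \<le> A * X * (1 / r + 1 / q)"
      using 3 a x r q by (intro mult_left_mono add_mono divide_right_mono) auto
    finally show ?thesis using rq by simp
  qed
qed

context
  fixes L :: "'l set" and a x :: "'l \<Rightarrow> 'k::rc_scalar"
  assumes a: "a \<in> carrier (ell r L)" and x: "x \<in> carrier (ell q L)"
begin

lemma pair_abs_summable: "(\<lambda>l. norm (a l * x l)) summable_on L"
  and pair_bound: "norm (pair L a x) \<le> nrm (ell r L) a * nrm (ell q L) x"
proof -
  have le: "(\<Sum>l\<in>F. norm (a l * x l)) \<le> nrm (ell r L) a * nrm (ell q L) x" if "finite F" for F
    using holder_finite[OF that ell_nrm_nonneg ell_nrm_nonneg ell_sum_le[OF _ a that] ell_sum_le[OF _ x that]]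
      exponents_le by (simp add: norm_mult)
  show sm: "(\<lambda>l. norm (a l * x l)) summable_on L"
    using le by (intro nonneg_bdd_above_summable_on bdd_aboveI2) auto
  have "norm (pair L a x) \<le> (\<Sum>\<^sub>\<infinity>l\<in>L. norm (a l * x l))"
    unfolding pair_def using sm by (rule norm_infsum_bound)
  also have "\<dots> \<le> nrm (ell r L) a * nrm (ell q L) x"
    using sm le by (intro infsum_le_finite_sums) auto
  finally show "norm (pair L a x) \<le> nrm (ell r L) a * nrm (ell q L) x" .
qed

lemma pair_summable: "(\<lambda>l. a l * x l) summable_on L"
  using pair_abs_summable by (rule abs_summable_summable)

lemma pair_smul_right: "pair L a (smul (ell q L) c x) = c * pair L a x"
  unfolding pair_def ell_smul using infsum_cmult_right[OF pair_summable, of c] by (simp add: mult_ac)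

end

lemma pair_add_right:
  assumes "a \<in> carrier (ell r L)" "x \<in> carrier (ell q L)" "y \<in> carrier (ell q L)"
  shows "pair L a (x + y) = pair L a x + pair L a y"
  unfolding pair_def
  using infsum_add[OF pair_summable[OF assms(1,2)] pair_summable[OF assms(1,3)]]
  by (simp add: distrib_left)

lemma pair_finite:
  assumes "finite F" "F \<subseteq> L"
  shows "pair L a (res F x) = (\<Sum>l\<in>F. a l * x l)"
proof -
  have "pair L a (res F x) = (\<Sum>\<^sub>\<infinity>l\<in>F. a l * x l)"
    unfolding pair_def using assms by (intro infsum_cong_neutral) (auto simp: res_def)
  then show ?thesis using assms by simp
qed

lemma pair_unit: "l \<in> L \<Longrightarrow> pair L a (unit l) = a l"
  using pair_finite[of "{l}" L a "\<lambda>_. 1"] by (auto simp: res_def unit_def cong: if_cong)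

lemma dual_of_mem:
  assumes a: "a \<in> carrier (ell r L)"
  shows "dual_of q L a \<in> carrier (dual (ell q L))" and "nrm (dual (ell q L)) (dual_of q L a) \<le> nrm (ell r L) a"
proof -
  interpret X: seminormed "ell q L" by (rule ell_seminormed[OF exponents_le(2)])
  have le: "norm (dual_of q L a x) \<le> nrm (ell r L) a * nrm (ell q L) x" if "x \<in> carrier (ell q L)" for x
    using pair_bound[OF a that] that by (simp add: dual_of_def)
  show "dual_of q L a \<in> carrier (dual (ell q L))"
    by (rule X.dualI[OF _ _ _ le])
      (auto simp: dual_of_def X.add_mem X.smul_mem pair_add_right[OF a] pair_smul_right[OF a])
  show "nrm (dual (ell q L)) (dual_of q L a) \<le> nrm (ell r L) a"
    using le ell_nrm_nonneg[OF exponents_le(1)] by (intro X.dual_nrm_le)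
qed

text \<open>The values of f on the unit vectors form a; the converse of Holder's inequality bounds
  its finite r-sums, and f agrees with a on finitely supported vectors, which are dense because q is
  finite.\<close>

lemma ell_dual_represent:
  fixes f :: "('l \<Rightarrow> 'k::rc_scalar) \<Rightarrow> 'k"
  assumes f: "f \<in> carrier (dual (ell q L))"
  obtains a where "a \<in> carrier (ell r L)" "nrm (ell r L) a \<le> nrm (dual (ell q L)) f" "f = dual_of q L a"
proof -
  interpret X: seminormed "ell q L :: ('k, 'l \<Rightarrow> 'k) nspace" by (rule ell_seminormed[OF exponents_le(2)])
  define a where "a l = (if l \<in> L then f (unit l) else 0)" for l
  have fin: "f (res F x) = (\<Sum>l\<in>F. a l * x l)" if "finite F" "F \<subseteq> L" for F x
  proof -
    have u: "(unit l :: 'l \<Rightarrow> 'k) \<in> carrier (ell q L)" if "l \<in> F" for l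
      using that \<open>F \<subseteq> L\<close> by (intro unit_mem(1)[OF exponents_le(2)]) auto
    have "f (res F x) = (\<Sum>l\<in>F. f (smul (ell q L) (x l) (unit l)))"
      unfolding res_finite_expand[OF exponents_le(2) that(1), of x L]
      by (rule X.dual_sum[OF f X.smul_mem[OF u]])
    also have "\<dots> = (\<Sum>l\<in>F. a l * x l)"
      using u that by (intro sum.cong) (auto simp: X.dual_smul[OF f] a_def mult.commute)
    finally show ?thesis .
  qed
  have bound: "(\<Sum>l\<in>F. norm (a l) powr r) \<le> nrm (dual (ell q L)) f powr r" if F: "finite F" "F \<subseteq> L" for F
  proof -
    define S where "S = (\<Sum>l\<in>F. norm (a l) powr r)"
    have S0: "0 \<le> S" unfolding S_def by (intro sum_nonneg) auto
    \<comment> \<open>The case of equality in Holder's inequality: both \<open>a l * y l\<close> and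
      \<open>norm (y l) powr q\<close> equal \<open>norm (a l) powr r\<close>. Where
      \<open>a l = 0\<close>, division by zero yields \<open>y l = 0\<close>, as required.\<close>
    define y where "y l = of_real (norm (a l) powr r) / a l" for l
    have y: "norm (y l) powr q = norm (a l) powr r" for l
    proof (cases "a l = 0")
      case False
      have "norm (y l) = norm (a l) powr (r - 1)"
        using False by (simp add: y_def norm_divide powr_diff)
      moreover have "(r - 1) * q = r" using r q rq by (simp add: field_simps)
      ultimately show ?thesis by (simp add: powr_powr)
    qed (simp add: y_def)
    have ay: "a l * y l = of_real (norm (a l) powr r)" for l
      by (simp add: y_def)
    have le: "(\<Sum>l\<in>G. norm (res F y l) powr q) \<le> (S powr (1 / q)) powr q" if "finite G" for G
    proof -
      have "(\<Sum>l\<in>G. norm (res F y l) powr q) = (\<Sum>l\<in>G \<inter> F. norm (a l) powr r)"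
        using that by (simp add: res_def sum.inter_restrict if_distrib[of norm] if_distrib[of "\<lambda>t. t powr q"] y cong: if_cong)
      also have "\<dots> \<le> S" unfolding S_def using F by (intro sum_mono2) auto
      finally show ?thesis using q S0 by (simp add: powr_powr)
    qed
    have mem: "res F y \<in> carrier (ell q L)" and ny: "nrm (ell q L) (res F y) \<le> S powr (1 / q)"
      by (rule ellI[OF exponents_le(2) _ _ le]; use F in \<open>auto simp: res_def\<close>)+
    have "f (res F y) = of_real S" unfolding fin[OF F] ay S_def by simp
    then have "S = norm (f (res F y))" using S0 by simp
    also have "\<dots> \<le> nrm (dual (ell q L)) f * nrm (ell q L) (res F y)"
      by (rule X.dual_bound[OF f mem])
    also have "\<dots> \<le> nrm (dual (ell q L)) f * S powr (1 / q)"
      by (intro mult_left_mono ny X.dual_nrm_nonneg f)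
    \<comment> \<open>Dividing by \<open>S powr (1 / q)\<close> leaves
      \<open>S powr (1 / r)\<close>, the r-norm of a over F.\<close>
    finally have SS: "S \<le> nrm (dual (ell q L)) f * S powr (1 / q)" .
    show ?thesis
    proof (cases "S = 0")
      case False
      with S0 have S: "0 < S" by simp
      have "1 / r = 1 - 1 / q" using rq by simp
      then have "S powr (1 / r) = S powr 1 / S powr (1 / q)" by (simp only: powr_diff)
      also have "\<dots> \<le> nrm (dual (ell q L)) f" using SS S by (simp add: field_simps)
      finally have "(S powr (1 / r)) powr r \<le> nrm (dual (ell q L)) f powr r"
        using r by (intro powr_mono2) auto
      then show ?thesis using r S by (simp add: powr_powr S_def)
    qed (simp add: S_def)
  qed
  have a: "a \<in> carrier (ell r L)" and na: "nrm (ell r L) a \<le> nrm (dual (ell q L)) f"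
    by (rule ellI[OF exponents_le(1) _ _ bound]; simp add: a_def X.dual_nrm_nonneg[OF f])+
  have "f x = dual_of q L a x" for x
  proof (cases "x \<in> carrier (ell q L)")
    case False
    then show ?thesis using X.dual_outside[OF f] by (simp add: dual_of_def)
  next
    case x: True
    note g = dual_of_mem[OF a]
    let ?M = "nrm (dual (ell q L)) f + nrm (dual (ell q L)) (dual_of q L a)"
    have M: "0 \<le> ?M" using X.dual_nrm_nonneg f g by (simp add: add_nonneg_nonneg)
    have "norm (f x - dual_of q L a x) \<le> 0 + e" if e: "0 < e" for e
    proof -
      have e': "0 < e / (?M + 1)" using M e by simp
      obtain F where F: "finite F" "F \<subseteq> L" "nrm (ell q L) (res (- F) x) \<le> e / (?M + 1)"
        using ell_tail[OF exponents_le(2) x e'] by (metis Compl_disjoint2)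
      have mem: "res F x \<in> carrier (ell q L)" "res (- F) x \<in> carrier (ell q L)"
        using res_mem[OF exponents_le(2) x] by auto
      have x_split: "x = res F x + res (- F) x"
        using res_diff_set[of x F] by (simp add: algebra_simps)
      have "dual_of q L a (res F x) = f (res F x)"
        using mem by (simp add: fin[OF F(1,2)] dual_of_def pair_finite[OF F(1,2)])
      then have "f x - dual_of q L a x = f (res (- F) x) - dual_of q L a (res (- F) x)"
        by (subst (1 2) x_split) (simp add: X.dual_add f g mem)
      also have "norm \<dots> \<le> norm (f (res (- F) x)) + norm (dual_of q L a (res (- F) x))"
        by (rule norm_triangle_ineq4)
      also have "\<dots> \<le> ?M * nrm (ell q L) (res (- F) x)"
        using X.dual_bound[OF f mem(2)] X.dual_bound[OF g(1) mem(2)] by (simp add: distrib_right)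
      also have "\<dots> \<le> ?M * (e / (?M + 1))" using F M by (intro mult_left_mono) auto
      also have "\<dots> \<le> e" using M e by (simp add: field_simps)
      finally show ?thesis by simp
    qed
    then have "norm (f x - dual_of q L a x) \<le> 0" by (rule field_le_epsilon)
    then show ?thesis by simp
  qed
  then show ?thesis using a na that by blast
qed

text \<open>The representing vector lies in \<open>\<ell>^r\<close> with r finite, so its tails are
  small in norm. The row and column estimates for functionals on Z rest on this.\<close>

lemma ell_dual_tail:
  fixes f :: "('l \<Rightarrow> 'k::rc_scalar) \<Rightarrow> 'k"
  assumes f: "f \<in> carrier (dual (ell q L))" and e: "0 < e"
  obtains F where "finite F" "F \<subseteq> L"
    "\<And>x. x \<in> carrier (ell q L) \<Longrightarrow> norm (f (res (- F) x)) \<le> e * nrm (ell q L) x"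
proof -
  obtain a where a: "a \<in> carrier (ell r L)" "f = dual_of q L a"
    using ell_dual_represent[OF f] by metis
  obtain F where F: "finite F" "F \<subseteq> L" "nrm (ell r L) (res (- F) a) \<le> e"
    using ell_tail[OF exponents_le(1) a(1) e] by (metis Compl_disjoint2)
  have "norm (f (res (- F) x)) \<le> e * nrm (ell q L) x" if x: "x \<in> carrier (ell q L)" for x
  proof -
    have "f (res (- F) x) = pair L (res (- F) a) x"
      using res_mem(1)[OF exponents_le(2) x] by (simp add: a(2) dual_of_def pair_res)
    then have "norm (f (res (- F) x)) \<le> nrm (ell r L) (res (- F) a) * nrm (ell q L) x"
      using pair_bound[OF res_mem(1)[OF exponents_le(1) a(1)] x] by simp
    also have "\<dots> \<le> e * nrm (ell q L) x"
      using F by (intro mult_right_mono ell_nrm_nonneg exponents_le)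
    finally show ?thesis .
  qed
  then show ?thesis using F(1,2) that by blast
qed

end

section \<open>The space of nuclear operators from \<open>\<ell>\<^sup>q(L)\<close> to \<open>\<ell>\<^sup>p(J)\<close>\<close>

lemma infsum_eq_suminf_nonneg:
  fixes f :: "nat \<Rightarrow> real"
  assumes "\<And>n. 0 \<le> f n" "summable f"
  shows "infsum f UNIV = suminf f"
proof -
  have "f summable_on UNIV" using assms by (simp add: summable_on_UNIV_nonneg_real_iff)
  then have "f sums infsum f UNIV" by (intro has_sum_imp_sums has_sum_infsum)
  then show ?thesis by (simp add: sums_iff)
qed

text \<open>The conjugate exponent r of q is a parameter, so that X' is literally
  \<open>ell r L\<close>; the theorem instantiates it with q / (q - 1).\<close>

locale nuclear_ell = conjugate_exponents r q for r q :: real +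
  fixes p :: real and J :: "'j set" and L :: "'l set"
    and Z :: "('k::rc_scalar, ('l \<Rightarrow> 'k) \<Rightarrow> ('j \<Rightarrow> 'k)) nspace"
  assumes p: "1 < p" and Z_def: "Z = nuclear_space (ell q L) (ell p J)"
begin

abbreviation X :: "('k, 'l \<Rightarrow> 'k) nspace" where "X \<equiv> ell q L"
abbreviation X' :: "('k, 'l \<Rightarrow> 'k) nspace" where "X' \<equiv> ell r L"
abbreviation Y :: "('k, 'j \<Rightarrow> 'k) nspace" where "Y \<equiv> ell p J"

lemma p_le: "1 \<le> p" using p by simp

sublocale X: seminormed X by (rule ell_seminormed[OF exponents_le(2)])
sublocale X': seminormed X' by (rule ell_seminormed[OF exponents_le(1)])
sublocale Y: seminormed Y by (rule ell_seminormed[OF p_le])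

lemmas X_res = res_mem[OF exponents_le(2)]
lemmas X'_res = res_mem[OF exponents_le(1)]
lemmas Y_res = res_mem[OF p_le]
lemmas Y_coord = ell_coord_le[OF p_le]

lemma pair_add_left:
  assumes "a \<in> carrier X'" "b \<in> carrier X'" "x \<in> carrier X"
  shows "pair L (a + b) x = pair L a x + pair L b x"
  using conjugate_exponents.pair_add_right[OF flip assms(3,1,2)] by (simp add: pair_commute)

lemma pair_smul_left:
  assumes "a \<in> carrier X'" "x \<in> carrier X"
  shows "pair L (smul X' c a) x = c * pair L a x"
  using conjugate_exponents.pair_smul_right[OF flip assms(2,1), of c] by (simp add: pair_commute)

section \<open>Nuclear representations by coefficient vectors\<close>

definition weight :: "('i \<Rightarrow> 'l \<Rightarrow> 'k) \<Rightarrow> ('i \<Rightarrow> 'j \<Rightarrow> 'k) \<Rightarrow> 'i \<Rightarrow> real" where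
  "weight a y i = nrm X' (a i) * nrm Y (y i)"

text \<open>Compared with \<open>nuclear_rep\<close>, functionals become vectors of X', norm
  convergence becomes unconditional convergence of each coordinate, and the index type is arbitrary.
  This form can be rearranged and joined over pairs of indices.\<close>

definition trep :: "(('l \<Rightarrow> 'k) \<Rightarrow> ('j \<Rightarrow> 'k)) \<Rightarrow> ('i \<Rightarrow> 'l \<Rightarrow> 'k) \<Rightarrow> ('i \<Rightarrow> 'j \<Rightarrow> 'k) \<Rightarrow> bool" where
  "trep T a y \<longleftrightarrow> (\<forall>i. a i \<in> carrier X') \<and> (\<forall>i. y i \<in> carrier Y) \<and> weight a y summable_on UNIV \<and>
     (\<forall>x. x \<notin> carrier X \<longrightarrow> T x = 0) \<and>
     (\<forall>x\<in>carrier X. \<forall>j. ((\<lambda>i. pair L (a i) x * y i j) has_sum T x j) UNIV)"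

lemma weight_nonneg: "0 \<le> weight a y i"
  unfolding weight_def by (intro mult_nonneg_nonneg ell_nrm_nonneg exponents_le p_le)

lemma term_bound:
  assumes "a \<in> carrier X'" "y \<in> carrier Y" "x \<in> carrier X"
  shows "norm (pair L a x * y j) \<le> nrm X x * (nrm X' a * nrm Y y)"
  using mult_mono[OF pair_bound[OF assms(1,3)] Y_coord[OF assms(2), of j]]
    X.nrm_nonneg[OF assms(3)] X'.nrm_nonneg[OF assms(1)]
  by (simp add: norm_mult mult_ac)

lemma trep_summable:
  assumes "\<And>i. a i \<in> carrier X'" "\<And>i. y i \<in> carrier Y" "weight a y summable_on UNIV" "x \<in> carrier X"
  shows "(\<lambda>i. norm (pair L (a i) x * y i j)) summable_on UNIV"
    and "(\<lambda>i. pair L (a i) x * y i j) summable_on UNIV"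
proof -
  have "(\<lambda>i. nrm X x * weight a y i) summable_on UNIV"
    using assms(3) by (rule summable_on_cmult_right)
  then show "(\<lambda>i. norm (pair L (a i) x * y i j)) summable_on UNIV"
    by (rule Infinite_Sum.abs_summable_on_comparison_test') (use assms term_bound in \<open>auto simp: weight_def\<close>)
  then show "(\<lambda>i. pair L (a i) x * y i j) summable_on UNIV" by (rule abs_summable_summable)
qed

text \<open>Every finite piece of the tail obeys the norm bound, and \<open>ell_limit\<close> passes
  it to the coordinatewise limit: summable weights force convergence in norm.\<close>

lemma trep_tail:
  fixes a :: "nat \<Rightarrow> 'l \<Rightarrow> 'k"
  assumes T: "trep T a y" and x: "x \<in> carrier X"
  shows "T x - (\<Sum>n<m. smul Y (pair L (a n) x) (y n)) \<in> carrier Y"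
    and "nrm Y (T x - (\<Sum>n<m. smul Y (pair L (a n) x) (y n))) \<le> nrm X x * (\<Sum>n. weight a y (n + m))"
proof -
  note T' = T[unfolded trep_def]
  have a: "a n \<in> carrier X'" and y: "y n \<in> carrier Y" for n using T' by auto
  have sw: "summable (weight a y)"
    using T' weight_nonneg[of a y] by (simp add: summable_on_UNIV_nonneg_real_iff)
  then have sw': "summable (\<lambda>n. weight a y (n + m))" by (rule summable_ignore_initial_segment)
  let ?S = "\<lambda>N. \<Sum>n<N. smul Y (pair L (a (n + m)) x) (y (n + m))"
  have mem: "?S N \<in> carrier Y" for N by (intro Y.sum_mem Y.smul_mem y)
  have bound: "nrm Y (?S N) \<le> nrm X x * (\<Sum>n. weight a y (n + m))" for N
  proof -
    have "nrm Y (?S N) \<le> (\<Sum>n<N. nrm Y (smul Y (pair L (a (n + m)) x) (y (n + m))))"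
      by (intro Y.nrm_sum Y.smul_mem y)
    also have "\<dots> \<le> (\<Sum>n<N. nrm X x * weight a y (n + m))"
    proof (rule sum_mono)
      fix n
      have "norm (pair L (a (n + m)) x) * nrm Y (y (n + m)) \<le> nrm X' (a (n + m)) * nrm X x * nrm Y (y (n + m))"
        by (intro mult_right_mono pair_bound a x Y.nrm_nonneg y)
      then show "nrm Y (smul Y (pair L (a (n + m)) x) (y (n + m))) \<le> nrm X x * weight a y (n + m)"
        by (simp add: Y.nrm_smul y weight_def mult_ac)
    qed
    also have "\<dots> \<le> nrm X x * (\<Sum>n. weight a y (n + m))"
      unfolding sum_distrib_left[symmetric]
      by (intro mult_left_mono sum_le_suminf sw' X.nrm_nonneg x) (auto simp: weight_nonneg)
    finally show ?thesis .
  qed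
  have lim: "(\<lambda>N. ?S N j) \<longlonglongrightarrow> (T x - (\<Sum>n<m. smul Y (pair L (a n) x) (y n))) j" for j
  proof -
    have "(\<lambda>n. pair L (a n) x * y n j) sums T x j"
      using T' x by (intro has_sum_imp_sums) auto
    then have "(\<lambda>n. pair L (a (n + m)) x * y (n + m) j) sums (T x j - (\<Sum>n<m. pair L (a n) x * y n j))"
      by (rule sums_split_initial_segment)
    then show ?thesis by (simp add: sums_def sum_fun_apply ell_smul)
  qed
  show "T x - (\<Sum>n<m. smul Y (pair L (a n) x) (y n)) \<in> carrier Y"
    and "nrm Y (T x - (\<Sum>n<m. smul Y (pair L (a n) x) (y n))) \<le> nrm X x * (\<Sum>n. weight a y (n + m))"
    by (rule ell_limit[OF p_le mem bound lim])+
qed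

lemma trep_linear:
  assumes T: "trep T a y"
  shows "x \<notin> carrier X \<Longrightarrow> T x = 0"
    and "x \<in> carrier X \<Longrightarrow> z \<in> carrier X \<Longrightarrow> T (x + z) = T x + T z"
    and "x \<in> carrier X \<Longrightarrow> T (smul X c x) = smul Y c (T x)"
proof -
  note T' = T[unfolded trep_def]
  have a: "a i \<in> carrier X'" for i using T' by auto
  have hs: "((\<lambda>i. pair L (a i) x * y i j) has_sum T x j) UNIV" if "x \<in> carrier X" for x j
    using T' that by auto
  show "x \<notin> carrier X \<Longrightarrow> T x = 0" using T' by auto
  show "T (x + z) = T x + T z" if x: "x \<in> carrier X" and z: "z \<in> carrier X"
  proof
    fix j
    show "T (x + z) j = (T x + T z) j"
      using has_sum_add[OF hs[OF x, of j] hs[OF z, of j]] hs[OF X.add_mem[OF x z], of j]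
      by (simp add: pair_add_right[OF a x z] distrib_right has_sum_unique)
  qed
  show "T (smul X c x) = smul Y c (T x)" if x: "x \<in> carrier X"
  proof
    fix j
    show "T (smul X c x) j = smul Y c (T x) j"
      using has_sum_unique[OF hs[OF X.smul_mem[OF x, of c], of j]] has_sum_cmult_right[OF hs[OF x, of j], of c]
      by (simp add: pair_smul_right[OF a x] mult.assoc ell_smul[of p])
  qed
qed

lemma carrier_Z: "carrier Z = {T \<in> linear_ops X Y. \<exists>f y. nuclear_rep X Y T f y}"
  and smul_Z: "smul Z = (\<lambda>c T x. smul Y c (T x))"
  and nrm_Z: "nrm Z T = Inf {\<Sum>n. nrm (dual X) (f n) * nrm Y (y n) | f y. nuclear_rep X Y T f y}"
  by (simp_all add: Z_def nuclear_space_def nuclear_norm_def)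

lemma nuclear_sum_nonneg:
  assumes "nuclear_rep X Y T f y" shows "0 \<le> (\<Sum>n. nrm (dual X) (f n) * nrm Y (y n))"
  using assms by (intro suminf_nonneg mult_nonneg_nonneg X.dual_nrm_nonneg Y.nrm_nonneg)
    (auto simp: nuclear_rep_def)

lemma nrm_Z_bdd: "bdd_below {\<Sum>n. nrm (dual X) (f n) * nrm Y (y n) | f y. nuclear_rep X Y T f y}"
  using nuclear_sum_nonneg by (intro bdd_belowI[where m = 0]) blast

text \<open>Together with \<open>nuclear_trep\<close> this exhibits \<open>nrm Z T\<close> as the
  infimum of the total weights of the representations \<open>trep\<close> of T over the natural
  numbers.\<close>

lemma trep_nuclear:
  fixes a :: "nat \<Rightarrow> 'l \<Rightarrow> 'k"
  assumes T: "trep T a y"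
  shows "T \<in> carrier Z" and "nrm Z T \<le> infsum (weight a y) UNIV"
proof -
  note T' = T[unfolded trep_def]
  have a: "a n \<in> carrier X'" and y: "y n \<in> carrier Y" for n using T' by auto
  have sw: "summable (weight a y)"
    using T' weight_nonneg[of a y] by (simp add: summable_on_UNIV_nonneg_real_iff)
  let ?f = "\<lambda>n. dual_of q L (a n)"
  have le: "nrm (dual X) (?f n) * nrm Y (y n) \<le> weight a y n" for n
    unfolding weight_def by (intro mult_right_mono dual_of_mem a Y.nrm_nonneg y)
  have sf: "summable (\<lambda>n. nrm (dual X) (?f n) * nrm Y (y n))"
  proof (rule summable_comparison_test_ev[OF _ sw])
    have "norm (nrm (dual X) (?f n) * nrm Y (y n)) \<le> weight a y n" for n
      using le[of n] X.dual_nrm_nonneg[OF dual_of_mem(1)[OF a]] Y.nrm_nonneg[OF y] by simp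
    then show "\<forall>\<^sub>F n in sequentially. norm (nrm (dual X) (?f n) * nrm Y (y n)) \<le> weight a y n" by simp
  qed
  have conv: "(\<lambda>m. nrm Y (T x - (\<Sum>n<m. smul Y (?f n x) (y n)))) \<longlonglongrightarrow> 0" if x: "x \<in> carrier X" for x
  proof (rule tendsto_sandwich[OF _ _ tendsto_const])
    show "\<forall>\<^sub>F m in sequentially. nrm Y (T x - (\<Sum>n<m. smul Y (?f n x) (y n))) \<le> nrm X x * (\<Sum>n. weight a y (n + m))"
      using trep_tail(2)[OF T x] x by (simp add: dual_of_def)
    have "(\<lambda>m. nrm X x * (\<Sum>n. weight a y (n + m))) \<longlonglongrightarrow> nrm X x * 0"
      by (intro tendsto_mult tendsto_const suminf_exist_split2 sw)
    then show "(\<lambda>m. nrm X x * (\<Sum>n. weight a y (n + m))) \<longlonglongrightarrow> 0" by simp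
    show "\<forall>\<^sub>F m in sequentially. 0 \<le> nrm Y (T x - (\<Sum>n<m. smul Y (?f n x) (y n)))"
      using trep_tail(1)[OF T x] x by (simp add: dual_of_def Y.nrm_nonneg)
  qed
  have rep: "nuclear_rep X Y T ?f y"
    unfolding nuclear_rep_def using dual_of_mem(1)[OF a] y sf conv by auto
  have "T x \<in> carrier Y" if "x \<in> carrier X" for x
    using trep_tail(1)[OF T that, of 0] by simp
  then have "T \<in> linear_ops X Y" unfolding linear_ops_def using trep_linear[OF T] by auto
  then show "T \<in> carrier Z" using rep by (auto simp: carrier_Z)
  have "nrm Z T \<le> (\<Sum>n. nrm (dual X) (?f n) * nrm Y (y n))"
    unfolding nrm_Z by (rule cInf_lower[OF _ nrm_Z_bdd]) (intro CollectI exI[of _ ?f] exI[of _ y] conjI refl rep)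
  also have "\<dots> \<le> (\<Sum>n. weight a y n)" by (intro suminf_le le sf sw)
  also have "\<dots> = infsum (weight a y) UNIV"
    using infsum_eq_suminf_nonneg[OF weight_nonneg sw] by simp
  finally show "nrm Z T \<le> infsum (weight a y) UNIV" .
qed

text \<open>\<open>ell_dual_represent\<close> replaces each functional by a vector of no larger
  norm, so the total weight does not grow in the passage to \<open>trep\<close>.\<close>

lemma nuclear_trep:
  assumes T: "T \<in> carrier Z" and e: "0 < e"
  obtains a y where "trep T (a :: nat \<Rightarrow> 'l \<Rightarrow> 'k) y" "infsum (weight a y) UNIV < nrm Z T + e"
proof -
  let ?S = "{\<Sum>n. nrm (dual X) (f n) * nrm Y (y n) | f y. nuclear_rep X Y T f y}"
  have "?S \<noteq> {}" using T by (auto simp: carrier_Z)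
  moreover have "Inf ?S < nrm Z T + e" using e by (simp add: nrm_Z)
  ultimately obtain f y where rep: "nuclear_rep X Y T f y"
    and lt: "(\<Sum>n. nrm (dual X) (f n) * nrm Y (y n)) < nrm Z T + e"
    using cInf_less_iff[OF _ nrm_Z_bdd] by blast
  have f: "f n \<in> carrier (dual X)" and y: "y n \<in> carrier Y" for n using rep by (auto simp: nuclear_rep_def)
  have "\<exists>a. a \<in> carrier X' \<and> nrm X' a \<le> nrm (dual X) (f n) \<and> f n = dual_of q L a" for n
    using ell_dual_represent[OF f[of n]] by metis
  then obtain a where a: "\<And>n. a n \<in> carrier X'" "\<And>n. nrm X' (a n) \<le> nrm (dual X) (f n)"
      "\<And>n. f n = dual_of q L (a n)"
    by metis
  have sf: "summable (\<lambda>n. nrm (dual X) (f n) * nrm Y (y n))" using rep by (simp add: nuclear_rep_def)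
  have le: "weight a y n \<le> nrm (dual X) (f n) * nrm Y (y n)" for n
    unfolding weight_def by (intro mult_right_mono a Y.nrm_nonneg y)
  have sw: "summable (weight a y)"
    by (rule summable_comparison_test_ev[OF _ sf]) (use le in \<open>auto intro!: always_eventually simp: weight_nonneg\<close>)
  have swo: "weight a y summable_on UNIV" using sw weight_nonneg[of a y] by (simp add: summable_on_UNIV_nonneg_real_iff)
  have hs: "((\<lambda>n. pair L (a n) x * y n j) has_sum T x j) UNIV" if x: "x \<in> carrier X" for x j
  proof (rule norm_summable_imp_has_sum)
    show "summable (\<lambda>n. norm (pair L (a n) x * y n j))"
      using trep_summable(1)[OF a(1) y swo x, of j] by (simp add: summable_on_UNIV_nonneg_real_iff)
    have Tx: "T x \<in> carrier Y" using T x by (auto simp: carrier_Z linear_ops_def)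
    have "(\<lambda>m. T x j - (\<Sum>n<m. pair L (a n) x * y n j)) \<longlonglongrightarrow> 0"
    proof (rule Lim_null_comparison)
      show "(\<lambda>m. nrm Y (T x - (\<Sum>n<m. smul Y (f n x) (y n)))) \<longlonglongrightarrow> 0"
        using rep x by (simp add: nuclear_rep_def)
      have "norm (T x j - (\<Sum>n<m. pair L (a n) x * y n j)) \<le> nrm Y (T x - (\<Sum>n<m. smul Y (f n x) (y n)))" for m
      proof -
        have "T x - (\<Sum>n<m. smul Y (f n x) (y n)) \<in> carrier Y"
          by (intro Y.diff_mem Tx Y.sum_mem Y.smul_mem y)
        from Y_coord[OF this, of j] show ?thesis
          using x by (simp add: sum_fun_apply ell_smul a(3) dual_of_def)
      qed
      then show "\<forall>\<^sub>F m in sequentially. norm (T x j - (\<Sum>n<m. pair L (a n) x * y n j))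
          \<le> nrm Y (T x - (\<Sum>n<m. smul Y (f n x) (y n)))" by simp
    qed
    from tendsto_diff[OF tendsto_const[of "T x j"] this] show "(\<lambda>n. pair L (a n) x * y n j) sums T x j"
      by (simp add: sums_def)
  qed
  have "trep T a y"
    unfolding trep_def using a(1) y swo hs T by (auto simp: carrier_Z linear_ops_def)
  moreover have "infsum (weight a y) UNIV < nrm Z T + e"
  proof -
    have "infsum (weight a y) UNIV = (\<Sum>n. weight a y n)" by (intro infsum_eq_suminf_nonneg weight_nonneg sw)
    also have "\<dots> \<le> (\<Sum>n. nrm (dual X) (f n) * nrm Y (y n))" by (intro suminf_le le sf sw)
    finally show ?thesis using lt by simp
  qed
  ultimately show ?thesis by (rule that)
qed

lemma Z_outside: "T \<in> carrier Z \<Longrightarrow> x \<notin> carrier X \<Longrightarrow> T x = 0"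
  by (auto simp: carrier_Z linear_ops_def)

lemma Z_apply_mem: "T \<in> carrier Z \<Longrightarrow> x \<in> carrier X \<Longrightarrow> T x \<in> carrier Y"
  by (auto simp: carrier_Z linear_ops_def)

lemma Z_apply_add: "T \<in> carrier Z \<Longrightarrow> x \<in> carrier X \<Longrightarrow> z \<in> carrier X \<Longrightarrow> T (x + z) = T x + T z"
  by (auto simp: carrier_Z linear_ops_def)

lemma Z_apply_smul: "T \<in> carrier Z \<Longrightarrow> x \<in> carrier X \<Longrightarrow> T (smul X c x) = smul Y c (T x)"
  by (auto simp: carrier_Z linear_ops_def)

lemma nrm_Z_nonneg:
  assumes "T \<in> carrier Z" shows "0 \<le> nrm Z T"
  unfolding nrm_Z
proof (rule cInf_greatest)
  show "{\<Sum>n. nrm (dual X) (f n) * nrm Y (y n) | f y. nuclear_rep X Y T f y} \<noteq> {}"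
    using assms by (auto simp: carrier_Z)
qed (use nuclear_sum_nonneg in blast)

lemma trep_reindex:
  assumes T: "trep T (a :: 'i \<Rightarrow> 'l \<Rightarrow> 'k) y" and g: "bij_betw g (UNIV :: 'i' set) UNIV"
  shows "trep T (\<lambda>i. a (g i)) (\<lambda>i. y (g i))"
    and "infsum (weight (\<lambda>i. a (g i)) (\<lambda>i. y (g i))) UNIV = infsum (weight a y) UNIV"
proof -
  note T' = T[unfolded trep_def]
  have w: "weight (\<lambda>i. a (g i)) (\<lambda>i. y (g i)) = (\<lambda>i. weight a y (g i))" by (auto simp: weight_def)
  have "((\<lambda>i. pair L (a (g i)) x * y (g i) j) has_sum T x j) UNIV" if "x \<in> carrier X" for x j
    using has_sum_reindex_bij_betw[OF g, of "\<lambda>i. pair L (a i) x * y i j"] T' that by simp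
  moreover have "(\<lambda>i. weight a y (g i)) summable_on UNIV"
    using summable_on_reindex_bij_betw[OF g] T' by blast
  ultimately show "trep T (\<lambda>i. a (g i)) (\<lambda>i. y (g i))" using T' unfolding trep_def w by auto
  show "infsum (weight (\<lambda>i. a (g i)) (\<lambda>i. y (g i))) UNIV = infsum (weight a y) UNIV"
    unfolding w by (rule infsum_reindex_bij_betw[OF g])
qed

text \<open>Representations of the T k that are optimal up to e / 2^(k+1) are joined into one
  indexed by pairs (k, n); the errors add up to e. Both the triangle inequality and completeness of
  the nuclear norm are instances.\<close>

lemma nuclear_series:
  fixes T :: "nat \<Rightarrow> ('l \<Rightarrow> 'k) \<Rightarrow> 'j \<Rightarrow> 'k"
  assumes T: "\<And>k. T k \<in> carrier Z" and sm: "(\<lambda>k. nrm Z (T k)) summable_on UNIV"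
    and out: "\<And>x. x \<notin> carrier X \<Longrightarrow> S x = 0"
    and S: "\<And>x j. x \<in> carrier X \<Longrightarrow> ((\<lambda>k. T k x j) has_sum S x j) UNIV"
  shows "S \<in> carrier Z" and "nrm Z S \<le> (\<Sum>\<^sub>\<infinity>k. nrm Z (T k))"
proof -
  have key: "S \<in> carrier Z \<and> nrm Z S \<le> (\<Sum>\<^sub>\<infinity>k. nrm Z (T k)) + e" if e: "0 < e" for e
  proof -
    have "\<exists>a y. trep (T k) (a :: nat \<Rightarrow> 'l \<Rightarrow> 'k) y \<and> infsum (weight a y) UNIV < nrm Z (T k) + e * (1/2) ^ Suc k" for k
    proof -
      have "0 < e * (1/2) ^ Suc k" using e by simp
      from nuclear_trep[OF T[of k] this] show ?thesis by blast
    qed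
    then obtain a y where rep: "\<And>k. trep (T k) (a k :: nat \<Rightarrow> 'l \<Rightarrow> 'k) (y k)"
      and lt: "\<And>k. infsum (weight (a k) (y k)) UNIV < nrm Z (T k) + e * (1/2) ^ Suc k"
      by metis
    define a' where "a' = (\<lambda>(k, n). a k n)"
    define y' where "y' = (\<lambda>(k, n). y k n)"
    let ?g = "\<lambda>k. infsum (weight (a k) (y k)) UNIV"
    have geo: "((\<lambda>k. e * (1/2) ^ Suc k) has_sum e) UNIV"
    proof (rule norm_summable_imp_has_sum)
      have 1: "(\<lambda>k. e * (1/2) ^ Suc k) sums (e * 1)" by (intro sums_mult power_half_series)
      then show "(\<lambda>k. e * (1/2) ^ Suc k) sums e" by simp
      show "summable (\<lambda>k. norm (e * (1/2) ^ Suc k))" using 1 e by (simp add: sums_iff)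
    qed
    have h_sum: "((\<lambda>k. nrm Z (T k) + e * (1/2) ^ Suc k) has_sum (\<Sum>\<^sub>\<infinity>k. nrm Z (T k)) + e) UNIV"
      by (intro has_sum_add has_sum_infsum sm geo)
    have gs: "?g summable_on UNIV"
    proof (rule summable_on_comparison_test)
      show "(\<lambda>k. nrm Z (T k) + e * (1/2) ^ Suc k) summable_on UNIV"
        using h_sum by (rule has_sum_imp_summable)
      show "?g k \<le> nrm Z (T k) + e * (1/2) ^ Suc k" for k using lt[of k] by simp
      show "0 \<le> ?g k" for k by (intro infsum_nonneg weight_nonneg)
    qed
    have wk: "weight a' y' (k, n) = weight (a k) (y k) n" for k n
      by (simp add: weight_def a'_def y'_def)
    have ws: "weight a' y' summable_on UNIV \<times> UNIV"
    proof (rule summable_on_SigmaI[OF _ gs])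
      fix k
      show "((\<lambda>n. weight a' y' (k, n)) has_sum ?g k) UNIV"
        unfolding wk using rep[of k] by (intro has_sum_infsum) (simp add: trep_def)
    qed (rule weight_nonneg)
    then have ws': "weight a' y' summable_on UNIV" by simp
    have mem: "a' i \<in> carrier X'" "y' i \<in> carrier Y" for i
      using rep[of "fst i"] by (auto simp: trep_def a'_def y'_def split_def)
    have "((\<lambda>i. pair L (a' i) x * y' i j) has_sum S x j) (UNIV \<times> UNIV)" if x: "x \<in> carrier X" for x j
    proof (rule has_sum_SigmaI[OF _ S[OF x]])
      fix k
      show "((\<lambda>n. pair L (a' (k, n)) x * y' (k, n) j) has_sum T k x j) UNIV"
        using rep[of k] x by (simp add: trep_def a'_def y'_def)
    qed (use trep_summable(2)[OF mem ws' x] in simp)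
    then have "trep S a' y'" unfolding trep_def using mem ws' out by auto
    note S_rep = trep_reindex[OF this bij_prod_decode]
    have "infsum (weight a' y') UNIV = infsum ?g UNIV"
      using infsum_Sigma_banach[OF ws] by (simp add: wk)
    also have "\<dots> \<le> (\<Sum>\<^sub>\<infinity>k. nrm Z (T k)) + e"
    proof -
      have "infsum ?g UNIV \<le> (\<Sum>\<^sub>\<infinity>k. nrm Z (T k) + e * (1/2) ^ Suc k)"
        using gs has_sum_imp_summable[OF h_sum] lt by (intro infsum_mono) (auto intro: less_imp_le)
      then show ?thesis using infsumI[OF h_sum] by simp
    qed
    finally show ?thesis
      using trep_nuclear[OF S_rep(1)] S_rep(2) by simp
  qed
  show "S \<in> carrier Z" using key[of 1] by simp
  show "nrm Z S \<le> (\<Sum>\<^sub>\<infinity>k. nrm Z (T k))" by (rule field_le_epsilon) (use key in auto)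
qed

section \<open>Seminorm properties of the nuclear norm\<close>

lemma zero_Z: "0 \<in> carrier Z" "nrm Z 0 = 0"
proof -
  have rep: "trep 0 (\<lambda>_::nat. 0) (\<lambda>_. 0)"
    unfolding trep_def weight_def using X'.zero_mem Y.zero_mem
    by (auto simp: X'.nrm_zero pair_def)
  show "0 \<in> carrier Z" using trep_nuclear[OF rep] by simp
  have "weight (\<lambda>_::nat. 0) (\<lambda>_. 0) = (\<lambda>_. 0)" by (auto simp: weight_def X'.nrm_zero)
  then have "nrm Z 0 \<le> 0" using trep_nuclear(2)[OF rep] by simp
  then show "nrm Z 0 = 0" using nrm_Z_nonneg[OF trep_nuclear(1)[OF rep]] by simp
qed

sublocale Z: seminormed Z
proof
  show "0 \<in> carrier Z" by (rule zero_Z)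
next
  fix S T assume S: "S \<in> carrier Z" and T: "T \<in> carrier Z"
  \<comment> \<open>The triangle inequality is \<open>nuclear_series\<close> for the sequence S, T,
    0, 0, ...\<close>
  define U where "U k = (if k = 0 then S else if k = 1 then T else 0)" for k :: nat
  have U: "U k \<in> carrier Z" for k using S T zero_Z by (simp add: U_def)
  have hs: "((\<lambda>k. F (U k)) has_sum F S + F T) UNIV" if "F 0 = 0"
    for F :: "(('l \<Rightarrow> 'k) \<Rightarrow> 'j \<Rightarrow> 'k) \<Rightarrow> 'c::{topological_comm_monoid_add}"
  proof -
    have "((\<lambda>k. F (U k)) has_sum (\<Sum>k\<in>{0, 1}. F (U k))) {0, 1}" by (intro has_sum_finite) auto
    then have "((\<lambda>k. F (U k)) has_sum (\<Sum>k\<in>{0, 1}. F (U k))) UNIV"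
      by (subst (asm) has_sum_cong_neutral[where T = UNIV and g = "\<lambda>k. F (U k)"])
        (auto simp: U_def that)
    then show ?thesis by (simp add: U_def)
  qed
  have n: "((\<lambda>k. nrm Z (U k)) has_sum nrm Z S + nrm Z T) UNIV" by (intro hs zero_Z)
  have "((\<lambda>k. U k x j) has_sum (S + T) x j) UNIV" for x j
    using hs[of "\<lambda>U. U x j"] by simp
  note ser = nuclear_series[OF U has_sum_imp_summable[OF n] _ this]
  show "S + T \<in> carrier Z" by (rule ser) (simp_all add: Z_outside[OF S] Z_outside[OF T] fun_eq_iff)
  have "nrm Z (S + T) \<le> (\<Sum>\<^sub>\<infinity>k. nrm Z (U k))"
    by (rule ser) (simp_all add: Z_outside[OF S] Z_outside[OF T] fun_eq_iff)
  then show "nrm Z (S + T) \<le> nrm Z S + nrm Z T" using infsumI[OF n] by simp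
next
  fix T c assume T: "T \<in> carrier Z"
  have key: "smul Z c T \<in> carrier Z \<and> nrm Z (smul Z c T) \<le> norm c * nrm Z T + e" if e: "0 < e" for e
  proof -
    have "0 < e / (norm c + 1)" using e by (simp add: add_nonneg_pos)
    then obtain a y where rep: "trep T (a :: nat \<Rightarrow> 'l \<Rightarrow> 'k) y"
      and lt: "infsum (weight a y) UNIV < nrm Z T + e / (norm c + 1)"
      by (rule nuclear_trep[OF T])
    note rep' = rep[unfolded trep_def]
    have w: "weight a (\<lambda>n. smul Y c (y n)) = (\<lambda>n. norm c * weight a y n)"
      using rep' by (auto simp: weight_def Y.nrm_smul)
    have "((\<lambda>i. pair L (a i) x * smul Y c (y i) j) has_sum smul Z c T x j) UNIV" if "x \<in> carrier X" for x j
      using has_sum_cmult_right[of "\<lambda>i. pair L (a i) x * y i j" UNIV "T x j" c] rep' that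
      by (simp add: ell_smul smul_Z mult_ac)
    moreover have "smul Z c T x = 0" if "x \<notin> carrier X" for x
      using Z_outside[OF T that] by (simp add: smul_Z Y.smul_zero_right)
    ultimately have "trep (smul Z c T) a (\<lambda>n. smul Y c (y n))"
      unfolding trep_def w using rep' by (auto intro: Y.smul_mem summable_on_cmult_right)
    note tn = trep_nuclear[OF this]
    have "nrm Z (smul Z c T) \<le> norm c * infsum (weight a y) UNIV"
      using tn(2) rep' unfolding w by (simp add: infsum_cmult_right)
    also have "\<dots> \<le> norm c * (nrm Z T + e / (norm c + 1))"
      using lt by (intro mult_left_mono) auto
    also have "\<dots> \<le> norm c * nrm Z T + e"
    proof -
      have "norm c * (e / (norm c + 1)) \<le> e"
        using e norm_ge_zero[of c] by (simp add: divide_le_eq algebra_simps not_less)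
      then show ?thesis by (simp add: distrib_left)
    qed
    finally show ?thesis using tn(1) by simp
  qed
  show "smul Z c T \<in> carrier Z" using key[of 1] by simp
  show "nrm Z (smul Z c T) \<le> norm c * nrm Z T" by (rule field_le_epsilon) (use key in auto)
qed (auto simp: smul_Z ell_smul nrm_Z_nonneg fun_eq_iff algebra_simps)

end

text \<open>Terms below \<delta> A contribute at most N \<delta> A; a larger term is at most
  \<delta>^(1-s) A (\<alpha> n / A)^s, and these quantities sum to at most \<delta>^(1-s) A. Since
  \<delta> stays free, the growth in N has arbitrarily small slope.\<close>

lemma sum_le_of_powr_sum_le:
  fixes \<alpha> :: "nat \<Rightarrow> real"
  assumes s: "1 < s" and \<delta>: "0 < \<delta>" and A: "0 \<le> A" and pos: "\<And>n. 0 \<le> \<alpha> n"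
    and le: "(\<Sum>n<N. \<alpha> n powr s) \<le> A powr s"
  shows "(\<Sum>n<N. \<alpha> n) \<le> (\<delta> powr (1 - s) + real N * \<delta>) * A"
proof (cases "A = 0")
  case True
  have "(\<Sum>n<N. \<alpha> n powr s) = 0" using le True s by (intro antisym sum_nonneg) auto
  then have "\<alpha> n = 0" if "n < N" for n using that by (simp add: sum_nonneg_eq_0_iff)
  then show ?thesis using True by simp
next
  case False
  with A have A: "0 < A" by simp
  have "\<alpha> n \<le> A * \<delta> + A * \<delta> powr (1 - s) * (\<alpha> n powr s / A powr s)" for n
  proof (cases "\<alpha> n / A \<le> \<delta>")
    case True
    then have "\<alpha> n \<le> A * \<delta>" using A by (simp add: field_simps)
    moreover have "0 \<le> A * \<delta> powr (1 - s) * (\<alpha> n powr s / A powr s)" using A by simp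
    ultimately show ?thesis by linarith
  next
    case False
    define t where "t = \<alpha> n / A"
    have t: "\<delta> < t" "0 < t" using False \<delta> by (auto simp: t_def)
    have "1 = \<delta> powr (1 - s) * \<delta> powr (s - 1)" using \<delta> by (simp flip: powr_add)
    also have "\<dots> \<le> \<delta> powr (1 - s) * t powr (s - 1)"
      using t s \<delta> by (intro mult_left_mono powr_mono2) auto
    finally have "t * 1 \<le> t * (\<delta> powr (1 - s) * t powr (s - 1))" using t by (intro mult_left_mono) auto
    also have "\<dots> = \<delta> powr (1 - s) * t powr s" using t by (simp add: powr_diff)
    finally have "A * t \<le> A * (\<delta> powr (1 - s) * t powr s)" using A by (intro mult_left_mono) auto
    moreover have "A * t = \<alpha> n" "t powr s = \<alpha> n powr s / A powr s"
      using A pos[of n] by (auto simp: t_def powr_divide)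
    moreover have "0 \<le> A * \<delta>" using A \<delta> by simp
    ultimately show ?thesis by simp
  qed
  then have "(\<Sum>n<N. \<alpha> n) \<le> (\<Sum>n<N. A * \<delta> + A * \<delta> powr (1 - s) * (\<alpha> n powr s / A powr s))"
    by (intro sum_mono)
  also have "\<dots> = real N * (A * \<delta>) + A * \<delta> powr (1 - s) * ((\<Sum>n<N. \<alpha> n powr s) / A powr s)"
    by (simp add: sum.distrib sum_distrib_left sum_divide_distrib)
  also have "\<dots> \<le> real N * (A * \<delta>) + A * \<delta> powr (1 - s) * 1"
    using A le by (intro add_left_mono mult_left_mono) auto
  finally show ?thesis by (simp add: algebra_simps)
qed

text \<open>Contractivity of the inclusion of \<open>\<ell>^s\<close> in \<open>\<ell>^t\<close>. It
  is through this lemma, with s = p and t = q, that p \<le> q enters the block estimate.\<close>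

lemma powr_sum_mono_exponent:
  fixes \<beta> :: "nat \<Rightarrow> real"
  assumes s: "0 < s" "s \<le> t" and B: "0 \<le> B" and pos: "\<And>n. 0 \<le> \<beta> n"
    and le: "(\<Sum>n<N. \<beta> n powr s) \<le> B powr s"
  shows "(\<Sum>n<N. \<beta> n powr t) \<le> B powr t"
proof -
  have "\<beta> n powr t \<le> \<beta> n powr s * B powr (t - s)" if n: "n < N" for n
  proof -
    have "\<beta> n powr s \<le> (\<Sum>n<N. \<beta> n powr s)" using n by (intro member_le_sum) auto
    then have "\<beta> n \<le> B" using le s B pos by (intro powr_le_imp_le_base[of s "\<beta> n" B]) auto
    have "\<beta> n powr t = \<beta> n powr s * \<beta> n powr (t - s)" by (simp flip: powr_add)
    also have "\<dots> \<le> \<beta> n powr s * B powr (t - s)"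
      using \<open>\<beta> n \<le> B\<close> s pos by (intro mult_left_mono powr_mono2) auto
    finally show ?thesis .
  qed
  then have "(\<Sum>n<N. \<beta> n powr t) \<le> (\<Sum>n<N. \<beta> n powr s) * B powr (t - s)"
    unfolding sum_distrib_right by (intro sum_mono) auto
  also have "\<dots> \<le> B powr s * B powr (t - s)" using le by (intro mult_right_mono) auto
  also have "\<dots> = B powr t" by (simp flip: powr_add)
  finally show ?thesis .
qed

context nuclear_ell
begin

subsection \<open>Elementary tensors\<close>

definition tens :: "('l \<Rightarrow> 'k) \<Rightarrow> ('j \<Rightarrow> 'k) \<Rightarrow> ('l \<Rightarrow> 'k) \<Rightarrow> 'j \<Rightarrow> 'k" where
  "tens a y = (\<lambda>x. if x \<in> carrier X then smul Y (pair L a x) y else 0)"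

lemma tens_mem:
  assumes a: "a \<in> carrier X'" and y: "y \<in> carrier Y"
  shows "tens a y \<in> carrier Z" and "nrm Z (tens a y) \<le> nrm X' a * nrm Y y"
proof -
  let ?a = "\<lambda>n::nat. if n = 0 then a else 0" and ?y = "\<lambda>n::nat. if n = 0 then y else 0"
  have hs: "(f has_sum f 0) UNIV" if "\<And>n. n \<noteq> 0 \<Longrightarrow> f n = 0"
    for f :: "nat \<Rightarrow> 'c::{comm_monoid_add, topological_space}"
    using that by (intro has_sum_finite_neutralI[of "{0}"]) auto
  have w: "(weight ?a ?y has_sum weight ?a ?y 0) UNIV"
    by (intro hs) (simp add: weight_def X'.nrm_zero)
  have "((\<lambda>i. pair L (?a i) x * ?y i j) has_sum pair L (?a 0) x * ?y 0 j) UNIV" for x j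
    by (rule hs) simp
  then have rep: "trep (tens a y) ?a ?y"
    unfolding trep_def using a y has_sum_imp_summable[OF w] X'.zero_mem Y.zero_mem
    by (simp add: tens_def ell_smul)
  show "tens a y \<in> carrier Z" by (rule trep_nuclear(1)[OF rep])
  show "nrm Z (tens a y) \<le> nrm X' a * nrm Y y"
    using trep_nuclear(2)[OF rep] infsumI[OF w] by (simp add: weight_def)
qed

lemma tens_add_left: "a \<in> carrier X' \<Longrightarrow> b \<in> carrier X' \<Longrightarrow> tens (a + b) y = tens a y + tens b y"
  by (auto simp: tens_def fun_eq_iff ell_smul pair_add_left distrib_right)

lemma tens_add_right: "tens a (y + z) = tens a y + tens a z"
  by (auto simp: tens_def fun_eq_iff ell_smul distrib_left)

lemma tens_smul_left: "a \<in> carrier X' \<Longrightarrow> tens (smul X' c a) y = smul Z c (tens a y)"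
  by (auto simp: tens_def fun_eq_iff pair_smul_left smul_Z) (auto simp: ell_smul)

lemma tens_smul_right: "tens a (smul Y c y) = smul Z c (tens a y)"
  by (auto simp: tens_def fun_eq_iff smul_Z ell_smul)

lemma tens_zero_left: "tens 0 y = 0"
  by (auto simp: tens_def fun_eq_iff ell_smul pair_def)

lemma tens_zero_right: "tens a 0 = 0"
  by (auto simp: tens_def fun_eq_iff ell_smul)

text \<open>Truncation of a near-optimal representation. Besides the approximation, the total weight
  of the finite sum has to stay close to \<open>nrm Z T\<close>; otherwise
  \<open>nrm_Z_dominates\<close> would lose its constant.\<close>

lemma finite_tensor_approx:
  assumes T: "T \<in> carrier Z" and e: "0 < e"
  obtains m a y where "\<And>n::nat. a n \<in> carrier X'" "\<And>n. y n \<in> carrier Y"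
    "nrm Z (T - (\<Sum>n<m. tens (a n) (y n))) \<le> e" "(\<Sum>n<m. nrm X' (a n) * nrm Y (y n)) \<le> nrm Z T + e"
proof -
  obtain a y where rep: "trep T (a :: nat \<Rightarrow> 'l \<Rightarrow> 'k) y" and lt: "infsum (weight a y) UNIV < nrm Z T + e"
    using nuclear_trep[OF T e] .
  note rep' = rep[unfolded trep_def]
  have a: "a n \<in> carrier X'" and y: "y n \<in> carrier Y" for n using rep' by auto
  have sw: "summable (weight a y)"
    using rep' by (simp add: weight_nonneg summable_on_UNIV_nonneg_real_iff)
  have "(\<lambda>m. \<Sum>n. weight a y (n + m)) \<longlonglongrightarrow> 0" by (rule suminf_exist_split2[OF sw])
  then have "\<forall>\<^sub>F m in sequentially. (\<Sum>n. weight a y (n + m)) < e" using e by (rule order_tendstoD)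
  then obtain m where m: "(\<Sum>n. weight a y (n + m)) < e" by (auto simp: eventually_sequentially)
  have sw': "summable (\<lambda>n. weight a y (n + m))" by (rule summable_ignore_initial_segment[OF sw])
  have w_shift: "weight (\<lambda>n. a (n + m)) (\<lambda>n. y (n + m)) = (\<lambda>n. weight a y (n + m))"
    by (rule ext) (simp only: weight_def)
  let ?R = "T - (\<Sum>n<m. tens (a n) (y n))"
  have "((\<lambda>n. pair L (a (n + m)) x * y (n + m) j) has_sum ?R x j) UNIV" if x: "x \<in> carrier X" for x j
  proof (rule norm_summable_imp_has_sum)
    have hs: "((\<lambda>n. pair L (a n) x * y n j) has_sum T x j) UNIV" using rep' x by auto
    have "summable (\<lambda>n. norm (pair L (a n) x * y n j))"
      using trep_summable(1)[of a y x j] rep' x by (simp add: summable_on_UNIV_nonneg_real_iff)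
    then show "summable (\<lambda>n. norm (pair L (a (n + m)) x * y (n + m) j))"
      by (rule summable_ignore_initial_segment)
    have "(\<lambda>n. pair L (a (n + m)) x * y (n + m) j) sums (T x j - (\<Sum>n<m. pair L (a n) x * y n j))"
      by (rule sums_split_initial_segment[OF has_sum_imp_sums[OF hs]])
    then show "(\<lambda>n. pair L (a (n + m)) x * y (n + m) j) sums ?R x j"
      using x by (simp add: sum_fun_apply tens_def ell_smul)
  qed
  moreover have "?R x = 0" if "x \<notin> carrier X" for x
    using that Z_outside[OF T that] by (simp add: sum_fun_apply tens_def)
  moreover have "weight (\<lambda>n. a (n + m)) (\<lambda>n. y (n + m)) summable_on UNIV"
    unfolding w_shift using sw' by (simp add: weight_nonneg summable_on_UNIV_nonneg_real_iff)
  ultimately have R: "trep ?R (\<lambda>n. a (n + m)) (\<lambda>n. y (n + m))"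
    unfolding trep_def using a y by auto
  have "nrm Z ?R \<le> infsum (weight (\<lambda>n. a (n + m)) (\<lambda>n. y (n + m))) UNIV" by (rule trep_nuclear(2)[OF R])
  also have "\<dots> = (\<Sum>n. weight a y (n + m))"
    unfolding w_shift by (intro infsum_eq_suminf_nonneg weight_nonneg sw')
  finally have 1: "nrm Z ?R \<le> e" using m by simp
  have "(\<Sum>n<m. weight a y n) \<le> (\<Sum>n. weight a y n)" by (intro sum_le_suminf sw) (auto simp: weight_nonneg)
  also have "\<dots> = infsum (weight a y) UNIV" using infsum_eq_suminf_nonneg[OF weight_nonneg sw] by simp
  finally have 2: "(\<Sum>n<m. nrm X' (a n) * nrm Y (y n)) \<le> nrm Z T + e" using lt by (simp add: weight_def)
  show ?thesis using that a y 1 2 by blast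
qed

text \<open>The constant K may be crude: it controls \<rho> on the remainder of a finite tensor sum,
  which is arbitrarily small. The finite sum itself is estimated by the tensor constant M, the one
  that survives.\<close>

lemma nrm_Z_dominates:
  assumes sub: "\<And>S T. S \<in> carrier Z \<Longrightarrow> T \<in> carrier Z \<Longrightarrow> \<rho> (S + T) \<le> \<rho> S + (\<rho> T :: real)"
    and cont: "\<And>T. T \<in> carrier Z \<Longrightarrow> \<rho> T \<le> K * nrm Z T"
    and tens: "\<And>a y. a \<in> carrier X' \<Longrightarrow> y \<in> carrier Y \<Longrightarrow> \<rho> (tens a y) \<le> M * (nrm X' a * nrm Y y)"
    and M: "0 \<le> M" and T: "T \<in> carrier Z"
  shows "\<rho> T \<le> M * nrm Z T"
proof (rule field_le_epsilon)
  fix e :: real assume e: "0 < e"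
  \<comment> \<open>An error \<open>e / K'\<close> enters with factor M through the weight of the
    finite sum and with factor \<bar>K\<bar> through the remainder; the summand 1 keeps K'
    positive.\<close>
  define K' where "K' = \<bar>K\<bar> + M + 1"
  have K': "0 < K'" using M by (simp add: K'_def add_nonneg_pos)
  obtain m a y where a: "\<And>n::nat. a n \<in> carrier X'" and y: "\<And>n. y n \<in> carrier Y"
    and 1: "nrm Z (T - (\<Sum>n<m. tens (a n) (y n))) \<le> e / K'"
    and 2: "(\<Sum>n<m. nrm X' (a n) * nrm Y (y n)) \<le> nrm Z T + e / K'"
    by (rule finite_tensor_approx[OF T divide_pos_pos[OF e K']]) blast
  let ?S = "\<lambda>m. \<Sum>n<m. tens (a n) (y n)"
  have S: "?S m \<in> carrier Z" for m by (intro Z.sum_mem tens_mem a y)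
  have "\<rho> 0 \<le> 0" using cont[OF Z.zero_mem] Z.nrm_zero by simp
  then have "\<rho> (?S m) \<le> (\<Sum>n<m. \<rho> (tens (a n) (y n)))"
    by (rule Z.sum_subadditive[of \<rho>]) (use sub tens_mem(1)[OF a y] in auto)
  also have "\<dots> \<le> (\<Sum>n<m. M * (nrm X' (a n) * nrm Y (y n)))"
    by (intro sum_mono tens a y)
  finally have \<rho>S: "\<rho> (?S m) \<le> (\<Sum>n<m. M * (nrm X' (a n) * nrm Y (y n)))" .
  have "\<rho> T = \<rho> (?S m + (T - ?S m))" by simp
  also have "\<dots> \<le> \<rho> (?S m) + \<rho> (T - ?S m)" by (intro sub S Z.diff_mem T)
  also have "\<dots> \<le> M * (nrm Z T + e / K') + \<bar>K\<bar> * (e / K')"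
  proof (intro add_mono)
    show "\<rho> (?S m) \<le> M * (nrm Z T + e / K')"
      using \<rho>S mult_left_mono[OF 2 M] by (simp add: sum_distrib_left)
    have "\<rho> (T - ?S m) \<le> K * nrm Z (T - ?S m)" by (intro cont Z.diff_mem T S)
    also have "\<dots> \<le> \<bar>K\<bar> * nrm Z (T - ?S m)"
      by (intro mult_right_mono Z.nrm_nonneg Z.diff_mem T S) simp
    also have "\<dots> \<le> \<bar>K\<bar> * (e / K')" using 1 by (intro mult_left_mono) auto
    finally show "\<rho> (T - ?S m) \<le> \<bar>K\<bar> * (e / K')" .
  qed
  also have "\<dots> = M * nrm Z T + (\<bar>K\<bar> + M) * (e / K')" by (simp add: algebra_simps)
  also have "(\<bar>K\<bar> + M) * (e / K') \<le> K' * (e / K')"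
    using e K' by (intro mult_right_mono) (auto simp: K'_def)
  finally show "\<rho> T \<le> M * nrm Z T + e" using K' by simp
qed

subsection \<open>Blocks\<close>

text \<open>P_C T Q_D for arbitrary sets, so that (I - P_C) T (I - Q_D) becomes
  \<open>blk (- C) (- D) T\<close> and both kinds of truncation share one calculus.\<close>

definition blk :: "'j set \<Rightarrow> 'l set \<Rightarrow> (('l \<Rightarrow> 'k) \<Rightarrow> 'j \<Rightarrow> 'k) \<Rightarrow> ('l \<Rightarrow> 'k) \<Rightarrow> 'j \<Rightarrow> 'k" where
  "blk C D T = (\<lambda>x. if x \<in> carrier X then res C (T (res D x)) else 0)"

lemma blk_mem:
  assumes T: "T \<in> carrier Z"
  shows "blk C D T \<in> carrier Z" and "nrm Z (blk C D T) \<le> nrm Z T"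
proof -
  have key: "blk C D T \<in> carrier Z \<and> nrm Z (blk C D T) \<le> nrm Z T + e" if e: "0 < e" for e
  proof -
    obtain a y where rep: "trep T (a :: nat \<Rightarrow> 'l \<Rightarrow> 'k) y" and lt: "infsum (weight a y) UNIV < nrm Z T + e"
      using nuclear_trep[OF T e] .
    note rep' = rep[unfolded trep_def]
    let ?a = "\<lambda>n. res D (a n)" and ?y = "\<lambda>n. res C (y n)"
    have le: "weight ?a ?y n \<le> weight a y n" for n
      unfolding weight_def using rep' by (intro mult_mono X'_res Y_res ell_nrm_nonneg exponents_le p_le) auto
    have sw: "weight ?a ?y summable_on UNIV"
      using rep' by (intro summable_on_comparison_test[OF _ le]) (auto simp: weight_nonneg)
    have "((\<lambda>i. pair L (?a i) x * ?y i j) has_sum blk C D T x j) UNIV" if x: "x \<in> carrier X" for x j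
    proof (cases "j \<in> C")
      case True
      have "((\<lambda>i. pair L (a i) (res D x) * y i j) has_sum T (res D x) j) UNIV"
        using rep' X_res(1)[OF x] by auto
      then show ?thesis using True x by (simp add: pair_res blk_def res_def[of C])
    next
      case False
      then show ?thesis using x by (simp add: blk_def res_def[of C])
    qed
    then have "trep (blk C D T) ?a ?y"
      unfolding trep_def using rep' sw by (auto simp: X'_res Y_res blk_def)
    note tn = trep_nuclear[OF this]
    have "infsum (weight ?a ?y) UNIV \<le> infsum (weight a y) UNIV"
      using rep' sw by (intro infsum_mono le) auto
    then show ?thesis using tn lt by simp
  qed
  show "blk C D T \<in> carrier Z" using key[of 1] by simp
  show "nrm Z (blk C D T) \<le> nrm Z T" by (rule field_le_epsilon) (use key in auto)
qed

lemma blk_add: "blk C D (S + T) = blk C D S + blk C D T"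
  by (auto simp: blk_def res_add fun_eq_iff)

lemma blk_diff: "blk C D (S - T) = blk C D S - blk C D T"
  by (auto simp: blk_def res_diff fun_eq_iff)

lemma blk_zero: "blk C D 0 = 0"
  by (auto simp: blk_def res_def fun_eq_iff)

lemma blk_sum: "blk C D (\<Sum>i\<in>I. T i) = (\<Sum>i\<in>I. blk C D (T i))"
  using sum_comp_morphism[of "blk C D", OF blk_zero blk_add, of T I] by (simp only: o_def)

lemma blk_smul: "blk C D (smul Z c T) = smul Z c (blk C D T)"
  by (auto simp: blk_def res_def fun_eq_iff smul_Z ell_smul)

lemma blk_blk: "blk C D (blk C' D' T) = blk (C \<inter> C') (D \<inter> D') T"
  by (auto simp: blk_def res_res X_res Int_commute)

lemma blk_empty:
  assumes "T \<in> carrier Z" "C = {} \<or> D = {}" shows "blk C D T = 0"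
proof -
  have "T 0 = 0" using Z_apply_add[OF assms(1) X.zero_mem X.zero_mem] by simp
  moreover have "res {} z = 0" for z :: "'i \<Rightarrow> 'k" by (auto simp: res_def)
  moreover have "res C 0 = (0 :: 'j \<Rightarrow> 'k)" by (auto simp: res_def)
  ultimately have "blk C D T x = 0" for x unfolding blk_def using assms(2) by metis
  then show ?thesis by (simp add: fun_eq_iff)
qed

lemma blk_UNIV: "T \<in> carrier Z \<Longrightarrow> blk UNIV UNIV T = T"
  using Z_outside by (auto simp: blk_def res_def fun_eq_iff)

lemma blk_Un_left: "C \<inter> C' = {} \<Longrightarrow> blk (C \<union> C') D T = blk C D T + blk C' D T"
  by (auto simp: blk_def res_Un fun_eq_iff)

lemma blk_Un_right:
  "D \<inter> D' = {} \<Longrightarrow> T \<in> carrier Z \<Longrightarrow> blk C (D \<union> D') T = blk C D T + blk C D' T"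
  by (auto simp: blk_def res_Un Z_apply_add X_res res_def[of C] fun_eq_iff)

lemma blk_tens: "blk C D (tens a y) = tens (res D a) (res C y)"
  by (auto simp: blk_def tens_def X_res pair_res ell_smul res_def[of C] fun_eq_iff)

lemma nrm_blk_tens_le:
  assumes "a \<in> carrier X'" "y \<in> carrier Y"
  shows "nrm Z (blk C D (tens a y)) \<le> nrm X' (res D a) * nrm Y (res C y)"
  unfolding blk_tens using assms by (intro tens_mem X'_res Y_res)

lemma blk_finite_expand:
  assumes T: "T \<in> carrier Z" and C: "finite C" "C \<subseteq> J" and D: "finite D" "D \<subseteq> L"
  shows "blk C D T = (\<Sum>j\<in>C. \<Sum>l\<in>D. smul Z (T (unit l) j) (tens (unit l) (unit j)))"
proof (intro ext)
  fix x i
  show "blk C D T x i = (\<Sum>j\<in>C. \<Sum>l\<in>D. smul Z (T (unit l) j) (tens (unit l) (unit j))) x i"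
  proof (cases "x \<in> carrier X")
    case False
    then show ?thesis by (simp add: blk_def tens_def sum_fun_apply smul_Z Y.smul_zero_right)
  next
    case x: True
    have u: "unit l \<in> carrier X" if "l \<in> D" for l
      using that D by (intro unit_mem(1)[OF exponents_le(2)]) auto
    have "T (res D x) = (\<Sum>l\<in>D. smul Y (x l) (T (unit l)))"
    proof -
      have "T 0 = 0" using Z_apply_add[OF T X.zero_mem X.zero_mem] by simp
      then have add: "T (\<Sum>l\<in>D. smul X (x l) (unit l)) = (\<Sum>l\<in>D. T (smul X (x l) (unit l)))"
        by (rule X.sum_additive[of T]) (use Z_apply_add[OF T] X.smul_mem u in auto)
      show ?thesis
        unfolding res_finite_expand[OF exponents_le(2) D(1), of x L] add
        using u by (intro sum.cong) (auto simp: Z_apply_smul[OF T])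
    qed
    then have "blk C D T x i = (if i \<in> C then \<Sum>l\<in>D. x l * T (unit l) i else 0)"
      using x by (simp add: blk_def res_def[of C] sum_fun_apply ell_smul)
    moreover have "smul Z (T (unit l) j) (tens (unit l) (unit j)) x i = (if i = j then x l * T (unit l) j else 0)"
      if "l \<in> D" for l j
    proof -
      have "pair L (unit l) x = x l" using that D pair_unit[of l L x] by (simp add: pair_commute subset_iff)
      then show ?thesis using x by (simp add: smul_Z tens_def ell_smul unit_def)
    qed
    then have "(\<Sum>j\<in>C. \<Sum>l\<in>D. smul Z (T (unit l) j) (tens (unit l) (unit j))) x i =
        (\<Sum>j\<in>C. if i = j then \<Sum>l\<in>D. x l * T (unit l) j else 0)"
      by (auto simp: sum_fun_apply intro!: sum.cong)
    ultimately show ?thesis using C by (simp add: sum.delta)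
  qed
qed

text \<open>For an elementary tensor this is smallness of the tails of its two factors, and it
  passes to finite sums and norm limits. The estimate is asked for all larger sets, since later
  constructions keep enlarging them.\<close>

lemma blk_approx:
  assumes T: "T \<in> carrier Z" and e: "0 < e"
  obtains C D where "finite C" "C \<subseteq> J" "finite D" "D \<subseteq> L"
    "\<And>C' D'. C \<subseteq> C' \<Longrightarrow> D \<subseteq> D' \<Longrightarrow> nrm Z (T - blk C' D' T) \<le> e"
proof -
  define dev where "dev T C D = nrm Z (T - blk C D T)" for T C D
  define good where "good T e \<longleftrightarrow> (\<exists>C D. finite C \<and> C \<subseteq> J \<and> finite D \<and> D \<subseteq> L \<and>
    (\<forall>C' D'. C \<subseteq> C' \<longrightarrow> D \<subseteq> D' \<longrightarrow> dev T C' D' \<le> e))" for T and e :: real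
  have goodI: "good T e" if "finite C" "C \<subseteq> J" "finite D" "D \<subseteq> L"
      "\<And>C' D'. C \<subseteq> C' \<Longrightarrow> D \<subseteq> D' \<Longrightarrow> dev T C' D' \<le> e" for T e C D
    unfolding good_def using that by blast
  have goodE: "\<exists>C D. finite C \<and> C \<subseteq> J \<and> finite D \<and> D \<subseteq> L \<and>
    (\<forall>C' D'. C \<subseteq> C' \<longrightarrow> D \<subseteq> D' \<longrightarrow> dev T C' D' \<le> e)" if "good T e" for T e
    using that unfolding good_def .
  have dev_add: "dev (S + T) C D \<le> dev S C D + dev T C D" if "S \<in> carrier Z" "T \<in> carrier Z" for S T C D
  proof -
    have "S + T - blk C D (S + T) = (S - blk C D S) + (T - blk C D T)" by (simp add: blk_add)
    then have "dev (S + T) C D = nrm Z ((S - blk C D S) + (T - blk C D T))"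
      unfolding dev_def by (rule arg_cong)
    also have "\<dots> \<le> dev S C D + dev T C D"
      unfolding dev_def by (intro Z.nrm_triangle Z.diff_mem blk_mem that)
    finally show ?thesis .
  qed
  have tens: "good (tens a y) e" if a: "a \<in> carrier X'" and y: "y \<in> carrier Y" and e: "0 < e" for a y e
  proof -
    define M where "M = nrm X' a + nrm Y y + 1"
    have M: "0 < M" "nrm X' a \<le> M" "nrm Y y \<le> M"
      using X'.nrm_nonneg[OF a] Y.nrm_nonneg[OF y] by (auto simp: M_def)
    define d where "d = e / (2 * M)"
    have d: "0 < d" using e M by (simp add: d_def)
    obtain D where D: "finite D" "D \<subseteq> L" "\<And>C. C \<inter> D = {} \<Longrightarrow> nrm X' (res C a) \<le> d"
      using ell_tail[OF exponents_le(1) a d] by blast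
    obtain C where C: "finite C" "C \<subseteq> J" "\<And>D. D \<inter> C = {} \<Longrightarrow> nrm Y (res D y) \<le> d"
      using ell_tail[OF p_le y d] by blast
    have "dev (tens a y) C' D' \<le> e" if "C \<subseteq> C'" "D \<subseteq> D'" for C' D'
    proof -
      have mem: "res D' a \<in> carrier X'" "res (- D') a \<in> carrier X'" "res C' y \<in> carrier Y" "res (- C') y \<in> carrier Y"
        using a y by (auto intro: X'_res Y_res)
      have a': "a = res D' a + res (- D') a" and y': "y = res C' y + res (- C') y"
        using res_diff_set[of a D'] res_diff_set[of y C'] by (auto simp: algebra_simps)
      have "tens a y = tens (res D' a) y + tens (res (- D') a) y"
        using tens_add_left[OF mem(1,2), of y] a' by simp
      moreover have "tens (res D' a) y = tens (res D' a) (res C' y) + tens (res D' a) (res (- C') y)"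
        using tens_add_right[of "res D' a" "res C' y" "res (- C') y"] y' by simp
      ultimately have "tens a y - blk C' D' (tens a y) = tens (res D' a) (res (- C') y) + tens (res (- D') a) y"
        unfolding blk_tens by (simp only: add_diff_cancel_left' add.assoc)
      then have "dev (tens a y) C' D' = nrm Z (tens (res D' a) (res (- C') y) + tens (res (- D') a) y)"
        unfolding dev_def by (rule arg_cong)
      also have "\<dots> \<le> nrm Z (tens (res D' a) (res (- C') y)) + nrm Z (tens (res (- D') a) y)"
        by (intro Z.nrm_triangle tens_mem mem y)
      also have "\<dots> \<le> nrm X' (res D' a) * nrm Y (res (- C') y) + nrm X' (res (- D') a) * nrm Y y"
        by (intro add_mono tens_mem mem y)
      also have "\<dots> \<le> M * d + d * M"
        using that M d C(3)[of "- C'"] D(3)[of "- D'"] X'_res(2)[OF a, of D']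
        by (intro add_mono mult_mono) (auto intro: ell_nrm_nonneg exponents_le p_le)
      also have "\<dots> = e" using M by (simp add: d_def)
      finally show ?thesis .
    qed
    with C(1,2) D(1,2) show ?thesis by (rule goodI)
  qed
  have add: "good (S + T) (d + e)" if S: "S \<in> carrier Z" "good S d" and T: "T \<in> carrier Z" "good T e" for S T d e
  proof -
    obtain C1 D1 where 1: "finite C1" "C1 \<subseteq> J" "finite D1" "D1 \<subseteq> L"
      "\<And>C' D'. C1 \<subseteq> C' \<Longrightarrow> D1 \<subseteq> D' \<Longrightarrow> dev S C' D' \<le> d" using goodE[OF S(2)] by blast
    obtain C2 D2 where 2: "finite C2" "C2 \<subseteq> J" "finite D2" "D2 \<subseteq> L"
      "\<And>C' D'. C2 \<subseteq> C' \<Longrightarrow> D2 \<subseteq> D' \<Longrightarrow> dev T C' D' \<le> e" using goodE[OF T(2)] by blast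
    show ?thesis
    proof (rule goodI[of "C1 \<union> C2" "D1 \<union> D2"])
      fix C' D' assume "C1 \<union> C2 \<subseteq> C'" "D1 \<union> D2 \<subseteq> D'"
      then show "dev (S + T) C' D' \<le> d + e"
        using dev_add[OF S(1) T(1), of C' D'] 1(5)[of C' D'] 2(5)[of C' D'] by simp
    qed (use 1 2 in auto)
  qed
  \<comment> \<open>Cutting to a block is contractive, so the error of the finite tensor sum counts
    twice; the third part is left for the finite sum itself.\<close>
  have e3: "0 < e / 3" using e by simp
  obtain m a y where a: "\<And>n::nat. a n \<in> carrier X'" and y: "\<And>n. y n \<in> carrier Y"
    and S: "nrm Z (T - (\<Sum>n<m. tens (a n) (y n))) \<le> e / 3"
    by (rule finite_tensor_approx[OF T e3]) blast
  have S_mem: "(\<Sum>n<m. tens (a n) (y n)) \<in> carrier Z" for m by (intro Z.sum_mem tens_mem a y)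
  have zero: "good 0 0"
  proof (rule goodI[of "{}" "{}"])
    show "dev 0 C' D' \<le> 0" for C' D'
      unfolding dev_def blk_zero by (simp only: diff_self Z.nrm_zero order_refl)
  qed auto
  have good_S: "good (\<Sum>n<m. tens (a n) (y n)) (real m * d)" if d: "0 < d" for d m
  proof (induction m)
    case 0
    show "good (\<Sum>n<0. tens (a n) (y n)) (real 0 * d)"
      using zero by (simp only: lessThan_0 sum.empty of_nat_0 mult_zero_left)
  next
    case (Suc m)
    have "good ((\<Sum>n<m. tens (a n) (y n)) + tens (a m) (y m)) (real m * d + d)"
      by (intro add S_mem tens_mem tens a y d Suc)
    then show "good (\<Sum>n<Suc m. tens (a n) (y n)) (real (Suc m) * d)"
      by (simp only: sum.lessThan_Suc of_nat_Suc distrib_right mult_1_left add.commute)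
  qed
  \<comment> \<open>The m tensors share e / 3; \<open>Suc m\<close> avoids a zero denominator when m
    = 0.\<close>
  have "0 < e / (3 * real (Suc m))" using e by simp
  from goodE[OF good_S[OF this, of m]]
  obtain C D where CD: "finite C" "C \<subseteq> J" "finite D" "D \<subseteq> L"
    "\<And>C' D'. C \<subseteq> C' \<Longrightarrow> D \<subseteq> D' \<Longrightarrow>
      dev (\<Sum>n<m. tens (a n) (y n)) C' D' \<le> real m * (e / (3 * real (Suc m)))"
    by blast
  have small: "real m * (e / (3 * real (Suc m))) \<le> e / 3" using e by (simp add: field_simps)
  have le: "nrm Z (T - blk C' D' T) \<le> e" if "C \<subseteq> C'" "D \<subseteq> D'" for C' D'
  proof -
    let ?S = "\<Sum>n<m. tens (a n) (y n)"
    have mem: "T - ?S \<in> carrier Z" by (intro Z.diff_mem T S_mem)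
    have "dev T C' D' \<le> dev (T - ?S) C' D' + dev ?S C' D'"
      using dev_add[OF mem S_mem, of m C' D'] by simp
    also have "dev (T - ?S) C' D' \<le> nrm Z (T - ?S) + nrm Z (blk C' D' (T - ?S))"
      unfolding dev_def by (intro Z.nrm_diff_le mem blk_mem)
    also have "nrm Z (blk C' D' (T - ?S)) \<le> nrm Z (T - ?S)" by (intro blk_mem mem)
    finally have "dev T C' D' \<le> e" using S CD(5)[OF that] small by linarith
    then show ?thesis by (simp only: dev_def)
  qed
  show ?thesis by (rule that[OF CD(1-4) le])
qed

subsection \<open>Disjoint blocks\<close>

text \<open>The sum of the block norms is a seminorm in T that is trivially at most N times
  \<open>nrm Z T\<close>; this crude bound is enough for \<open>nrm_Z_dominates\<close>, which
  leaves elementary tensors to be estimated.\<close>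

lemma sum_nrm_blk_dominated:
  assumes M: "0 \<le> M" and T: "T \<in> carrier Z"
    and tens: "\<And>a y. a \<in> carrier X' \<Longrightarrow> y \<in> carrier Y \<Longrightarrow>
      (\<Sum>n<N. nrm X' (res (D n) a) * nrm Y (res (C n) y)) \<le> M * (nrm X' a * nrm Y y)"
  shows "(\<Sum>n<(N::nat). nrm Z (blk (C n) (D n) T)) \<le> M * nrm Z T"
proof (rule nrm_Z_dominates[where \<rho> = "\<lambda>T. \<Sum>n<N. nrm Z (blk (C n) (D n) T)" and K = "real N", OF _ _ _ M T])
  show "(\<Sum>n<N. nrm Z (blk (C n) (D n) (S + T))) \<le> (\<Sum>n<N. nrm Z (blk (C n) (D n) S)) + (\<Sum>n<N. nrm Z (blk (C n) (D n) T))"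
    if "S \<in> carrier Z" "T \<in> carrier Z" for S T
    unfolding sum.distrib[symmetric] blk_add using that by (intro sum_mono Z.nrm_triangle blk_mem)
  show "(\<Sum>n<N. nrm Z (blk (C n) (D n) T)) \<le> real N * nrm Z T" if "T \<in> carrier Z" for T
    using sum_mono[of "{..<N}" "\<lambda>n. nrm Z (blk (C n) (D n) T)" "\<lambda>_. nrm Z T"] blk_mem[OF that] by simp
  show "(\<Sum>n<N. nrm Z (blk (C n) (D n) (tens a y))) \<le> M * (nrm X' a * nrm Y y)"
    if "a \<in> carrier X'" "y \<in> carrier Y" for a y
    using sum_mono[of "{..<N}", OF nrm_blk_tens_le[OF that]] tens[OF that] by (rule order_trans)
qed

text \<open>Disjointness of the D n alone lets only the factor in X' be split. Its r-sum is bounded,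
  not its sum, which costs the sublinear factor in place of 1.\<close>

lemma sum_nrm_blk_le_right:
  assumes T: "T \<in> carrier Z" and \<delta>: "0 < \<delta>"
    and D: "\<And>m n. m < n \<Longrightarrow> n < N \<Longrightarrow> D m \<inter> D n = {}"
  shows "(\<Sum>n<(N::nat). nrm Z (blk (C n) (D n) T)) \<le> (\<delta> powr (1 - r) + real N * \<delta>) * nrm Z T"
proof (rule sum_nrm_blk_dominated[OF _ T])
  show "0 \<le> \<delta> powr (1 - r) + real N * \<delta>" using \<delta> by simp
  fix a y assume a: "a \<in> carrier X'" and y: "y \<in> carrier Y"
  have "(\<Sum>n<N. nrm X' (res (D n) a)) \<le> (\<delta> powr (1 - r) + real N * \<delta>) * nrm X' a"
    using a by (intro sum_le_of_powr_sum_le r \<delta> ell_nrm_nonneg[OF exponents_le(1)]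
        ell_disjoint_le[OF exponents_le(1)] D)
  then have "(\<Sum>n<N. nrm X' (res (D n) a)) * nrm Y y \<le> (\<delta> powr (1 - r) + real N * \<delta>) * nrm X' a * nrm Y y"
    by (intro mult_right_mono Y.nrm_nonneg y)
  moreover have "(\<Sum>n<N. nrm X' (res (D n) a) * nrm Y (res (C n) y)) \<le> (\<Sum>n<N. nrm X' (res (D n) a)) * nrm Y y"
    unfolding sum_distrib_right using a y
    by (intro sum_mono mult_left_mono Y_res ell_nrm_nonneg[OF exponents_le(1)])
  ultimately show "(\<Sum>n<N. nrm X' (res (D n) a) * nrm Y (res (C n) y)) \<le>
      (\<delta> powr (1 - r) + real N * \<delta>) * (nrm X' a * nrm Y y)" by (simp add: mult.assoc)
qed

lemma sum_nrm_blk_le_left: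
  assumes T: "T \<in> carrier Z" and \<delta>: "0 < \<delta>"
    and C: "\<And>m n. m < n \<Longrightarrow> n < N \<Longrightarrow> C m \<inter> C n = {}"
  shows "(\<Sum>n<(N::nat). nrm Z (blk (C n) (D n) T)) \<le> (\<delta> powr (1 - p) + real N * \<delta>) * nrm Z T"
proof (rule sum_nrm_blk_dominated[OF _ T])
  show "0 \<le> \<delta> powr (1 - p) + real N * \<delta>" using \<delta> by simp
  fix a y assume a: "a \<in> carrier X'" and y: "y \<in> carrier Y"
  have "(\<Sum>n<N. nrm Y (res (C n) y)) \<le> (\<delta> powr (1 - p) + real N * \<delta>) * nrm Y y"
    using y by (intro sum_le_of_powr_sum_le p \<delta> ell_nrm_nonneg[OF p_le] ell_disjoint_le[OF p_le] C)
  then have "nrm X' a * (\<Sum>n<N. nrm Y (res (C n) y)) \<le> nrm X' a * ((\<delta> powr (1 - p) + real N * \<delta>) * nrm Y y)"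
    by (intro mult_left_mono X'.nrm_nonneg a)
  moreover have "(\<Sum>n<N. nrm X' (res (D n) a) * nrm Y (res (C n) y)) \<le> nrm X' a * (\<Sum>n<N. nrm Y (res (C n) y))"
    unfolding sum_distrib_left using a y
    by (intro sum_mono mult_right_mono X'_res ell_nrm_nonneg[OF p_le])
  ultimately show "(\<Sum>n<N. nrm X' (res (D n) a) * nrm Y (res (C n) y)) \<le>
      (\<delta> powr (1 - p) + real N * \<delta>) * (nrm X' a * nrm Y y)" by (simp add: mult_ac)
qed

text \<open>When both families are disjoint, Holder's inequality pairs the r-sum of the pieces of a
  with the q-sum of the pieces of y; the latter is controlled by the p-sum because p \<le>
  q.\<close>

lemma sum_nrm_blk_le:
  assumes pq: "p \<le> q" and T: "T \<in> carrier Z"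
    and C: "\<And>m n. m < n \<Longrightarrow> n < N \<Longrightarrow> C m \<inter> C n = {}"
    and D: "\<And>m n. m < n \<Longrightarrow> n < N \<Longrightarrow> D m \<inter> D n = {}"
  shows "(\<Sum>n<(N::nat). nrm Z (blk (C n) (D n) T)) \<le> nrm Z T"
proof -
  have "(\<Sum>n<N. nrm X' (res (D n) a) * nrm Y (res (C n) y)) \<le> 1 * (nrm X' a * nrm Y y)"
    if a: "a \<in> carrier X'" and y: "y \<in> carrier Y" for a y
  proof -
    let ?\<alpha> = "\<lambda>n. nrm X' (res (D n) a)" and ?\<beta> = "\<lambda>n. nrm Y (res (C n) y)"
    have pos: "0 \<le> ?\<alpha> n" "0 \<le> ?\<beta> n" for n
      by (rule ell_nrm_nonneg[OF exponents_le(1)] ell_nrm_nonneg[OF p_le])+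
    have 1: "(\<Sum>n<N. ?\<alpha> n powr r) \<le> nrm X' a powr r"
      using a by (intro ell_disjoint_le[OF exponents_le(1)] D)
    have "(\<Sum>n<N. ?\<beta> n powr p) \<le> nrm Y y powr p"
      using y by (intro ell_disjoint_le[OF p_le] C)
    then have 2: "(\<Sum>n<N. ?\<beta> n powr q) \<le> nrm Y y powr q"
      using pq p pos Y.nrm_nonneg[OF y] by (intro powr_sum_mono_exponent[of p q]) auto
    have "(\<Sum>n<N. norm (?\<alpha> n) * norm (?\<beta> n)) \<le> nrm X' a * nrm Y y"
      using 1 2 pos X'.nrm_nonneg[OF a] Y.nrm_nonneg[OF y] by (intro holder_finite) auto
    then show ?thesis using pos by simp
  qed
  then show ?thesis using sum_nrm_blk_dominated[of 1 T] T by simp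
qed

end

section \<open>The dual and the bidual\<close>

text \<open>Equal signs on both factors preserve the diagonal terms of B, while averaging over signs
  cancels the mixed ones; hence some choice does not decrease the norm. The offset c carries the
  diagonal terms already split off through the induction.\<close>

lemma exists_signs:
  fixes a :: "nat \<Rightarrow> 'u::ab_group_add" and y :: "nat \<Rightarrow> 'w::ab_group_add" and B :: "'u \<Rightarrow> 'w \<Rightarrow> 'k::real_normed_vector"
  assumes S: "0 \<in> S" "\<And>u v. u \<in> S \<Longrightarrow> v \<in> S \<Longrightarrow> u + v \<in> S" "\<And>u. u \<in> S \<Longrightarrow> - u \<in> S"
    and W: "0 \<in> W" "\<And>u v. u \<in> W \<Longrightarrow> v \<in> W \<Longrightarrow> u + v \<in> W" "\<And>u. u \<in> W \<Longrightarrow> - u \<in> W"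
    and B1: "\<And>u v w. u \<in> S \<Longrightarrow> v \<in> S \<Longrightarrow> w \<in> W \<Longrightarrow> B (u + v) w = B u w + B v w"
    and B2: "\<And>u v w. u \<in> S \<Longrightarrow> v \<in> W \<Longrightarrow> w \<in> W \<Longrightarrow> B u (v + w) = B u v + B u w"
    and mem: "\<And>n. a n \<in> S" "\<And>n. y n \<in> W"
  shows "\<exists>u w. (\<forall>n. u n = a n \<and> w n = y n \<or> u n = - a n \<and> w n = - y n) \<and>
    norm ((\<Sum>n<N. B (a n) (y n)) + c) \<le> norm (B (\<Sum>n<N. u n) (\<Sum>n<N. w n) + c)"
proof (induction N arbitrary: c)
  case 0
  have "B 0 0 = 0" using B1[of 0 0 0] S W by simp
  then show ?case by (intro exI[of _ a] exI[of _ y]) simp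
next
  case (Suc N)
  obtain u w where uw: "\<And>n. u n = a n \<and> w n = y n \<or> u n = - a n \<and> w n = - y n"
    and le: "norm ((\<Sum>n<N. B (a n) (y n)) + (c + B (a N) (y N))) \<le> norm (B (\<Sum>n<N. u n) (\<Sum>n<N. w n) + (c + B (a N) (y N)))"
    using Suc[of "c + B (a N) (y N)"] by blast
  let ?U = "\<Sum>n<N. u n" and ?W = "\<Sum>n<N. w n"
  have u: "u n \<in> S" and w: "w n \<in> W" for n using uw[of n] mem S W by metis+
  have U: "(\<Sum>n<M. u n) \<in> S" for M by (induction M) (auto intro: S u)
  have V: "(\<Sum>n<M. w n) \<in> W" for M by (induction M) (auto intro: W w)
  have B1n: "B (- v) z = - B v z" if "v \<in> S" "z \<in> W" for v z
  proof -
    have "B 0 z = 0" using B1[of 0 0 z] S that by simp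
    then show ?thesis using B1[of v "- v" z] S that by (simp add: eq_neg_iff_add_eq_0 add.commute)
  qed
  have B2n: "B v (- z) = - B v z" if "v \<in> S" "z \<in> W" for v z
  proof -
    have "B v 0 = 0" using B2[of v 0 0] W that by simp
    then show ?thesis using B2[of v z "- z"] W that by (simp add: eq_neg_iff_add_eq_0 add.commute)
  qed
  define b where "b = B ?U ?W + (c + B (a N) (y N))"
  define d where "d = B ?U (y N) + B (a N) ?W"
  have plus: "B (?U + a N) (?W + y N) + c = b + d"
    using U V mem by (simp add: B1 B2 S W b_def d_def)
  have minus: "B (?U + - a N) (?W + - y N) + c = b - d"
  proof -
    have mem': "- a N \<in> S" "- y N \<in> W" "?W + - y N \<in> W" by (intro S(3) W(2,3) mem V)+
    have "B (?U + - a N) (?W + - y N) = B ?U ?W + B ?U (- y N) + (B (- a N) ?W + B (- a N) (- y N))"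
      using B1[OF U mem'(1,3)] B2[OF U V mem'(2)] B2[OF mem'(1) V mem'(2)] by simp
    then show ?thesis
      using B1n[OF mem(1) V] B1n[OF mem(1) mem'(2)] B2n[OF U mem(2)] B2n[OF mem(1,2)] by (simp add: b_def d_def)
  qed
  \<comment> \<open>d collects the mixed terms with the last pair and changes sign with it; b is the
    midpoint of b + d and b - d, so one of them is at least as long as b.\<close>
  have "2 * norm b \<le> norm (b + d) + norm (b - d)"
    using norm_triangle_ineq[of "b + d" "b - d"] by (simp flip: scaleR_2)
  then consider "norm b \<le> norm (b + d)" | "norm b \<le> norm (b - d)" by linarith
  then show ?case
  proof cases
    case 1
    define u' w' where "u' = u(N := a N)" and "w' = w(N := y N)"
    have sums: "(\<Sum>n<Suc N. u' n) = ?U + a N" "(\<Sum>n<Suc N. w' n) = ?W + y N"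
      by (simp_all add: u'_def w'_def)
    have "norm ((\<Sum>n<Suc N. B (a n) (y n)) + c) \<le> norm (B (\<Sum>n<Suc N. u' n) (\<Sum>n<Suc N. w' n) + c)"
      unfolding sums plus using 1 le by (simp add: b_def add_ac)
    then show ?thesis using uw by (intro exI[of _ u'] exI[of _ w']) (auto simp: u'_def w'_def)
  next
    case 2
    define u' w' where "u' = u(N := - a N)" and "w' = w(N := - y N)"
    have sums: "(\<Sum>n<Suc N. u' n) = ?U + - a N" "(\<Sum>n<Suc N. w' n) = ?W + - y N"
      by (simp_all add: u'_def w'_def)
    have "norm ((\<Sum>n<Suc N. B (a n) (y n)) + c) \<le> norm (B (\<Sum>n<Suc N. u' n) (\<Sum>n<Suc N. w' n) + c)"
      unfolding sums minus using 2 le by (simp add: b_def add_ac)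
    then show ?thesis using uw by (intro exI[of _ u'] exI[of _ w']) (auto simp: u'_def w'_def)
  qed
qed

text \<open>Turns the failure of a tail condition, namely bad objects outside every finite set, into
  a sequence of bad objects with pairwise disjoint supports.\<close>

lemma disjoint_choice:
  assumes "\<And>E. finite E \<Longrightarrow> \<exists>x. P x \<and> finite (f x) \<and> f x \<inter> E = {}"
  shows "\<exists>s :: nat \<Rightarrow> 'a. (\<forall>n. P (s n) \<and> finite (f (s n))) \<and> (\<forall>m n. m < n \<longrightarrow> f (s m) \<inter> f (s n) = {})"
proof -
  have "\<exists>s. \<forall>n::nat. P (s n) \<and> finite (f (s n)) \<and> f (s n) \<inter> (\<Union>m<n. f (s m)) = {}"
  proof (rule dependent_wellorder_choice)
    fix s :: "nat \<Rightarrow> 'a" and n :: nat assume "\<And>m. m < n \<Longrightarrow> P (s m) \<and> finite (f (s m)) \<and> f (s m) \<inter> (\<Union>k<m. f (s k)) = {}"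
    then have "finite (f (s m))" if "m < n" for m using that by blast
    then have "finite (\<Union>m<n. f (s m))" by simp
    then show "\<exists>x. P x \<and> finite (f x) \<and> f x \<inter> (\<Union>m<n. f (s m)) = {}" by (rule assms)
  next
    fix x and s t :: "nat \<Rightarrow> 'a" and n :: nat assume "\<And>m. m < n \<Longrightarrow> s m = t m"
    then have "(\<Union>m<n. f (s m)) = (\<Union>m<n. f (t m))" by auto
    then show "(P x \<and> finite (f x) \<and> f x \<inter> (\<Union>m<n. f (s m)) = {}) =
        (P x \<and> finite (f x) \<and> f x \<inter> (\<Union>m<n. f (t m)) = {})" by simp
  qed
  then obtain s :: "nat \<Rightarrow> 'a" where s: "\<And>n. P (s n) \<and> finite (f (s n)) \<and> f (s n) \<inter> (\<Union>m<n. f (s m)) = {}" by blast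
  have disj: "f (s m) \<inter> f (s n) = {}" if "m < n" for m n using s[of n] that by blast
  show ?thesis using s disj by (intro exI[of _ s]) auto
qed

text \<open>With \<delta> so small that \<delta> K \<le> e / 2, the right side grows at most like a
  constant plus N e / 2.\<close>

lemma linear_growth_contradiction:
  fixes e K M :: real
  assumes e: "0 < e" and K: "0 \<le> K" and s: "1 < s"
    and le: "\<And>N \<delta>. 0 < \<delta> \<Longrightarrow> real N * e \<le> (\<delta> powr (1 - s) + real N * \<delta>) * K"
  shows False
proof -
  define \<delta> where "\<delta> = e / (2 * (K + 1))"
  have \<delta>: "0 < \<delta>" using e K by (simp add: \<delta>_def)
  have "\<delta> * K \<le> e / 2" using e K by (simp add: \<delta>_def field_simps)
  obtain N :: nat where N: "2 * (\<delta> powr (1 - s) * K) / e < real N" using reals_Archimedean2 by blast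
  then have "2 * (\<delta> powr (1 - s) * K) < real N * e" using e by (simp add: divide_less_eq)
  moreover have "real N * (\<delta> * K) \<le> real N * (e / 2)" using \<open>\<delta> * K \<le> e / 2\<close> by (intro mult_left_mono) auto
  moreover have "real N * e \<le> \<delta> powr (1 - s) * K + real N * (\<delta> * K)"
    using le[OF \<delta>, of N] by (simp add: algebra_simps)
  ultimately show False by (simp add: algebra_simps)
qed

context nuclear_ell
begin

sublocale Z': seminormed "dual Z" by (rule Z.dual_seminormed)
sublocale Z'': seminormed "dual (dual Z)" by (rule Z'.dual_seminormed)

lemma Z_apply_bound:
  assumes T: "T \<in> carrier Z" and x: "x \<in> carrier X"
  shows "nrm Y (T x) \<le> nrm X x * nrm Z T"
proof (rule field_le_epsilon)
  fix e :: real assume e: "0 < e"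
  define e' where "e' = e / (nrm X x + 1)"
  have e': "0 < e'" using e X.nrm_nonneg[OF x] by (simp add: e'_def)
  obtain a y where rep: "trep T (a :: nat \<Rightarrow> 'l \<Rightarrow> 'k) y" and lt: "infsum (weight a y) UNIV < nrm Z T + e'"
    using nuclear_trep[OF T e'] by blast
  have "summable (weight a y)"
    using rep by (simp add: trep_def weight_nonneg summable_on_UNIV_nonneg_real_iff)
  then have "nrm Y (T x) \<le> nrm X x * infsum (weight a y) UNIV"
    using trep_tail(2)[OF rep x, of 0] by (simp add: infsum_eq_suminf_nonneg weight_nonneg)
  also have "\<dots> \<le> nrm X x * (nrm Z T + e')" using lt by (intro mult_left_mono X.nrm_nonneg x) auto
  also have "nrm X x * e' \<le> e"
    using e X.nrm_nonneg[OF x] by (simp add: e'_def field_simps)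
  then have "nrm X x * (nrm Z T + e') \<le> nrm X x * nrm Z T + e" by (simp add: distrib_left)
  finally show "nrm Y (T x) \<le> nrm X x * nrm Z T + e" .
qed

text \<open>Completeness with an explicit rate: the limit is U 0 plus the series of increments,
  defined coordinatewise and placed in Z by \<open>nuclear_series\<close>. The same lemma applied to
  the increments from n on gives the distance to U n.\<close>

lemma nuclear_complete:
  assumes U: "\<And>n::nat. U n \<in> carrier Z" and c: "0 \<le> c"
    and le: "\<And>n. nrm Z (U (Suc n) - U n) \<le> c * (1/2) ^ n"
  obtains S where "S \<in> carrier Z" "\<And>n. nrm Z (S - U n) \<le> 2 * c * (1/2) ^ n"
proof -
  define D where "D n k = U (Suc (n + k)) - U (n + k)" for n k
  have D: "D n k \<in> carrier Z" for n k unfolding D_def by (intro Z.diff_mem U)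
  have geo: "((\<lambda>k. c * (1/2) ^ (n + k)) has_sum 2 * c * (1/2) ^ n) UNIV" for n
  proof (rule norm_summable_imp_has_sum)
    have "(\<lambda>k. (1/2 :: real) ^ k) sums 2" using geometric_sums[of "1/2 :: real"] by simp
    then have 1: "(\<lambda>k. c * (1/2) ^ n * (1/2) ^ k) sums (c * (1/2) ^ n * 2)" by (rule sums_mult)
    then show "(\<lambda>k. c * (1/2) ^ (n + k)) sums (2 * c * (1/2) ^ n)" by (simp add: power_add mult_ac)
    then show "summable (\<lambda>k. norm (c * (1/2) ^ (n + k)))" using c by (simp add: sums_iff)
  qed
  have D_le: "nrm Z (D n k) \<le> c * (1/2) ^ (n + k)" for n k unfolding D_def by (rule le)
  have sm: "(\<lambda>k. nrm Z (D n k)) summable_on UNIV" for n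
    using has_sum_imp_summable[OF geo[of n]] D_le by (rule summable_on_comparison_test) (auto intro: Z.nrm_nonneg D)
  have sm_le: "(\<Sum>\<^sub>\<infinity>k. nrm Z (D n k)) \<le> 2 * c * (1/2) ^ n" for n
    using infsum_mono[OF sm has_sum_imp_summable[OF geo[of n]] D_le] infsumI[OF geo[of n]] by simp
  have pt: "(\<lambda>k. norm (D n k x j)) summable_on UNIV" if x: "x \<in> carrier X" for n x j
  proof (rule Infinite_Sum.abs_summable_on_comparison_test')
    show "(\<lambda>k. nrm X x * nrm Z (D n k)) summable_on UNIV" using sm by (rule summable_on_cmult_right)
    show "norm (D n k x j) \<le> nrm X x * nrm Z (D n k)" for k
      using Y_coord[OF Z_apply_mem[OF D x], of n k j] Z_apply_bound[OF D x, of n k] by linarith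
  qed
  define R where "R n x j = (if x \<in> carrier X then \<Sum>\<^sub>\<infinity>k. D n k x j else 0)" for n x j
  have R: "((\<lambda>k. D n k x j) has_sum R n x j) UNIV" if "x \<in> carrier X" for n x j
    using abs_summable_summable[OF pt[OF that]] that by (simp add: R_def)
  have R0: "R n x = 0" if "x \<notin> carrier X" for n x using that by (simp add: R_def fun_eq_iff)
  note ser = nuclear_series[OF D sm R0 R]
  have shift: "R 0 + U 0 - U n = R n" for n
  proof (intro ext)
    fix x j
    show "(R 0 + U 0 - U n) x j = R n x j"
    proof (cases "x \<in> carrier X")
      case True
      have "(\<lambda>k. D 0 k x j) sums R 0 x j" using has_sum_imp_sums[OF R[OF True]] .
      then have "(\<lambda>k. D 0 (k + n) x j) sums (R 0 x j - (\<Sum>k<n. D 0 k x j))"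
        by (rule sums_split_initial_segment)
      moreover have "D 0 (k + n) = D n k" for k by (simp add: D_def add.commute)
      moreover have "(\<Sum>k<n. D 0 k x j) = U n x j - U 0 x j"
        using sum_lessThan_telescope[of "\<lambda>k. U k x j" n] by (simp add: D_def)
      ultimately have "(\<lambda>k. D n k x j) sums (R 0 x j - (U n x j - U 0 x j))" by simp
      moreover have "(\<lambda>k. D n k x j) sums R n x j" using has_sum_imp_sums[OF R[OF True]] .
      ultimately have "R n x j = R 0 x j - (U n x j - U 0 x j)" by (rule sums_unique2[symmetric])
      then show ?thesis by simp
    next
      case False
      then show ?thesis using Z_outside[OF U False] by (simp add: R_def)
    qed
  qed
  have "R 0 + U 0 \<in> carrier Z" by (intro Z.add_mem ser(1) U)
  moreover have "nrm Z (R 0 + U 0 - U n) \<le> 2 * c * (1/2) ^ n" for n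
    unfolding shift using ser(2)[of n] sm_le[of n] by linarith
  ultimately show ?thesis by (rule that)
qed

subsection \<open>Blocks of functionals\<close>

text \<open>The adjoint of the block projection. \<phi> sees nothing outside C and D exactly when
  \<open>pull \<phi> C D = \<phi>\<close>, and that is how supports of functionals are
  expressed.\<close>

definition pull :: "((('l \<Rightarrow> 'k) \<Rightarrow> 'j \<Rightarrow> 'k) \<Rightarrow> 'k) \<Rightarrow> 'j set \<Rightarrow> 'l set \<Rightarrow> (('l \<Rightarrow> 'k) \<Rightarrow> 'j \<Rightarrow> 'k) \<Rightarrow> 'k" where
  "pull \<phi> C D = (\<lambda>T. if T \<in> carrier Z then \<phi> (blk C D T) else 0)"

lemma pull_apply: "T \<in> carrier Z \<Longrightarrow> pull \<phi> C D T = \<phi> (blk C D T)"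
  by (simp only: pull_def if_True)

lemma pull_mem:
  assumes \<phi>: "\<phi> \<in> carrier (dual Z)"
  shows "pull \<phi> C D \<in> carrier (dual Z)"
proof (rule Z.dualI)
  fix T assume T: "T \<in> carrier Z"
  have "norm (pull \<phi> C D T) \<le> nrm (dual Z) \<phi> * nrm Z (blk C D T)"
    unfolding pull_apply[OF T] by (intro Z.dual_bound \<phi> blk_mem T)
  also have "\<dots> \<le> nrm (dual Z) \<phi> * nrm Z T" by (intro mult_left_mono blk_mem T Z.dual_nrm_nonneg \<phi>)
  finally show "norm (pull \<phi> C D T) \<le> nrm (dual Z) \<phi> * nrm Z T" .
next
  fix S T assume S: "S \<in> carrier Z" and T: "T \<in> carrier Z"
  show "pull \<phi> C D (S + T) = pull \<phi> C D S + pull \<phi> C D T"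
    by (simp only: pull_apply S T Z.add_mem blk_add Z.dual_add[OF \<phi>] blk_mem)
next
  fix c T assume T: "T \<in> carrier Z"
  show "pull \<phi> C D (smul Z c T) = c * pull \<phi> C D T"
    by (simp only: pull_apply T Z.smul_mem blk_smul Z.dual_smul[OF \<phi>] blk_mem)
qed (simp only: pull_def if_False)

lemma pull_nrm_le:
  assumes "0 \<le> e" "\<And>T. T \<in> carrier Z \<Longrightarrow> norm (\<phi> (blk C D T)) \<le> e * nrm Z T"
  shows "nrm (dual Z) (pull \<phi> C D) \<le> e"
  using assms by (intro Z.dual_nrm_le) (simp_all only: pull_apply)

lemma pull_Un_left:
  assumes \<phi>: "\<phi> \<in> carrier (dual Z)" and "C \<inter> C' = {}"
  shows "pull \<phi> (C \<union> C') D = pull \<phi> C D + pull \<phi> C' D"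
proof
  fix T
  show "pull \<phi> (C \<union> C') D T = (pull \<phi> C D + pull \<phi> C' D) T"
  proof (cases "T \<in> carrier Z")
    case True
    then show ?thesis
      by (simp only: pull_apply plus_fun_apply blk_Un_left[OF assms(2)] Z.dual_add[OF \<phi>] blk_mem)
  qed (simp add: pull_def)
qed

lemma pull_Un_right:
  assumes \<phi>: "\<phi> \<in> carrier (dual Z)" and "D \<inter> D' = {}"
  shows "pull \<phi> C (D \<union> D') = pull \<phi> C D + pull \<phi> C D'"
proof
  fix T
  show "pull \<phi> C (D \<union> D') T = (pull \<phi> C D + pull \<phi> C D') T"
  proof (cases "T \<in> carrier Z")
    case True
    then show ?thesis
      by (simp only: pull_apply plus_fun_apply blk_Un_right[OF assms(2)] Z.dual_add[OF \<phi>] blk_mem)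
  qed (simp add: pull_def)
qed

lemma pull_UNIV:
  assumes \<phi>: "\<phi> \<in> carrier (dual Z)"
  shows "pull \<phi> UNIV UNIV = \<phi>"
  using Z.dual_outside[OF \<phi>] by (auto simp: pull_def fun_eq_iff blk_UNIV)

section \<open>Tails of functionals over finitely many rows or columns\<close>

lemma functional_le_on_tensors:
  assumes \<phi>: "\<phi> \<in> carrier (dual Z)" and e: "0 \<le> e" and T: "T \<in> carrier Z"
    and le: "\<And>a y. a \<in> carrier X' \<Longrightarrow> y \<in> carrier Y \<Longrightarrow>
      norm (\<phi> (tens (res D a) (res C y))) \<le> e * (nrm X' a * nrm Y y)"
  shows "norm (\<phi> (blk C D T)) \<le> e * nrm Z T"
proof -
  note \<phi>' = pull_mem[OF \<phi>, of C D]
  have "norm (pull \<phi> C D T) \<le> e * nrm Z T"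
  \<comment> \<open>The modulus of a functional is subadditive and bounded by a multiple of the
    norm, so its exact bound may be read off from elementary tensors.\<close>
  proof (rule nrm_Z_dominates[where \<rho> = "\<lambda>T. norm (pull \<phi> C D T)", OF _ _ _ e T])
    show "norm (pull \<phi> C D (S + T)) \<le> norm (pull \<phi> C D S) + norm (pull \<phi> C D T)"
      if "S \<in> carrier Z" "T \<in> carrier Z" for S T
      unfolding Z.dual_add[OF \<phi>' that] by (rule norm_triangle_ineq)
    show "norm (pull \<phi> C D T) \<le> nrm (dual Z) (pull \<phi> C D) * nrm Z T" if "T \<in> carrier Z" for T
      by (rule Z.dual_bound[OF \<phi>' that])
    show "norm (pull \<phi> C D (tens a y)) \<le> e * (nrm X' a * nrm Y y)" if "a \<in> carrier X'" "y \<in> carrier Y" for a y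
      using le[OF that] by (simp only: pull_apply tens_mem that blk_tens)
  qed
  then show ?thesis by (simp only: pull_apply[OF T])
qed

text \<open>For fixed j the map a \<mapsto> \<phi> (a \<otimes> unit j) is a functional on X' and
  has small tails by \<open>ell_dual_tail\<close>; a finite C allows the exceptional sets to be
  united and the errors e' to be added.\<close>

lemma functional_rows_tail:
  assumes \<phi>: "\<phi> \<in> carrier (dual Z)" and C: "finite C" "C \<subseteq> J" and e: "0 < e"
  obtains D where "finite D" "D \<subseteq> L" "\<And>T. T \<in> carrier Z \<Longrightarrow> norm (\<phi> (blk C (- D) T)) \<le> e * nrm Z T"
proof -
  define e' where "e' = e / (real (card C) + 1)"
  have e': "0 < e'" using e by (simp add: e'_def add_nonneg_pos)
  define g where "g j a = (if a \<in> carrier X' then \<phi> (tens a (unit j)) else 0)" for j a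
  have u: "unit j \<in> carrier Y" "nrm Y (unit j) \<le> 1" if "j \<in> C" for j
    using that C(2) by (auto intro!: unit_mem[OF p_le])
  have g: "g j \<in> carrier (dual X')" if j: "j \<in> C" for j
  proof (rule X'.dualI)
    show "norm (g j a) \<le> nrm (dual Z) \<phi> * nrm X' a" if a: "a \<in> carrier X'" for a
    proof -
      have "norm (g j a) \<le> nrm (dual Z) \<phi> * nrm Z (tens a (unit j))"
        using Z.dual_bound[OF \<phi> tens_mem(1)[OF a u(1)[OF j]]] a by (simp add: g_def)
      also have "\<dots> \<le> nrm (dual Z) \<phi> * (nrm X' a * 1)"
        using tens_mem(2)[OF a u(1)[OF j]] mult_left_mono[OF u(2)[OF j] X'.nrm_nonneg[OF a]]
        by (intro mult_left_mono Z.dual_nrm_nonneg \<phi>) linarith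
      finally show ?thesis by simp
    qed
  next
    fix a b assume a: "a \<in> carrier X'" and b: "b \<in> carrier X'"
    have "\<phi> (tens (a + b) (unit j)) = \<phi> (tens a (unit j)) + \<phi> (tens b (unit j))"
      unfolding tens_add_left[OF a b] by (intro Z.dual_add[OF \<phi>] tens_mem a b u j)
    then show "g j (a + b) = g j a + g j b" using a b X'.add_mem[OF a b] by (simp add: g_def)
  next
    fix c a assume a: "a \<in> carrier X'"
    have "\<phi> (tens (smul X' c a) (unit j)) = c * \<phi> (tens a (unit j))"
      unfolding tens_smul_left[OF a] by (intro Z.dual_smul[OF \<phi>] tens_mem a u j)
    then show "g j (smul X' c a) = c * g j a" using a X'.smul_mem[OF a] by (simp add: g_def)
  qed (simp add: g_def)
  have "\<forall>j\<in>C. \<exists>D. finite D \<and> D \<subseteq> L \<and> (\<forall>a\<in>carrier X'. norm (g j (res (- D) a)) \<le> e' * nrm X' a)"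
    using conjugate_exponents.ell_dual_tail[OF flip g e'] by metis
  then obtain D where D: "\<And>j. j \<in> C \<Longrightarrow> finite (D j) \<and> D j \<subseteq> L \<and>
      (\<forall>a\<in>carrier X'. norm (g j (res (- D j) a)) \<le> e' * nrm X' a)"
    by metis
  define E where "E = (\<Union>j\<in>C. D j)"
  have "norm (\<phi> (blk C (- E) T)) \<le> e * nrm Z T" if T: "T \<in> carrier Z" for T
  proof (rule functional_le_on_tensors[OF \<phi> less_imp_le[OF e] T])
    fix a y assume a: "a \<in> carrier X'" and y: "y \<in> carrier Y"
    let ?a = "res (- E) a"
    have aE: "?a \<in> carrier X'" using X'_res(1)[OF a] .
    have "tens ?a (res C y) = (\<Sum>j\<in>C. tens ?a (smul Y (y j) (unit j)))"
      unfolding res_finite_expand[OF p_le C(1), of y J]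
      by (rule Y.sum_additive[of "tens ?a"]) (auto intro: tens_add_right tens_zero_right Y.smul_mem u)
    then have "\<phi> (tens ?a (res C y)) = (\<Sum>j\<in>C. \<phi> (tens ?a (smul Y (y j) (unit j))))"
      by (simp only:) (rule Z.dual_sum[OF \<phi>], intro tens_mem aE Y.smul_mem u)
    also have "\<dots> = (\<Sum>j\<in>C. y j * g j ?a)"
    proof (rule sum.cong)
      fix j assume j: "j \<in> C"
      have "\<phi> (smul Z (y j) (tens ?a (unit j))) = y j * \<phi> (tens ?a (unit j))"
        by (intro Z.dual_smul[OF \<phi>] tens_mem aE u j)
      then show "\<phi> (tens ?a (smul Y (y j) (unit j))) = y j * g j ?a"
        using aE by (simp only: tens_smul_right g_def if_True)
    qed simp
    finally have "norm (\<phi> (tens ?a (res C y))) \<le> (\<Sum>j\<in>C. norm (y j * g j ?a))"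
      by (simp only: norm_sum)
    also have "\<dots> \<le> (\<Sum>j\<in>C. nrm Y y * (e' * nrm X' a))"
    proof (rule sum_mono)
      fix j assume j: "j \<in> C"
      have "?a = res (- D j) ?a" using j by (auto simp: res_res E_def intro!: arg_cong[where f = "\<lambda>D. res D a"])
      then have "norm (g j ?a) \<le> e' * nrm X' ?a" using D[OF j] aE by metis
      also have "\<dots> \<le> e' * nrm X' a" using e' by (intro mult_left_mono X'_res a) auto
      finally show "norm (y j * g j ?a) \<le> nrm Y y * (e' * nrm X' a)"
        unfolding norm_mult by (intro mult_mono Y_coord y Y.nrm_nonneg) auto
    qed
    also have "\<dots> = (real (card C) * e') * (nrm X' a * nrm Y y)" by simp
    also have "\<dots> \<le> e * (nrm X' a * nrm Y y)"
      using e by (intro mult_right_mono mult_nonneg_nonneg X'.nrm_nonneg Y.nrm_nonneg a y)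
        (simp add: e'_def field_simps)
    finally show "norm (\<phi> (tens ?a (res C y))) \<le> e * (nrm X' a * nrm Y y)" .
  qed
  moreover have "finite E" "E \<subseteq> L" using D C(1) by (auto simp: E_def)
  ultimately show ?thesis using that by blast
qed

text \<open>The mirror image of \<open>functional_rows_tail\<close>: now y varies in Y, so the tails
  come from duality with the conjugate exponent p' of p.\<close>

lemma functional_columns_tail:
  assumes \<phi>: "\<phi> \<in> carrier (dual Z)" and D: "finite D" "D \<subseteq> L" and e: "0 < e"
  obtains C where "finite C" "C \<subseteq> J" "\<And>T. T \<in> carrier Z \<Longrightarrow> norm (\<phi> (blk (- C) D T)) \<le> e * nrm Z T"
proof -
  define p' where "p' = p / (p - 1)"
  have conj: "conjugate_exponents p' p"
    by unfold_locales (use p in \<open>auto simp: p'_def field_simps\<close>)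
  define e' where "e' = e / (real (card D) + 1)"
  have e': "0 < e'" using e by (simp add: e'_def add_nonneg_pos)
  define g where "g l y = (if y \<in> carrier Y then \<phi> (tens (unit l) y) else 0)" for l y
  have u: "unit l \<in> carrier X'" "nrm X' (unit l) \<le> 1" if "l \<in> D" for l
    using that D(2) by (auto intro!: unit_mem[OF exponents_le(1)])
  have g: "g l \<in> carrier (dual Y)" if l: "l \<in> D" for l
  proof (rule Y.dualI)
    show "norm (g l y) \<le> nrm (dual Z) \<phi> * nrm Y y" if y: "y \<in> carrier Y" for y
    proof -
      have "norm (g l y) \<le> nrm (dual Z) \<phi> * nrm Z (tens (unit l) y)"
        using Z.dual_bound[OF \<phi> tens_mem(1)[OF u(1)[OF l] y]] y by (simp add: g_def)
      also have "\<dots> \<le> nrm (dual Z) \<phi> * (1 * nrm Y y)"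
        using tens_mem(2)[OF u(1)[OF l] y] mult_right_mono[OF u(2)[OF l] Y.nrm_nonneg[OF y]]
        by (intro mult_left_mono Z.dual_nrm_nonneg \<phi>) linarith
      finally show ?thesis by simp
    qed
  next
    fix y z assume y: "y \<in> carrier Y" and z: "z \<in> carrier Y"
    have "\<phi> (tens (unit l) (y + z)) = \<phi> (tens (unit l) y) + \<phi> (tens (unit l) z)"
      unfolding tens_add_right by (intro Z.dual_add[OF \<phi>] tens_mem y z u l)
    then show "g l (y + z) = g l y + g l z" using y z Y.add_mem[OF y z] by (simp add: g_def)
  next
    fix c y assume y: "y \<in> carrier Y"
    have "\<phi> (tens (unit l) (smul Y c y)) = c * \<phi> (tens (unit l) y)"
      unfolding tens_smul_right by (intro Z.dual_smul[OF \<phi>] tens_mem y u l)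
    then show "g l (smul Y c y) = c * g l y" using y Y.smul_mem[OF y] by (simp add: g_def)
  qed (simp add: g_def)
  have "\<forall>l\<in>D. \<exists>C. finite C \<and> C \<subseteq> J \<and> (\<forall>y\<in>carrier Y. norm (g l (res (- C) y)) \<le> e' * nrm Y y)"
    using conjugate_exponents.ell_dual_tail[OF conj g e'] by metis
  then obtain C where C: "\<And>l. l \<in> D \<Longrightarrow> finite (C l) \<and> C l \<subseteq> J \<and>
      (\<forall>y\<in>carrier Y. norm (g l (res (- C l) y)) \<le> e' * nrm Y y)"
    by metis
  define E where "E = (\<Union>l\<in>D. C l)"
  have "norm (\<phi> (blk (- E) D T)) \<le> e * nrm Z T" if T: "T \<in> carrier Z" for T
  proof (rule functional_le_on_tensors[OF \<phi> less_imp_le[OF e] T])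
    fix a y assume a: "a \<in> carrier X'" and y: "y \<in> carrier Y"
    let ?y = "res (- E) y"
    have yE: "?y \<in> carrier Y" using Y_res(1)[OF y] .
    have "tens (res D a) ?y = (\<Sum>l\<in>D. tens (smul X' (a l) (unit l)) ?y)"
      unfolding res_finite_expand[OF exponents_le(1) D(1), of a L]
      by (rule X'.sum_additive[of "\<lambda>a. tens a ?y"]) (auto intro: tens_add_left tens_zero_left X'.smul_mem u)
    then have "\<phi> (tens (res D a) ?y) = (\<Sum>l\<in>D. \<phi> (tens (smul X' (a l) (unit l)) ?y))"
      by (simp only:) (rule Z.dual_sum[OF \<phi>], intro tens_mem yE X'.smul_mem u)
    also have "\<dots> = (\<Sum>l\<in>D. a l * g l ?y)"
    proof (rule sum.cong)
      fix l assume l: "l \<in> D"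
      have "\<phi> (smul Z (a l) (tens (unit l) ?y)) = a l * \<phi> (tens (unit l) ?y)"
        by (intro Z.dual_smul[OF \<phi>] tens_mem yE u l)
      then show "\<phi> (tens (smul X' (a l) (unit l)) ?y) = a l * g l ?y"
        using yE by (simp only: tens_smul_left[OF u(1)[OF l]] g_def if_True)
    qed simp
    finally have "norm (\<phi> (tens (res D a) ?y)) \<le> (\<Sum>l\<in>D. norm (a l * g l ?y))"
      by (simp only: norm_sum)
    also have "\<dots> \<le> (\<Sum>l\<in>D. nrm X' a * (e' * nrm Y y))"
    proof (rule sum_mono)
      fix l assume l: "l \<in> D"
      have "?y = res (- C l) ?y" using l by (auto simp: res_res E_def intro!: arg_cong[where f = "\<lambda>D. res D y"])
      then have "norm (g l ?y) \<le> e' * nrm Y ?y" using C[OF l] yE by metis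
      also have "\<dots> \<le> e' * nrm Y y" using e' by (intro mult_left_mono Y_res y) auto
      finally show "norm (a l * g l ?y) \<le> nrm X' a * (e' * nrm Y y)"
        unfolding norm_mult by (intro mult_mono ell_coord_le[OF exponents_le(1)] a X'.nrm_nonneg) auto
    qed
    also have "\<dots> = (real (card D) * e') * (nrm X' a * nrm Y y)" by simp
    also have "\<dots> \<le> e * (nrm X' a * nrm Y y)"
      using e by (intro mult_right_mono mult_nonneg_nonneg X'.nrm_nonneg Y.nrm_nonneg a y)
        (simp add: e'_def field_simps)
    finally show "norm (\<phi> (tens (res D a) ?y)) \<le> e * (nrm X' a * nrm Y y)" .
  qed
  moreover have "finite E" "E \<subseteq> J" using C D(1) by (auto simp: E_def)
  ultimately show ?thesis using that by blast
qed

end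

text \<open>Bookkeeping shared by functionals and operators: what lies off the corner is the full
  rows plus the full columns minus their overlap.\<close>

lemma group_rearrange:
  fixes x :: "'a::ab_group_add"
  assumes "x = A + B" "B = c + d" "E = F + c"
  shows "x - d = A + (E - F)"
  using assms by simp

lemma le_zero_of_half_powers:
  fixes x c :: real
  assumes "\<And>n::nat. x \<le> c * (1/2) ^ n"
  shows "x \<le> 0"
proof (rule LIMSEQ_le_const)
  have "(\<lambda>n. c * (1/2) ^ n) \<longlonglongrightarrow> c * 0" by (intro tendsto_mult tendsto_const LIMSEQ_power_zero) simp
  then show "(\<lambda>n. c * (1/2) ^ n) \<longlonglongrightarrow> 0" by simp
  show "\<exists>N. \<forall>n\<ge>N. x \<le> c * (1/2) ^ n" using assms by blast
qed

context nuclear_ell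
begin

subsection \<open>The matrix of an element of the bidual\<close>

definition ent :: "'j \<times> 'l \<Rightarrow> (('l \<Rightarrow> 'k) \<Rightarrow> 'j \<Rightarrow> 'k) \<Rightarrow> 'k" where
  "ent i T = (if T \<in> carrier Z then T (unit (snd i)) (fst i) else 0)"

definition etens :: "'j \<times> 'l \<Rightarrow> ('l \<Rightarrow> 'k) \<Rightarrow> 'j \<Rightarrow> 'k" where
  "etens i = tens (unit (snd i)) (unit (fst i))"

text \<open>The part over S of the matrix with entries \<open>\<psi> (ent i)\<close>, as a
  finite-rank operator for finite S. S need not be a rectangle, so that differences of rectangles
  can be cut into pieces.\<close>

definition bmat :: "(((('l \<Rightarrow> 'k) \<Rightarrow> 'j \<Rightarrow> 'k) \<Rightarrow> 'k) \<Rightarrow> 'k) \<Rightarrow> ('j \<times> 'l) set \<Rightarrow> ('l \<Rightarrow> 'k) \<Rightarrow> 'j \<Rightarrow> 'k" where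
  "bmat \<psi> S = (\<Sum>i\<in>S. smul Z (\<psi> (ent i)) (etens i))"

lemma unit_X: "l \<in> L \<Longrightarrow> unit l \<in> carrier X" "l \<in> L \<Longrightarrow> nrm X (unit l) \<le> 1"
  by (intro unit_mem exponents_le; assumption)+

lemma unit_X': "l \<in> L \<Longrightarrow> unit l \<in> carrier X'" "l \<in> L \<Longrightarrow> nrm X' (unit l) \<le> 1"
  by (intro unit_mem exponents_le; assumption)+

lemma unit_Y: "j \<in> J \<Longrightarrow> unit j \<in> carrier Y" "j \<in> J \<Longrightarrow> nrm Y (unit j) \<le> 1"
  by (intro unit_mem p_le; assumption)+

lemma etens_mem: "i \<in> J \<times> L \<Longrightarrow> etens i \<in> carrier Z"
  unfolding etens_def by (intro tens_mem unit_X' unit_Y) auto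

lemma etens_nrm:
  assumes "i \<in> J \<times> L" shows "nrm Z (etens i) \<le> 1"
proof -
  have "nrm Z (etens i) \<le> nrm X' (unit (snd i)) * nrm Y (unit (fst i))"
    unfolding etens_def using assms by (intro tens_mem unit_X' unit_Y) auto
  also have "\<dots> \<le> 1 * 1"
    using assms by (intro mult_mono unit_X' unit_Y ell_nrm_nonneg p_le) auto
  finally show ?thesis by simp
qed

lemma ent_apply: "T \<in> carrier Z \<Longrightarrow> ent i T = T (unit (snd i)) (fst i)"
  by (simp add: ent_def)

lemma ent_bound:
  assumes i: "i \<in> J \<times> L" and T: "T \<in> carrier Z"
  shows "norm (ent i T) \<le> nrm Z T"
proof -
  have u: "unit (snd i) \<in> carrier X" using i by (intro unit_X) auto
  have "norm (ent i T) \<le> nrm Y (T (unit (snd i)))"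
    unfolding ent_apply[OF T] by (intro Y_coord Z_apply_mem T u)
  also have "\<dots> \<le> nrm X (unit (snd i)) * nrm Z T" by (rule Z_apply_bound[OF T u])
  also have "\<dots> \<le> 1 * nrm Z T" using i by (intro mult_right_mono unit_X Z.nrm_nonneg T) auto
  finally show ?thesis by simp
qed

lemma ent_mem:
  assumes i: "i \<in> J \<times> L" shows "ent i \<in> carrier (dual Z)"
proof (rule Z.dualI)
  have u: "unit (snd i) \<in> carrier X" using i by (intro unit_X) auto
  show "norm (ent i T) \<le> 1 * nrm Z T" if "T \<in> carrier Z" for T using ent_bound[OF i that] by simp
  show "ent i (S + T) = ent i S + ent i T" if "S \<in> carrier Z" "T \<in> carrier Z" for S T
    using that Z.add_mem[OF that] by (simp only: ent_apply plus_fun_apply)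
  show "ent i (smul Z c T) = c * ent i T" if "T \<in> carrier Z" for c T
    using that Z.smul_mem[OF that, of c] by (simp only: ent_apply) (simp add: smul_Z ell_smul)
qed (simp add: ent_def)

lemma etens_entry:
  assumes "i \<in> J \<times> L" shows "ent i (etens i) = 1"
proof -
  have "pair L (unit (snd i)) (unit (snd i) :: 'l \<Rightarrow> 'k) = 1"
    using assms pair_unit[of "snd i" L "unit (snd i)"] by (auto simp: unit_def)
  then show ?thesis
    using ent_apply[OF etens_mem[OF assms], of i] assms unit_X[of "snd i"]
    by (auto simp: etens_def tens_def ell_smul unit_def[of "fst i"])
qed

lemma blk_etens: "blk C D (etens i) = (if i \<in> C \<times> D then etens i else 0)"
proof -
  have "res C (unit j) = (if j \<in> C then unit j else (0 :: 'j \<Rightarrow> 'k))" for C :: "'j set" and j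
    by (auto simp: res_def unit_def fun_eq_iff)
  moreover have "res D (unit l) = (if l \<in> D then unit l else (0 :: 'l \<Rightarrow> 'k))" for D :: "'l set" and l
    by (auto simp: res_def unit_def fun_eq_iff)
  ultimately show ?thesis
    unfolding etens_def blk_tens
    by (cases "fst i \<in> C"; cases "snd i \<in> D"; cases i) (simp_all only: if_True if_False tens_zero_left tens_zero_right mem_Sigma_iff fst_conv snd_conv simp_thms)
qed

context
  fixes C D assumes CD: "finite C" "C \<subseteq> J" "finite D" "D \<subseteq> L"
begin

lemma CD_sub: "i \<in> C \<times> D \<Longrightarrow> i \<in> J \<times> L"
  using CD by auto

lemma blk_expand_etens:
  assumes T: "T \<in> carrier Z"
  shows "blk C D T = (\<Sum>i\<in>C \<times> D. smul Z (ent i T) (etens i))"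
  unfolding blk_finite_expand[OF T CD] sum.cartesian_product
  using T by (intro sum.cong refl) (auto simp only: ent_apply etens_def fst_conv snd_conv split: prod.splits)

lemma functional_blk:
  assumes \<phi>: "\<phi> \<in> carrier (dual Z)" and T: "T \<in> carrier Z"
  shows "\<phi> (blk C D T) = (\<Sum>i\<in>C \<times> D. ent i T * \<phi> (etens i))"
proof -
  have "\<phi> (blk C D T) = (\<Sum>i\<in>C \<times> D. \<phi> (smul Z (ent i T) (etens i)))"
    unfolding blk_expand_etens[OF T]
    by (rule Z.dual_sum[OF \<phi>]) (rule Z.smul_mem, rule etens_mem, erule CD_sub)
  also have "\<dots> = (\<Sum>i\<in>C \<times> D. ent i T * \<phi> (etens i))"
    by (intro sum.cong refl Z.dual_smul[OF \<phi>] etens_mem CD_sub)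
  finally show ?thesis .
qed

lemma pull_expand:
  assumes \<phi>: "\<phi> \<in> carrier (dual Z)"
  shows "pull \<phi> C D = (\<Sum>i\<in>C \<times> D. smul (dual Z) (\<phi> (etens i)) (ent i))"
proof
  fix T
  show "pull \<phi> C D T = (\<Sum>i\<in>C \<times> D. smul (dual Z) (\<phi> (etens i)) (ent i)) T"
  proof (cases "T \<in> carrier Z")
    case True
    then show ?thesis
      unfolding pull_apply[OF True] functional_blk[OF \<phi> True] sum_fun_apply Z.dual_smul_eq
      by (simp add: mult.commute)
  qed (simp add: pull_def sum_fun_apply Z.dual_smul_eq ent_def)
qed

lemma bmat_mem: "bmat \<psi> (C \<times> D) \<in> carrier Z"
  unfolding bmat_def by (intro Z.sum_mem Z.smul_mem etens_mem CD_sub)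

context
  fixes \<psi> assumes \<psi>: "\<psi> \<in> carrier (dual (dual Z))"
begin

text \<open>A functional supported on a finite block is a linear combination of the entry
  functionals, on which \<psi> is known by definition of its matrix.\<close>

lemma bmat_pull:
  assumes \<phi>: "\<phi> \<in> carrier (dual Z)"
  shows "\<psi> (pull \<phi> C D) = \<phi> (bmat \<psi> (C \<times> D))"
proof -
  have "\<psi> (pull \<phi> C D) = (\<Sum>i\<in>C \<times> D. \<psi> (smul (dual Z) (\<phi> (etens i)) (ent i)))"
    unfolding pull_expand[OF \<phi>]
    by (rule Z'.dual_sum[OF \<psi>]) (rule Z'.smul_mem, rule ent_mem, erule CD_sub)
  also have "\<dots> = (\<Sum>i\<in>C \<times> D. \<phi> (etens i) * \<psi> (ent i))"
    by (intro sum.cong refl Z'.dual_smul[OF \<psi>] ent_mem CD_sub)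
  also have "\<dots> = (\<Sum>i\<in>C \<times> D. \<phi> (smul Z (\<psi> (ent i)) (etens i)))"
    by (intro sum.cong refl) (simp add: Z.dual_smul[OF \<phi>] etens_mem CD_sub)
  also have "\<dots> = \<phi> (bmat \<psi> (C \<times> D))"
    unfolding bmat_def by (rule Z.dual_sum[OF \<phi>, symmetric]) (rule Z.smul_mem, rule etens_mem, erule CD_sub)
  finally show ?thesis .
qed

text \<open>A norming functional of the finite matrix can be cut down to the same block without
  increasing its norm, and there \<psi> evaluates it. Hence the finite matrices of \<psi> are
  uniformly bounded.\<close>

lemma bmat_nrm: "nrm Z (bmat \<psi> (C \<times> D)) \<le> nrm (dual (dual Z)) \<psi>"
proof -
  obtain f where f: "f \<in> carrier (dual Z)" "nrm (dual Z) f \<le> 1"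
    "f (bmat \<psi> (C \<times> D)) = of_real (nrm Z (bmat \<psi> (C \<times> D)))"
    using Z.hahn_banach[OF bmat_mem] by blast
  have "nrm Z (bmat \<psi> (C \<times> D)) = norm (\<psi> (pull f C D))"
    using Z.nrm_nonneg[OF bmat_mem] by (simp add: bmat_pull[OF f(1)] f(3))
  also have "\<dots> \<le> nrm (dual (dual Z)) \<psi> * nrm (dual Z) (pull f C D)"
    by (intro Z'.dual_bound \<psi> pull_mem f)
  also have "nrm (dual Z) (pull f C D) \<le> 1"
  proof (rule pull_nrm_le)
    fix T assume T: "T \<in> carrier Z"
    have "norm (f (blk C D T)) \<le> nrm (dual Z) f * nrm Z (blk C D T)"
      by (intro Z.dual_bound f blk_mem T)
    also have "\<dots> \<le> 1 * nrm Z T" using f by (intro mult_mono blk_mem T Z.nrm_nonneg) auto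
    finally show "norm (f (blk C D T)) \<le> 1 * nrm Z T" .
  qed simp
  then have "nrm (dual (dual Z)) \<psi> * nrm (dual Z) (pull f C D) \<le> nrm (dual (dual Z)) \<psi>"
    using Z'.dual_nrm_nonneg[OF \<psi>] by (simp add: mult_left_le)
  finally show ?thesis .
qed

end

end

lemma bmat_Un: "finite S \<Longrightarrow> finite S' \<Longrightarrow> S \<inter> S' = {} \<Longrightarrow> bmat \<psi> (S \<union> S') = bmat \<psi> S + bmat \<psi> S'"
  unfolding bmat_def by (rule sum.union_disjoint)

lemma blk_bmat:
  assumes S: "finite S" shows "blk C D (bmat \<psi> S) = bmat \<psi> (S \<inter> C \<times> D)"
proof -
  have "smul Z c (if i \<in> C \<times> D then etens i else 0) = (if i \<in> C \<times> D then smul Z c (etens i) else 0)" for c i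
    by (cases "i \<in> C \<times> D") (simp_all only: if_True if_False Z.smul_zero_right)
  then have "blk C D (bmat \<psi> S) = (\<Sum>i\<in>S. if i \<in> C \<times> D then smul Z (\<psi> (ent i)) (etens i) else 0)"
    unfolding bmat_def blk_sum blk_smul blk_etens by (simp only:)
  then show ?thesis unfolding bmat_def by (simp only: sum.inter_restrict[OF S])
qed

section \<open>Convergence of the finite matrices of an element of the bidual\<close>

context
  fixes \<psi> assumes \<psi>: "\<psi> \<in> carrier (dual (dual Z))"
begin

text \<open>Otherwise there are arbitrarily many blocks of norm above e with disjoint D n, all
  contained in a finite matrix of norm at most that of \<psi>; this contradicts the sublinear
  estimate \<open>sum_nrm_blk_le_right\<close>.\<close>

lemma bmat_rows_tail:
  assumes e: "0 < e"
  obtains D0 where "finite D0" "D0 \<subseteq> L"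
    "\<And>C D. finite C \<Longrightarrow> C \<subseteq> J \<Longrightarrow> finite D \<Longrightarrow> D \<subseteq> L \<Longrightarrow> D \<inter> D0 = {} \<Longrightarrow> nrm Z (bmat \<psi> (C \<times> D)) \<le> e"
proof (rule ccontr)
  note intro_thesis = that
  assume neg: "\<not> thesis"
  define P where "P x \<longleftrightarrow> finite (fst x) \<and> fst x \<subseteq> J \<and> snd x \<subseteq> L \<and> e < nrm Z (bmat \<psi> (fst x \<times> snd x))" for x
  have ex: "\<exists>x. P x \<and> finite (snd x) \<and> snd x \<inter> E = {}" if E: "finite E" for E
  proof (rule ccontr)
    assume none: "\<nexists>x. P x \<and> finite (snd x) \<and> snd x \<inter> E = {}"
    have "nrm Z (bmat \<psi> (C \<times> D)) \<le> e"
      if "finite C" "C \<subseteq> J" "finite D" "D \<subseteq> L" "D \<inter> (E \<inter> L) = {}" for C D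
    proof (rule ccontr)
      assume "\<not> nrm Z (bmat \<psi> (C \<times> D)) \<le> e"
      then have "P (C, D)" "finite (snd (C, D))" "snd (C, D) \<inter> E = {}" using that by (auto simp: P_def)
      with none show False by blast
    qed
    then have thesis using E intro_thesis[of "E \<inter> L"] by simp
    with neg show False ..
  qed
  have "\<exists>s :: nat \<Rightarrow> 'j set \<times> 'l set. (\<forall>n. P (s n) \<and> finite (snd (s n))) \<and> (\<forall>m n. m < n \<longrightarrow> snd (s m) \<inter> snd (s n) = {})"
    by (rule disjoint_choice[OF ex])
  then obtain s :: "nat \<Rightarrow> 'j set \<times> 'l set" where s: "\<forall>n. P (s n) \<and> finite (snd (s n))"
    and s_disj: "\<forall>m n. m < n \<longrightarrow> snd (s m) \<inter> snd (s n) = {}"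
    by blast
  define C D where "C n = fst (s n)" and "D n = snd (s n)" for n
  have CD: "finite (C n)" "C n \<subseteq> J" "finite (D n)" "D n \<subseteq> L" "e < nrm Z (bmat \<psi> (C n \<times> D n))" for n
    using s by (auto simp: P_def C_def D_def)
  have disj: "D m \<inter> D n = {}" if "m < n" for m n using s_disj that by (simp add: D_def)
  show False
  proof (rule linear_growth_contradiction[OF e Z'.dual_nrm_nonneg[OF \<psi>] r])
    fix N :: nat and \<delta> :: real assume \<delta>: "0 < \<delta>"
    \<comment> \<open>The bound \<open>bmat_nrm\<close> concerns rectangles, so the blocks are
      embedded in one; its additional entries disappear when the blocks are cut out again.\<close>
    define U V where "U = (\<Union>n<N. C n)" and "V = (\<Union>n<N. D n)"
    have UV: "finite U" "U \<subseteq> J" "finite V" "V \<subseteq> L" unfolding U_def V_def by (simp_all add: UN_least CD)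
    have "blk (C n) (D n) (bmat \<psi> (U \<times> V)) = bmat \<psi> (C n \<times> D n)" if "n < N" for n
    proof -
      have "U \<times> V \<inter> C n \<times> D n = C n \<times> D n" using that by (auto simp: U_def V_def)
      then show ?thesis using blk_bmat[of "U \<times> V" "C n" "D n" \<psi>] UV by simp
    qed
    then have "e \<le> nrm Z (blk (C n) (D n) (bmat \<psi> (U \<times> V)))" if "n < N" for n
      using that CD(5)[of n] by simp
    then have "(\<Sum>n<N. e) \<le> (\<Sum>n<N. nrm Z (blk (C n) (D n) (bmat \<psi> (U \<times> V))))"
      by (intro sum_mono) auto
    also have "\<dots> \<le> (\<delta> powr (1 - r) + real N * \<delta>) * nrm Z (bmat \<psi> (U \<times> V))"
      by (rule sum_nrm_blk_le_right[OF bmat_mem[OF UV] \<delta>]) (rule disj)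
    also have "\<dots> \<le> (\<delta> powr (1 - r) + real N * \<delta>) * nrm (dual (dual Z)) \<psi>"
      using \<delta> by (intro mult_left_mono bmat_nrm[OF UV \<psi>]) auto
    finally show "real N * e \<le> (\<delta> powr (1 - r) + real N * \<delta>) * nrm (dual (dual Z)) \<psi>" by simp
  qed
qed

text \<open>As for \<open>bmat_rows_tail\<close>, with disjoint C n, the estimate
  \<open>sum_nrm_blk_le_left\<close> and the exponent p in place of r.\<close>

lemma bmat_columns_tail:
  assumes e: "0 < e"
  obtains C0 where "finite C0" "C0 \<subseteq> J"
    "\<And>C D. finite C \<Longrightarrow> C \<subseteq> J \<Longrightarrow> finite D \<Longrightarrow> D \<subseteq> L \<Longrightarrow> C \<inter> C0 = {} \<Longrightarrow> nrm Z (bmat \<psi> (C \<times> D)) \<le> e"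
proof (rule ccontr)
  note intro_thesis = that
  assume neg: "\<not> thesis"
  define P where "P x \<longleftrightarrow> finite (snd x) \<and> fst x \<subseteq> J \<and> snd x \<subseteq> L \<and> e < nrm Z (bmat \<psi> (fst x \<times> snd x))" for x
  have ex: "\<exists>x. P x \<and> finite (fst x) \<and> fst x \<inter> E = {}" if E: "finite E" for E
  proof (rule ccontr)
    assume none: "\<nexists>x. P x \<and> finite (fst x) \<and> fst x \<inter> E = {}"
    have "nrm Z (bmat \<psi> (C \<times> D)) \<le> e"
      if "finite C" "C \<subseteq> J" "finite D" "D \<subseteq> L" "C \<inter> (E \<inter> J) = {}" for C D
    proof (rule ccontr)
      assume "\<not> nrm Z (bmat \<psi> (C \<times> D)) \<le> e"
      then have "P (C, D)" "finite (fst (C, D))" "fst (C, D) \<inter> E = {}" using that by (auto simp: P_def)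
      with none show False by blast
    qed
    then have thesis using E intro_thesis[of "E \<inter> J"] by simp
    with neg show False ..
  qed
  have "\<exists>s :: nat \<Rightarrow> 'j set \<times> 'l set. (\<forall>n. P (s n) \<and> finite (fst (s n))) \<and> (\<forall>m n. m < n \<longrightarrow> fst (s m) \<inter> fst (s n) = {})"
    by (rule disjoint_choice[OF ex])
  then obtain s :: "nat \<Rightarrow> 'j set \<times> 'l set" where s: "\<forall>n. P (s n) \<and> finite (fst (s n))"
    and s_disj: "\<forall>m n. m < n \<longrightarrow> fst (s m) \<inter> fst (s n) = {}"
    by blast
  define C D where "C n = fst (s n)" and "D n = snd (s n)" for n
  have CD: "finite (C n)" "C n \<subseteq> J" "finite (D n)" "D n \<subseteq> L" "e < nrm Z (bmat \<psi> (C n \<times> D n))" for n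
    using s by (auto simp: P_def C_def D_def)
  have disj: "C m \<inter> C n = {}" if "m < n" for m n using s_disj that by (simp add: C_def)
  show False
  proof (rule linear_growth_contradiction[OF e Z'.dual_nrm_nonneg[OF \<psi>] p])
    fix N :: nat and \<delta> :: real assume \<delta>: "0 < \<delta>"
    define U V where "U = (\<Union>n<N. C n)" and "V = (\<Union>n<N. D n)"
    have UV: "finite U" "U \<subseteq> J" "finite V" "V \<subseteq> L" unfolding U_def V_def by (simp_all add: UN_least CD)
    have "blk (C n) (D n) (bmat \<psi> (U \<times> V)) = bmat \<psi> (C n \<times> D n)" if "n < N" for n
    proof -
      have "U \<times> V \<inter> C n \<times> D n = C n \<times> D n" using that by (auto simp: U_def V_def)
      then show ?thesis using blk_bmat[of "U \<times> V" "C n" "D n" \<psi>] UV by simp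
    qed
    then have "e \<le> nrm Z (blk (C n) (D n) (bmat \<psi> (U \<times> V)))" if "n < N" for n
      using that CD(5)[of n] by simp
    then have "(\<Sum>n<N. e) \<le> (\<Sum>n<N. nrm Z (blk (C n) (D n) (bmat \<psi> (U \<times> V))))"
      by (intro sum_mono) auto
    also have "\<dots> \<le> (\<delta> powr (1 - p) + real N * \<delta>) * nrm Z (bmat \<psi> (U \<times> V))"
      by (rule sum_nrm_blk_le_left[OF bmat_mem[OF UV] \<delta>]) (rule disj)
    also have "\<dots> \<le> (\<delta> powr (1 - p) + real N * \<delta>) * nrm (dual (dual Z)) \<psi>"
      using \<delta> by (intro mult_left_mono bmat_nrm[OF UV \<psi>]) auto
    finally show "real N * e \<le> (\<delta> powr (1 - p) + real N * \<delta>) * nrm (dual (dual Z)) \<psi>" by simp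
  qed
qed

text \<open>C' \<times> D' minus C \<times> D splits into C \<times> (D' - D) and (C' - C) \<times>
  D', and each piece avoids one of the two exceptional sets.\<close>

lemma bmat_cauchy:
  assumes e: "0 < e"
  shows "\<exists>C D. finite C \<and> C \<subseteq> J \<and> finite D \<and> D \<subseteq> L \<and> (\<forall>C' D'. finite C' \<longrightarrow> C' \<subseteq> J \<longrightarrow> finite D' \<longrightarrow> D' \<subseteq> L \<longrightarrow>
     C \<subseteq> C' \<longrightarrow> D \<subseteq> D' \<longrightarrow> nrm Z (bmat \<psi> (C' \<times> D') - bmat \<psi> (C \<times> D)) \<le> e)"
proof -
  have e2: "0 < e / 2" using e by simp
  obtain D where D: "finite D" "D \<subseteq> L"
    "\<And>C' D'. finite C' \<Longrightarrow> C' \<subseteq> J \<Longrightarrow> finite D' \<Longrightarrow> D' \<subseteq> L \<Longrightarrow> D' \<inter> D = {} \<Longrightarrow> nrm Z (bmat \<psi> (C' \<times> D')) \<le> e / 2"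
    by (rule bmat_rows_tail[OF e2]) blast
  obtain C where C: "finite C" "C \<subseteq> J"
    "\<And>C' D'. finite C' \<Longrightarrow> C' \<subseteq> J \<Longrightarrow> finite D' \<Longrightarrow> D' \<subseteq> L \<Longrightarrow> C' \<inter> C = {} \<Longrightarrow> nrm Z (bmat \<psi> (C' \<times> D')) \<le> e / 2"
    by (rule bmat_columns_tail[OF e2]) blast
  have le: "nrm Z (bmat \<psi> (C' \<times> D') - bmat \<psi> (C \<times> D)) \<le> e"
    if C': "finite C'" "C' \<subseteq> J" "C \<subseteq> C'" and D': "finite D'" "D' \<subseteq> L" "D \<subseteq> D'" for C' D'
  proof -
    have 1: "C' \<times> D' = C \<times> D \<union> (C \<times> (D' - D) \<union> (C' - C) \<times> D')" using C' D' by auto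
    have "bmat \<psi> (C' \<times> D') = bmat \<psi> (C \<times> D) + (bmat \<psi> (C \<times> (D' - D)) + bmat \<psi> ((C' - C) \<times> D'))"
      unfolding 1 by (subst bmat_Un; (subst bmat_Un)?) (use C C' D D' in auto)
    then have "bmat \<psi> (C' \<times> D') - bmat \<psi> (C \<times> D) = bmat \<psi> (C \<times> (D' - D)) + bmat \<psi> ((C' - C) \<times> D')"
      by (simp only: add_diff_cancel_left')
    then have "nrm Z (bmat \<psi> (C' \<times> D') - bmat \<psi> (C \<times> D)) =
        nrm Z (bmat \<psi> (C \<times> (D' - D)) + bmat \<psi> ((C' - C) \<times> D'))" by (rule arg_cong)
    also have "\<dots> \<le> nrm Z (bmat \<psi> (C \<times> (D' - D))) + nrm Z (bmat \<psi> ((C' - C) \<times> D'))"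
      by (intro Z.nrm_triangle bmat_mem) (use C C' D D' in auto)
    also have "\<dots> \<le> e / 2 + e / 2"
      by (intro add_mono D(3) C(3)) (use C(1,2) C' D(1,2) D' in auto)
    finally show ?thesis by simp
  qed
  show ?thesis
    by (rule exI[of _ C], rule exI[of _ D], intro conjI C(1,2) D(1,2) allI impI le)
qed

text \<open>The finite matrices form a Cauchy net over pairs of finite sets. A sequence of pairs
  suffices to construct the limit S, even for uncountable J and L, because the Cauchy bounds hold
  for all larger finite sets.\<close>

lemma matrix_of_bidual:
  obtains S where "S \<in> carrier Z"
    "\<And>\<phi> C D. \<phi> \<in> carrier (dual Z) \<Longrightarrow> finite C \<Longrightarrow> C \<subseteq> J \<Longrightarrow> finite D \<Longrightarrow> D \<subseteq> L \<Longrightarrow>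
      \<psi> (pull \<phi> C D) = \<phi> (blk C D S)"
proof -
  have "\<forall>n::nat. \<exists>C D. finite C \<and> C \<subseteq> J \<and> finite D \<and> D \<subseteq> L \<and> (\<forall>C' D'. finite C' \<longrightarrow> C' \<subseteq> J \<longrightarrow> finite D' \<longrightarrow>
     D' \<subseteq> L \<longrightarrow> C \<subseteq> C' \<longrightarrow> D \<subseteq> D' \<longrightarrow> nrm Z (bmat \<psi> (C' \<times> D') - bmat \<psi> (C \<times> D)) \<le> (1/2) ^ n)"
    by (intro allI bmat_cauchy) simp
  then obtain c d where cd: "\<And>n::nat. finite (c n) \<and> c n \<subseteq> J \<and> finite (d n) \<and> d n \<subseteq> L"
    and close: "\<And>n C' D'. finite C' \<Longrightarrow> C' \<subseteq> J \<Longrightarrow> finite D' \<Longrightarrow> D' \<subseteq> L \<Longrightarrow> c n \<subseteq> C' \<Longrightarrow> d n \<subseteq> D' \<Longrightarrow>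
       nrm Z (bmat \<psi> (C' \<times> D') - bmat \<psi> (c n \<times> d n)) \<le> (1/2) ^ n"
    by metis
  \<comment> \<open>The sets from the Cauchy condition need not increase; their partial unions
    do.\<close>
  define C D where "C n = (\<Union>k\<le>n. c k)" and "D n = (\<Union>k\<le>n. d k)" for n
  have CD: "finite (C n)" "C n \<subseteq> J" "finite (D n)" "D n \<subseteq> L" "c n \<subseteq> C n" "d n \<subseteq> D n" for n
    using cd by (auto simp: C_def D_def)
  have mono: "C n \<subseteq> C (Suc n)" "D n \<subseteq> D (Suc n)" for n by (auto simp: C_def D_def atMost_Suc)
  define U where "U n = bmat \<psi> (C n \<times> D n)" for n
  have U: "U n \<in> carrier Z" for n unfolding U_def by (intro bmat_mem CD)
  \<comment> \<open>Both matrices lie within (1/2)^n of the one over c n and d n, hence the factor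
    2.\<close>
  have close': "nrm Z (bmat \<psi> (C' \<times> D') - U n) \<le> 2 * (1/2) ^ n"
    if "finite C'" "C' \<subseteq> J" "finite D'" "D' \<subseteq> L" "C n \<subseteq> C'" "D n \<subseteq> D'" for C' D' n
  proof -
    let ?m = "bmat \<psi> (c n \<times> d n)"
    have mem: "bmat \<psi> (C' \<times> D') \<in> carrier Z" "?m \<in> carrier Z"
      using that cd[of n] by (auto intro!: bmat_mem)
    have "bmat \<psi> (C' \<times> D') - U n = (bmat \<psi> (C' \<times> D') - ?m) - (U n - ?m)" by simp
    then have "nrm Z (bmat \<psi> (C' \<times> D') - U n) = nrm Z ((bmat \<psi> (C' \<times> D') - ?m) - (U n - ?m))" by (rule arg_cong)
    also have "\<dots> \<le> nrm Z (bmat \<psi> (C' \<times> D') - ?m) + nrm Z (U n - ?m)"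
      by (intro Z.nrm_diff_le Z.diff_mem mem U)
    also have "\<dots> \<le> (1/2) ^ n + (1/2) ^ n"
      unfolding U_def using that CD[of n] by (intro add_mono close) auto
    finally show ?thesis by simp
  qed
  have "nrm Z (U (Suc n) - U n) \<le> 2 * (1/2) ^ n" for n
    unfolding U_def[of "Suc n"] by (intro close' CD mono)
  then obtain S where S: "S \<in> carrier Z" "\<And>n. nrm Z (S - U n) \<le> 2 * 2 * (1/2) ^ n"
    by (rule nuclear_complete[OF U, of 2, rotated]) auto
  have "\<psi> (pull \<phi> A B) = \<phi> (blk A B S)"
    if \<phi>: "\<phi> \<in> carrier (dual Z)" and A: "finite A" "A \<subseteq> J" and B: "finite B" "B \<subseteq> L" for \<phi> A B
  proof -
    have m: "bmat \<psi> (A \<times> B) \<in> carrier Z" by (intro bmat_mem A B)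
    have "nrm Z (blk A B S - bmat \<psi> (A \<times> B)) \<le> 6 * (1/2) ^ n" for n
    proof -
      \<comment> \<open>Large enough to contain the block over A and B and to be close to S at the
        same time: 4 (1/2)^n for S against U n plus 2 (1/2)^n for ?M against U n.\<close>
      let ?M = "bmat \<psi> ((A \<union> C n) \<times> (B \<union> D n))"
      have M: "?M \<in> carrier Z" using A B CD by (intro bmat_mem) auto
      have "(A \<union> C n) \<times> (B \<union> D n) \<inter> A \<times> B = A \<times> B" by auto
      then have "bmat \<psi> (A \<times> B) = blk A B ?M"
        using blk_bmat[of "(A \<union> C n) \<times> (B \<union> D n)" A B \<psi>] A B CD by simp
      then have "blk A B S - bmat \<psi> (A \<times> B) = blk A B (S - ?M)" by (simp only: blk_diff)
      then have "nrm Z (blk A B S - bmat \<psi> (A \<times> B)) = nrm Z (blk A B (S - ?M))" by (rule arg_cong)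
      also have "\<dots> \<le> nrm Z (S - ?M)" by (intro blk_mem Z.diff_mem S M)
      also have "\<dots> = nrm Z ((S - U n) - (?M - U n))" by (rule arg_cong[where f = "nrm Z"]) simp
      also have "\<dots> \<le> nrm Z (S - U n) + nrm Z (?M - U n)" by (intro Z.nrm_diff_le Z.diff_mem S M U)
      also have "\<dots> \<le> 2 * 2 * (1/2) ^ n + 2 * (1/2) ^ n"
        using A B CD by (intro add_mono S(2) close') auto
      finally show ?thesis by simp
    qed
    then have "nrm Z (blk A B S - bmat \<psi> (A \<times> B)) \<le> 0" by (rule le_zero_of_half_powers)
    then have "nrm Z (blk A B S - bmat \<psi> (A \<times> B)) = 0"
      using Z.nrm_nonneg[OF Z.diff_mem[OF blk_mem(1)[OF S(1)] m]] by (rule antisym)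
    then have "norm (\<phi> (blk A B S - bmat \<psi> (A \<times> B))) \<le> 0"
      using Z.dual_bound[OF \<phi> Z.diff_mem[OF blk_mem(1)[OF S(1)] m], of A B] by simp
    then have "\<phi> (blk A B S) = \<phi> (bmat \<psi> (A \<times> B))"
      using Z.dual_diff[OF \<phi> blk_mem(1)[OF S(1)] m, of A B] by simp
    then show ?thesis using bmat_pull[OF A B \<psi> \<phi>] by simp
  qed
  then show ?thesis using S(1) that by blast
qed

text \<open>\<psi> and S agree on functionals with finite block. The rows over C and the columns
  over D of any \<phi> are norm limits of such functionals, by the tail lemmas; no such
  approximation is claimed for the corner.\<close>

lemma bidual_off_corner:
  assumes S: "S \<in> carrier Z"
    and fin: "\<And>\<phi> C D. \<phi> \<in> carrier (dual Z) \<Longrightarrow> finite C \<Longrightarrow> C \<subseteq> J \<Longrightarrow> finite D \<Longrightarrow> D \<subseteq> L \<Longrightarrow>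
      \<psi> (pull \<phi> C D) = \<phi> (blk C D S)"
    and \<phi>: "\<phi> \<in> carrier (dual Z)" and C: "finite C" "C \<subseteq> J" and D: "finite D" "D \<subseteq> L"
  shows "\<psi> (\<phi> - pull \<phi> (- C) (- D)) = \<phi> (S - blk (- C) (- D) S)"
proof -
  \<comment> \<open>A functional of norm e / K costs at most (e / K) times the norm of \<psi> and
    the norm of S; the 1 ensures positivity.\<close>
  define K where "K = nrm (dual (dual Z)) \<psi> + nrm Z S + 1"
  have K: "0 < K" using Z'.dual_nrm_nonneg[OF \<psi>] Z.nrm_nonneg[OF S] by (simp add: K_def)
  have small: "norm (\<psi> (pull \<phi> A B) - \<phi> (blk A B S)) \<le> e"
    if e: "0 < e" and le: "\<And>T. T \<in> carrier Z \<Longrightarrow> norm (\<phi> (blk A B T)) \<le> e / K * nrm Z T" for A B e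
  proof -
    have "norm (\<psi> (pull \<phi> A B)) \<le> nrm (dual (dual Z)) \<psi> * nrm (dual Z) (pull \<phi> A B)"
      by (intro Z'.dual_bound \<psi> pull_mem \<phi>)
    also have "\<dots> \<le> nrm (dual (dual Z)) \<psi> * (e / K)"
      using e K by (intro mult_left_mono pull_nrm_le le Z'.dual_nrm_nonneg \<psi>) auto
    finally have "norm (\<psi> (pull \<phi> A B) - \<phi> (blk A B S)) \<le> nrm (dual (dual Z)) \<psi> * (e / K) + e / K * nrm Z S"
      using le[OF S] norm_triangle_ineq4[of "\<psi> (pull \<phi> A B)" "\<phi> (blk A B S)"] by linarith
    also have "\<dots> = (nrm (dual (dual Z)) \<psi> + nrm Z S) * (e / K)" by (simp add: algebra_simps)
    also have "\<dots> \<le> K * (e / K)" using e K by (intro mult_right_mono) (auto simp: K_def)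
    finally show ?thesis using K by simp
  qed
  have rows: "\<psi> (pull \<phi> C UNIV) = \<phi> (blk C UNIV S)"
  proof -
    have "norm (\<psi> (pull \<phi> C UNIV) - \<phi> (blk C UNIV S)) \<le> 0 + e" if e: "0 < e" for e
    proof -
      obtain E where E: "finite E" "E \<subseteq> L" "\<And>T. T \<in> carrier Z \<Longrightarrow> norm (\<phi> (blk C (- E) T)) \<le> e / K * nrm Z T"
        using functional_rows_tail[OF \<phi> C divide_pos_pos[OF e K]] by blast
      have 1: "pull \<phi> C UNIV = pull \<phi> C E + pull \<phi> C (- E)"
        using pull_Un_right[OF \<phi>, of E "- E" C] by (simp only: Compl_partition Compl_disjoint simp_thms)
      have 2: "blk C UNIV S = blk C E S + blk C (- E) S"
        using blk_Un_right[of E "- E" S C] S by (simp only: Compl_partition Compl_disjoint simp_thms)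
      have "\<psi> (pull \<phi> C UNIV) - \<phi> (blk C UNIV S) = \<psi> (pull \<phi> C (- E)) - \<phi> (blk C (- E) S)"
        unfolding 1 2 Z'.dual_add[OF \<psi> pull_mem[OF \<phi>] pull_mem[OF \<phi>]] Z.dual_add[OF \<phi> blk_mem(1)[OF S] blk_mem(1)[OF S]]
        using fin[OF \<phi> C E(1,2)] by simp
      then show ?thesis using small[OF e E(3)] by simp
    qed
    then have "norm (\<psi> (pull \<phi> C UNIV) - \<phi> (blk C UNIV S)) \<le> 0" by (rule field_le_epsilon)
    then show ?thesis by simp
  qed
  have columns: "\<psi> (pull \<phi> UNIV D) = \<phi> (blk UNIV D S)"
  proof -
    have "norm (\<psi> (pull \<phi> UNIV D) - \<phi> (blk UNIV D S)) \<le> 0 + e" if e: "0 < e" for e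
    proof -
      obtain E where E: "finite E" "E \<subseteq> J" "\<And>T. T \<in> carrier Z \<Longrightarrow> norm (\<phi> (blk (- E) D T)) \<le> e / K * nrm Z T"
        using functional_columns_tail[OF \<phi> D divide_pos_pos[OF e K]] by blast
      have 1: "pull \<phi> UNIV D = pull \<phi> E D + pull \<phi> (- E) D"
        using pull_Un_left[OF \<phi>, of E "- E" D] by (simp only: Compl_partition Compl_disjoint simp_thms)
      have 2: "blk UNIV D S = blk E D S + blk (- E) D S"
        using blk_Un_left[of E "- E" D S] by (simp only: Compl_partition Compl_disjoint simp_thms)
      have "\<psi> (pull \<phi> UNIV D) - \<phi> (blk UNIV D S) = \<psi> (pull \<phi> (- E) D) - \<phi> (blk (- E) D S)"
        unfolding 1 2 Z'.dual_add[OF \<psi> pull_mem[OF \<phi>] pull_mem[OF \<phi>]] Z.dual_add[OF \<phi> blk_mem(1)[OF S] blk_mem(1)[OF S]]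
        using fin[OF \<phi> E(1,2) D] by simp
      then show ?thesis using small[OF e E(3)] by simp
    qed
    then have "norm (\<psi> (pull \<phi> UNIV D) - \<phi> (blk UNIV D S)) \<le> 0" by (rule field_le_epsilon)
    then show ?thesis by simp
  qed
  have pull_split: "\<phi> - pull \<phi> (- C) (- D) = pull \<phi> C UNIV + (pull \<phi> UNIV D - pull \<phi> C D)"
  proof -
    have "\<phi> = pull \<phi> C UNIV + pull \<phi> (- C) UNIV"
      using pull_Un_left[OF \<phi>, of C "- C" UNIV] pull_UNIV[OF \<phi>] by (simp only: Compl_partition Compl_disjoint simp_thms)
    moreover have "pull \<phi> (- C) UNIV = pull \<phi> (- C) D + pull \<phi> (- C) (- D)"
      using pull_Un_right[OF \<phi>, of D "- D" "- C"] by (simp only: Compl_partition Compl_disjoint simp_thms)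
    moreover have "pull \<phi> UNIV D = pull \<phi> C D + pull \<phi> (- C) D"
      using pull_Un_left[OF \<phi>, of C "- C" D] by (simp only: Compl_partition Compl_disjoint simp_thms)
    ultimately show ?thesis by (rule group_rearrange)
  qed
  have blk_split: "S - blk (- C) (- D) S = blk C UNIV S + (blk UNIV D S - blk C D S)"
  proof -
    have "S = blk C UNIV S + blk (- C) UNIV S"
      using blk_Un_left[of C "- C" UNIV S] blk_UNIV[OF S] by (simp only: Compl_partition Compl_disjoint simp_thms)
    moreover have "blk (- C) UNIV S = blk (- C) D S + blk (- C) (- D) S"
      using blk_Un_right[of D "- D" S "- C"] S by (simp only: Compl_partition Compl_disjoint simp_thms)
    moreover have "blk UNIV D S = blk C D S + blk (- C) D S"
      using blk_Un_left[of C "- C" D S] by (simp only: Compl_partition Compl_disjoint simp_thms)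
    ultimately show ?thesis by (rule group_rearrange)
  qed
  show ?thesis
    unfolding pull_split blk_split
      Z'.dual_add[OF \<psi> pull_mem[OF \<phi>] Z'.diff_mem[OF pull_mem[OF \<phi>] pull_mem[OF \<phi>]]]
      Z'.dual_diff[OF \<psi> pull_mem[OF \<phi>] pull_mem[OF \<phi>]]
      Z.dual_add[OF \<phi> blk_mem(1)[OF S] Z.diff_mem[OF blk_mem(1)[OF S] blk_mem(1)[OF S]]]
      Z.dual_diff[OF \<phi> blk_mem(1)[OF S] blk_mem(1)[OF S]]
      rows columns fin[OF \<phi> C D] ..
qed

end

end

lemma diff_eq_swap:
  fixes a :: "'a::ab_group_add"
  assumes "a - b = c - d"
  shows "a - c = b - d"
proof -
  have "a - c = (a - b) - (c - b)" by simp
  then show ?thesis using assms by simp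
qed

text \<open>N is taken so large that N^(1 - s) exceeds K / e.\<close>

lemma sublinear_growth_contradiction:
  fixes e K s :: real
  assumes e: "0 < e" and s: "s < 1" and le: "\<And>N::nat. 0 < N \<Longrightarrow> real N * e \<le> K * real N powr s"
  shows False
proof -
  have K: "0 < K" using le[of 1] e by simp
  obtain N :: nat where N: "(K / e) powr (1 / (1 - s)) < real N" using reals_Archimedean2 by blast
  then have N0: "0 < real N" using powr_ge_zero[of "K / e" "1 / (1 - s)"] by linarith
  have "K / e = ((K / e) powr (1 / (1 - s))) powr (1 - s)" using s K e by (simp add: powr_powr)
  also have "\<dots> < real N powr (1 - s)" using N s by (intro powr_less_mono2) auto
  also have "\<dots> = real N / real N powr s" using N0 by (simp add: powr_diff)
  finally have "K * real N powr s < real N * e" using e N0 by (simp add: field_simps)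
  then show False using le[of N] N0 by simp
qed

lemma ell_disjoint_sum_le:
  fixes u :: "nat \<Rightarrow> 'j \<Rightarrow> 'k::rc_scalar"
  assumes p: "1 \<le> p" and u: "\<And>n. u n \<in> carrier (ell p J)" "\<And>n. nrm (ell p J) (u n) \<le> 1"
    and G: "\<And>n. res (G n) (u n) = u n" "\<And>m n. m < n \<Longrightarrow> G m \<inter> G n = {}"
  shows "nrm (ell p J) (\<Sum>n<N. u n) \<le> real N powr (1 / p)"
proof -
  let ?s = "\<Sum>n<N. u n"
  have zero: "u m j = 0" if "j \<notin> G m" for m j
    using G(1)[of m] that by (auto simp: res_def dest: fun_cong[where x = j])
  have uniq: "m = n" if "j \<in> G m" "j \<in> G n" for m n j
    using G(2)[of m n] G(2)[of n m] that by (metis disjoint_iff linorder_neqE_nat)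
  have s: "?s \<in> carrier (ell p J)" by (intro seminormed.sum_mem ell_seminormed p u)
  have res_s: "res (G n) ?s = u n" if n: "n < N" for n
  proof
    fix j
    show "res (G n) ?s j = u n j"
    proof (cases "j \<in> G n")
      case True
      have "u m j = 0" if "m \<noteq> n" for m using zero uniq[OF _ True] that by blast
      then have "(\<Sum>m<N. u m j) = (\<Sum>m\<in>{n}. u m j)"
        using n by (intro sum.mono_neutral_right) auto
      then show ?thesis using True by (simp add: res_def sum_fun_apply)
    qed (simp add: res_def zero)
  qed
  have "res (\<Union>n<N. G n) ?s = ?s"
  proof
    fix j
    show "res (\<Union>n<N. G n) ?s j = ?s j"
    proof (cases "j \<in> (\<Union>n<N. G n)")
      case False
      then have "(\<Sum>n<N. u n j) = 0" using zero by (intro sum.neutral) auto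
      then show ?thesis using False by (simp add: res_def sum_fun_apply)
    qed (simp add: res_def)
  qed
  then have "nrm (ell p J) ?s powr p = (\<Sum>n<N. nrm (ell p J) (res (G n) ?s) powr p)"
    using ell_disjoint_sum[OF p s, of N G] G(2) by simp
  also have "\<dots> \<le> (\<Sum>n<N. 1)"
  proof (rule sum_mono)
    fix n assume "n \<in> {..<N}"
    then have "nrm (ell p J) (res (G n) ?s) powr p \<le> 1 powr p"
      using u p by (intro powr_mono2) (auto simp: res_s ell_nrm_nonneg)
    then show "nrm (ell p J) (res (G n) ?s) powr p \<le> 1" by simp
  qed
  finally have "nrm (ell p J) ?s powr p \<le> (real N powr (1 / p)) powr p" using p by (simp add: powr_powr)
  then show ?thesis using p by (rule_tac powr_le_imp_le_base[of p]) (auto simp: ell_nrm_nonneg)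
qed

context nuclear_ell
begin

section \<open>Reflexivity for \<open>q < p\<close>\<close>

text \<open>Otherwise there are disjointly supported unit vectors \<open>a\<^sub>n\<close>, \<open>y\<^sub>n\<close> with
  \<open>\<phi> (a\<^sub>n \<otimes> y\<^sub>n) > e\<close>; for suitable signs, \<open>N e\<close> is at most
  \<open>\<phi> ((\<Sum> \<plusminus>a\<^sub>n) \<otimes> (\<Sum> \<plusminus>y\<^sub>n))\<close>, which is of order \<open>N powr (1 / r + 1 / p)\<close> with exponent below 1.\<close>

lemma functional_corner_tail:
  assumes qp: "q < p" and \<phi>: "\<phi> \<in> carrier (dual Z)" and e: "0 < e"
  shows "\<exists>C D. finite C \<and> C \<subseteq> J \<and> finite D \<and> D \<subseteq> L \<and>
    (\<forall>T\<in>carrier Z. norm (\<phi> (blk (- C) (- D) T)) \<le> e * nrm Z T)"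
proof (rule ccontr)
  assume neg: "\<not> ?thesis"
  define P :: "'j set \<times> 'l set \<times> ('l \<Rightarrow> 'k) \<times> ('j \<Rightarrow> 'k) \<Rightarrow> bool" where
    "P = (\<lambda>(F, G, a, y). a \<in> carrier X' \<and> y \<in> carrier Y \<and> nrm X' a \<le> 1 \<and> nrm Y y \<le> 1 \<and>
      res G a = a \<and> res F y = y \<and> (\<exists>t>e. \<phi> (tens a y) = of_real t))"
  \<comment> \<open>Rows and columns are put into one disjoint sum, so that
    \<open>disjoint_choice\<close> makes both families of supports disjoint at once.\<close>
  define f :: "'j set \<times> 'l set \<times> ('l \<Rightarrow> 'k) \<times> ('j \<Rightarrow> 'k) \<Rightarrow> ('j + 'l) set" where
    "f = (\<lambda>(F, G, a, y). Inl ` F \<union> Inr ` G)"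
  have ex: "\<exists>x. P x \<and> finite (f x) \<and> f x \<inter> E = {}" if E: "finite E" for E
  proof -
    define C D where "C = {j \<in> J. Inl j \<in> E}" and "D = {l \<in> L. Inr l \<in> E}"
    have fin: "finite C" "finite D"
    proof -
      have "finite (Inl -` E)" "finite (Inr -` E)" using E by (auto intro: finite_vimageI)
      then show "finite C" "finite D" by (auto simp: C_def D_def vimage_def elim!: rev_finite_subset)
    qed
    have "\<not> (\<forall>T\<in>carrier Z. norm (\<phi> (blk (- C) (- D) T)) \<le> e * nrm Z T)"
      using neg fin by (auto simp: C_def D_def)
    then obtain T where T: "T \<in> carrier Z" "\<not> norm (\<phi> (blk (- C) (- D) T)) \<le> e * nrm Z T" by blast
    \<comment> \<open>A functional exceeding e on some operator must exceed it on some elementary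
      tensor, by \<open>functional_le_on_tensors\<close>.\<close>
    have "\<exists>a\<in>carrier X'. \<exists>y\<in>carrier Y. e * (nrm X' a * nrm Y y) < norm (\<phi> (tens (res (- D) a) (res (- C) y)))"
    proof (rule ccontr)
      assume none: "\<not> ?thesis"
      have "norm (\<phi> (blk (- C) (- D) T)) \<le> e * nrm Z T"
      proof (rule functional_le_on_tensors[OF \<phi> less_imp_le[OF e] T(1)])
        fix a y assume ay: "a \<in> carrier X'" "y \<in> carrier Y"
        show "norm (\<phi> (tens (res (- D) a) (res (- C) y))) \<le> e * (nrm X' a * nrm Y y)"
        proof (rule ccontr)
          assume "\<not> ?thesis"
          then have "e * (nrm X' a * nrm Y y) < norm (\<phi> (tens (res (- D) a) (res (- C) y)))" by (rule not_le_imp_less)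
          then have "\<exists>a\<in>carrier X'. \<exists>y\<in>carrier Y. e * (nrm X' a * nrm Y y) < norm (\<phi> (tens (res (- D) a) (res (- C) y)))"
            by (rule bexI[OF bexI[OF _ ay(2)] ay(1)])
          with none show False ..
        qed
      qed
      with T(2) show False ..
    qed
    then obtain a y where a: "a \<in> carrier X'" and y: "y \<in> carrier Y"
      and gt: "e * (nrm X' a * nrm Y y) < norm (\<phi> (tens (res (- D) a) (res (- C) y)))"
      by blast
    define b z v where "b = res (- D) a" and "z = res (- C) y" and "v = \<phi> (tens b z)"
    have b: "b \<in> carrier X'" "nrm X' b \<le> nrm X' a" unfolding b_def by (intro X'_res a)+
    have z: "z \<in> carrier Y" "nrm Y z \<le> nrm Y y" unfolding z_def by (intro Y_res y)+
    \<comment> \<open>The margin in the strict inequality, scaled so that truncating the two factors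
      to finite supports cannot use it up.\<close>
    define \<eta> where "\<eta> = (norm v - e * (nrm X' a * nrm Y y)) / (nrm (dual Z) \<phi> + 1)"
    have \<eta>: "0 < \<eta>" using gt Z.dual_nrm_nonneg[OF \<phi>] by (simp add: \<eta>_def v_def b_def z_def)
    obtain F G where FG: "finite F" "F \<subseteq> J" "finite G" "G \<subseteq> L"
      and close': "\<And>C' D'. F \<subseteq> C' \<Longrightarrow> G \<subseteq> D' \<Longrightarrow> nrm Z (tens b z - blk C' D' (tens b z)) \<le> \<eta>"
      by (rule blk_approx[OF tens_mem(1)[OF b(1) z(1)] \<eta>]) blast
    note close = close'[OF order_refl order_refl]
    define b' z' w where "b' = res G b" and "z' = res F z" and "w = \<phi> (tens b' z')"
    have b': "b' \<in> carrier X'" "nrm X' b' \<le> nrm X' a"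
      unfolding b'_def using X'_res[OF b(1), of G] b(2) by auto
    have z': "z' \<in> carrier Y" "nrm Y z' \<le> nrm Y y"
      unfolding z'_def using Y_res[OF z(1), of F] z(2) by auto
    have w_gt: "e * (nrm X' a * nrm Y y) < norm w"
    proof -
      have "norm (v - w) = norm (\<phi> (tens b z - tens b' z'))"
        by (simp only: v_def w_def Z.dual_diff[OF \<phi> tens_mem(1)[OF b(1) z(1)] tens_mem(1)[OF b'(1) z'(1)]])
      also have "\<dots> \<le> nrm (dual Z) \<phi> * nrm Z (tens b z - tens b' z')"
        by (intro Z.dual_bound \<phi> Z.diff_mem tens_mem b z b' z')
      also have "\<dots> \<le> nrm (dual Z) \<phi> * \<eta>"
        using close by (intro mult_left_mono Z.dual_nrm_nonneg \<phi>) (simp only: blk_tens b'_def z'_def)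
      also have "\<dots> < (nrm (dual Z) \<phi> + 1) * \<eta>" using \<eta> by (simp add: distrib_right)
      also have "\<dots> = norm v - e * (nrm X' a * nrm Y y)"
        using Z.dual_nrm_nonneg[OF \<phi>] by (simp add: \<eta>_def)
      finally show ?thesis using norm_triangle_ineq2[of v w] by linarith
    qed
    have w_le: "norm w \<le> nrm (dual Z) \<phi> * (nrm X' a * nrm Y y)"
    proof -
      have "norm w \<le> nrm (dual Z) \<phi> * nrm Z (tens b' z')"
        unfolding w_def by (intro Z.dual_bound \<phi> tens_mem b' z')
      also have "\<dots> \<le> nrm (dual Z) \<phi> * (nrm X' b' * nrm Y z')"
        by (intro mult_left_mono tens_mem Z.dual_nrm_nonneg \<phi> b' z')
      also have "\<dots> \<le> nrm (dual Z) \<phi> * (nrm X' a * nrm Y y)"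
        by (intro mult_left_mono mult_mono Z.dual_nrm_nonneg \<phi> b' z' X'.nrm_nonneg a Y.nrm_nonneg)
      finally show ?thesis .
    qed
    \<comment> \<open>If the product of the norms vanished, \<open>w_le\<close> would give w = 0
      against \<open>w_gt\<close>; so normalisation is legitimate.\<close>
    have pos: "0 < nrm X' a" "0 < nrm Y y"
    proof -
      have "nrm X' a * nrm Y y \<noteq> 0" using w_gt w_le by auto
      then show "0 < nrm X' a" "0 < nrm Y y" using X'.nrm_nonneg[OF a] Y.nrm_nonneg[OF y] by auto
    qed
    then have w0: "w \<noteq> 0" using w_gt e by (metis less_trans mult_pos_pos norm_zero order_less_irrefl)
    \<comment> \<open>The factor \<open>of_real (norm w) / w\<close> makes the value of \<phi>
      positive. Division by the norms of the original a and y is enough, since restriction has not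
      increased them.\<close>
    define a'' where "a'' = smul X' (of_real (norm w) / w / of_real (nrm X' a)) b'"
    define y'' where "y'' = smul Y (1 / of_real (nrm Y y)) z'"
    have mem: "a'' \<in> carrier X'" "y'' \<in> carrier Y"
      unfolding a''_def y''_def by (intro X'.smul_mem Y.smul_mem b' z')+
    have "nrm X' a'' \<le> 1" "nrm Y y'' \<le> 1"
      unfolding a''_def y''_def using pos w0 b' z'
      by (simp_all add: X'.nrm_smul Y.nrm_smul norm_mult norm_divide divide_le_eq)
    moreover have "res (G - D) a'' = a''" "res (F - C) y'' = y''"
      by (auto simp: a''_def y''_def b'_def z'_def b_def z_def res_def ell_smul fun_eq_iff)
    moreover have "\<phi> (tens a'' y'') = of_real (norm w / (nrm X' a * nrm Y y))"
    proof -
      have "tens a'' y'' = smul Z (1 / of_real (nrm Y y)) (smul Z (of_real (norm w) / w / of_real (nrm X' a)) (tens b' z'))"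
        unfolding a''_def y''_def by (simp only: tens_smul_left[OF b'(1)] tens_smul_right)
      then have "\<phi> (tens a'' y'') = 1 / of_real (nrm Y y) * (of_real (norm w) / w / of_real (nrm X' a) * w)"
        by (simp only: w_def Z.dual_smul[OF \<phi>] Z.smul_mem tens_mem(1)[OF b'(1) z'(1)])
      then show ?thesis using w0 by simp
    qed
    moreover have "e < norm w / (nrm X' a * nrm Y y)"
      using w_gt pos by (simp add: less_divide_eq)
    ultimately have "P (F - C, G - D, a'', y'')" using mem by (auto simp: P_def)
    moreover have "finite (f (F - C, G - D, a'', y''))" using FG by (simp add: f_def)
    moreover have "f (F - C, G - D, a'', y'') \<inter> E = {}"
      using FG by (auto simp: f_def C_def D_def)
    ultimately show ?thesis by blast
  qed
  from disjoint_choice[of P f, OF ex] obtain s :: "nat \<Rightarrow> _" where s: "\<forall>n. P (s n) \<and> finite (f (s n))"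
    and s_disj: "\<forall>m n. m < n \<longrightarrow> f (s m) \<inter> f (s n) = {}" by blast
  define F G a y where "F n = fst (s n)" and "G n = fst (snd (s n))" and "a n = fst (snd (snd (s n)))"
    and "y n = snd (snd (snd (s n)))" for n
  have props: "a n \<in> carrier X'" "y n \<in> carrier Y" "nrm X' (a n) \<le> 1" "nrm Y (y n) \<le> 1"
      "res (G n) (a n) = a n" "res (F n) (y n) = y n" "\<exists>t>e. \<phi> (tens (a n) (y n)) = of_real t" for n
    using s by (auto simp: P_def F_def G_def a_def y_def split_def)
  have disj: "F m \<inter> F n = {}" "G m \<inter> G n = {}" if "m < n" for m n
    using s_disj that by (fastforce simp: f_def F_def G_def split_def)+
  obtain t where t: "\<And>n. e < t n" "\<And>n. \<phi> (tens (a n) (y n)) = of_real (t n)" using props(7) by metis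
  \<comment> \<open>The place where q < p is used: 1 / p < 1 / q, while 1 / r + 1 / q = 1.\<close>
  have lt: "1 / r + 1 / p < 1"
  proof -
    have "1 / p < 1 / q" using qp q by (simp add: frac_less2)
    then show ?thesis using rq by simp
  qed
  have B1: "\<phi> (tens (u + v) w) = \<phi> (tens u w) + \<phi> (tens v w)"
    if "u \<in> carrier X'" "v \<in> carrier X'" "w \<in> carrier Y" for u v w
    using that by (simp only: tens_add_left Z.dual_add[OF \<phi>] tens_mem)
  have B2: "\<phi> (tens u (v + w)) = \<phi> (tens u v) + \<phi> (tens u w)"
    if "u \<in> carrier X'" "v \<in> carrier Y" "w \<in> carrier Y" for u v w
    using that by (simp only: tens_add_right Z.dual_add[OF \<phi>] tens_mem)
  show False
  proof (rule sublinear_growth_contradiction[OF e lt])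
    fix N :: nat assume N: "0 < N"
    obtain u w where uw: "\<And>n. u n = a n \<and> w n = y n \<or> u n = - a n \<and> w n = - y n"
      and le: "norm ((\<Sum>n<N. \<phi> (tens (a n) (y n))) + 0) \<le> norm (\<phi> (tens (\<Sum>n<N. u n) (\<Sum>n<N. w n)) + 0)"
      using exists_signs[of "carrier X'" "carrier Y" "\<lambda>u w. \<phi> (tens u w)" a y N 0,
          OF X'.zero_mem X'.add_mem X'.uminus_mem Y.zero_mem Y.add_mem Y.uminus_mem B1 B2 props(1,2)]
      by blast
    have res_minus: "res H (- x) = - res H x" for H and x :: "'i \<Rightarrow> 'k" by (auto simp: res_def)
    have u: "u n \<in> carrier X'" "nrm X' (u n) \<le> 1" "res (G n) (u n) = u n" for n
      using uw[of n] props[of n] X'.uminus_mem[of "a n"] X'.nrm_uminus[of "a n"] by (auto simp: res_minus)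
    have w: "w n \<in> carrier Y" "nrm Y (w n) \<le> 1" "res (F n) (w n) = w n" for n
      using uw[of n] props[of n] Y.uminus_mem[of "y n"] Y.nrm_uminus[of "y n"] by (auto simp: res_minus)
    have U: "(\<Sum>n<N. u n) \<in> carrier X'" "(\<Sum>n<N. w n) \<in> carrier Y"
      by (intro X'.sum_mem Y.sum_mem u w)+
    have "real N * e = (\<Sum>n<N. e)" by simp
    also have "\<dots> \<le> (\<Sum>n<N. t n)" using t(1) by (intro sum_mono) (simp add: less_imp_le)
    also have "\<dots> \<le> norm (of_real (\<Sum>n<N. t n) :: 'k)" by (simp del: of_real_sum)
    also have "of_real (\<Sum>n<N. t n) = (\<Sum>n<N. \<phi> (tens (a n) (y n)))" by (simp add: t(2))
    also have "norm \<dots> \<le> norm (\<phi> (tens (\<Sum>n<N. u n) (\<Sum>n<N. w n)))" using le by (simp only: add_0_right)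
    also have "\<dots> \<le> nrm (dual Z) \<phi> * nrm Z (tens (\<Sum>n<N. u n) (\<Sum>n<N. w n))"
      by (intro Z.dual_bound \<phi> tens_mem U)
    also have "\<dots> \<le> nrm (dual Z) \<phi> * (nrm X' (\<Sum>n<N. u n) * nrm Y (\<Sum>n<N. w n))"
      by (intro mult_left_mono tens_mem U Z.dual_nrm_nonneg \<phi>)
    also have "\<dots> \<le> nrm (dual Z) \<phi> * (real N powr (1 / r) * real N powr (1 / p))"
      by (intro mult_left_mono mult_mono Z.dual_nrm_nonneg \<phi> Y.nrm_nonneg U
          ell_disjoint_sum_le[OF exponents_le(1) u] ell_disjoint_sum_le[OF p_le w] disj) auto
    finally show "real N * e \<le> nrm (dual Z) \<phi> * real N powr (1 / r + 1 / p)" by (simp add: powr_add)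
  qed
qed

lemma canon_eqI:
  assumes "\<psi> \<in> carrier (dual (dual Z))" "\<And>\<phi>. \<phi> \<in> carrier (dual Z) \<Longrightarrow> \<psi> \<phi> = \<phi> S"
  shows "\<psi> = canon Z S"
proof
  fix \<phi>
  show "\<psi> \<phi> = canon Z S \<phi>"
    using assms(2)[of \<phi>] Z'.dual_outside[OF assms(1), of \<phi>] by (simp add: canon_def)
qed

text \<open>By \<open>bidual_off_corner\<close> the functional \<psi> can differ from S only through
  the corner of \<phi>, and \<open>functional_corner_tail\<close> makes this corner small in
  norm.\<close>

theorem nuclear_reflexive:
  assumes "q < p"
  shows "reflexive Z"
  unfolding reflexive_def
proof (intro equalityI subsetI)
  fix \<psi> assume "\<psi> \<in> canon Z ` carrier Z"
  then show "\<psi> \<in> carrier (dual (dual Z))" using Z.canon_mem(1) by auto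
next
  fix \<psi> assume \<psi>: "\<psi> \<in> carrier (dual (dual Z))"
  obtain S where S: "S \<in> carrier Z" and fin: "\<And>\<phi> C D. \<phi> \<in> carrier (dual Z) \<Longrightarrow> finite C \<Longrightarrow> C \<subseteq> J \<Longrightarrow>
      finite D \<Longrightarrow> D \<subseteq> L \<Longrightarrow> \<psi> (pull \<phi> C D) = \<phi> (blk C D S)"
    using matrix_of_bidual[OF \<psi>] by blast
  have "\<psi> \<phi> = \<phi> S" if \<phi>: "\<phi> \<in> carrier (dual Z)" for \<phi>
  proof -
    define K where "K = nrm (dual (dual Z)) \<psi> + nrm Z S + 1"
    have K: "0 < K" using Z'.dual_nrm_nonneg[OF \<psi>] Z.nrm_nonneg[OF S] by (simp add: K_def)
    have "norm (\<psi> \<phi> - \<phi> S) \<le> 0 + e" if e: "0 < e" for e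
    proof -
      obtain C D where CD: "finite C" "C \<subseteq> J" "finite D" "D \<subseteq> L"
        and le: "\<And>T. T \<in> carrier Z \<Longrightarrow> norm (\<phi> (blk (- C) (- D) T)) \<le> e / K * nrm Z T"
        using functional_corner_tail[OF assms \<phi> divide_pos_pos[OF e K]] by blast
      let ?c = "pull \<phi> (- C) (- D)" and ?b = "blk (- C) (- D) S"
      have "\<psi> (\<phi> - ?c) = \<phi> (S - ?b)" by (rule bidual_off_corner[OF \<psi> S fin \<phi> CD])
      then have "\<psi> \<phi> - \<psi> ?c = \<phi> S - \<phi> ?b"
        by (simp only: Z'.dual_diff[OF \<psi> \<phi> pull_mem[OF \<phi>]] Z.dual_diff[OF \<phi> S blk_mem(1)[OF S]])
      then have "\<psi> \<phi> - \<phi> S = \<psi> ?c - \<phi> ?b" by (rule diff_eq_swap)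
      then have "norm (\<psi> \<phi> - \<phi> S) \<le> norm (\<psi> ?c) + norm (\<phi> ?b)"
        using norm_triangle_ineq4[of "\<psi> ?c" "\<phi> ?b"] by simp
      also have "norm (\<psi> ?c) \<le> nrm (dual (dual Z)) \<psi> * nrm (dual Z) ?c"
        by (intro Z'.dual_bound \<psi> pull_mem \<phi>)
      also have "nrm (dual (dual Z)) \<psi> * nrm (dual Z) ?c \<le> nrm (dual (dual Z)) \<psi> * (e / K)"
        using e K by (intro mult_left_mono pull_nrm_le le Z'.dual_nrm_nonneg \<psi>) auto
      also have "norm (\<phi> ?b) \<le> e / K * nrm Z S" by (rule le[OF S])
      finally have "norm (\<psi> \<phi> - \<phi> S) \<le> (nrm (dual (dual Z)) \<psi> + nrm Z S) * (e / K)"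
        by (simp add: algebra_simps)
      also have "\<dots> \<le> K * (e / K)" using e K by (intro mult_right_mono) (auto simp: K_def)
      finally show ?thesis using K by simp
    qed
    then have "norm (\<psi> \<phi> - \<phi> S) \<le> 0" by (rule field_le_epsilon)
    then show ?thesis by simp
  qed
  then have "\<psi> = canon Z S" by (rule canon_eqI[OF \<psi>])
  then show "\<psi> \<in> canon Z ` carrier Z" using S by blast
qed

section \<open>The formulas for the measures of non-compactness\<close>

lemma corner_eq: "blk (- C) (- D) (blk C D T) = 0" if "T \<in> carrier Z"
  using blk_empty[OF that, of "{}" "{}"] by (simp only: blk_blk Int_commute Compl_disjoint simp_thms)

text \<open>\<open>?G\<close> consists of the functionals supported in the corner. An element of the
  bidual that kills them is evaluation at an operator, namely S without its corner, so
  \<open>weakly_compact_annihilator\<close> provides K. Each T in A differs from an operator killed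
  by \<open>?G\<close> by its own corner, of norm at most d.\<close>

lemma omega_le_corner:
  assumes A: "bounded_in Z A" "A \<noteq> {}" and C: "finite C" "C \<subseteq> J" and D: "finite D" "D \<subseteq> L"
    and le: "\<And>T. T \<in> A \<Longrightarrow> nrm Z (blk (- C) (- D) T) \<le> d"
  shows "omega_nc Z A \<le> d"
proof -
  let ?G = "(\<lambda>\<phi>. pull \<phi> (- C) (- D)) ` carrier (dual Z)"
  obtain M where M: "A \<subseteq> carrier Z" "\<And>T. T \<in> A \<Longrightarrow> nrm Z T \<le> M" using A(1) by (auto simp: bounded_in_def)
  have G: "?G \<subseteq> carrier (dual Z)" using pull_mem by auto
  have canon: "\<psi> \<in> canon Z ` carrier Z"
    if \<psi>: "\<psi> \<in> carrier (dual (dual Z))" and zero: "\<forall>\<phi>\<in>?G. \<psi> \<phi> = 0" for \<psi>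
  proof -
    obtain S where S: "S \<in> carrier Z" and fin: "\<And>\<phi> C D. \<phi> \<in> carrier (dual Z) \<Longrightarrow> finite C \<Longrightarrow> C \<subseteq> J \<Longrightarrow>
        finite D \<Longrightarrow> D \<subseteq> L \<Longrightarrow> \<psi> (pull \<phi> C D) = \<phi> (blk C D S)"
      using matrix_of_bidual[OF \<psi>] by blast
    have "\<psi> \<phi> = \<phi> (S - blk (- C) (- D) S)" if \<phi>: "\<phi> \<in> carrier (dual Z)" for \<phi>
    proof -
      have "\<psi> (pull \<phi> (- C) (- D)) = 0" using zero \<phi> by blast
      then have "\<psi> (\<phi> - pull \<phi> (- C) (- D)) = \<psi> \<phi>"
        by (simp only: Z'.dual_diff[OF \<psi> \<phi> pull_mem[OF \<phi>]] diff_zero)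
      moreover have "\<psi> (\<phi> - pull \<phi> (- C) (- D)) = \<phi> (S - blk (- C) (- D) S)"
        by (rule bidual_off_corner[OF \<psi> S fin \<phi> C D])
      ultimately show ?thesis by (simp only:)
    qed
    then have "\<psi> = canon Z (S - blk (- C) (- D) S)" by (rule canon_eqI[OF \<psi>])
    moreover have "S - blk (- C) (- D) S \<in> carrier Z" by (intro Z.diff_mem S blk_mem)
    ultimately show ?thesis by blast
  qed
  \<comment> \<open>Removing the corner may double the norm, hence the radius 2 * M.\<close>
  obtain K where K: "K \<subseteq> carrier Z" "compactin (weak_topology Z) K"
    and near: "\<And>v. v \<in> carrier Z \<Longrightarrow> nrm Z v \<le> 2 * M \<Longrightarrow> (\<And>\<phi>. \<phi> \<in> ?G \<Longrightarrow> \<phi> v = 0) \<Longrightarrow> \<exists>k\<in>K. nrm Z (v - k) = 0"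
    by (rule Z.weakly_compact_annihilator[OF G canon, of "2 * M"]) blast+
  have approx: "\<exists>k\<in>K. nrm Z (T - k) \<le> d" if T: "T \<in> A" for T
  proof -
    have TZ: "T \<in> carrier Z" using T M by auto
    let ?c = "blk (- C) (- D) T"
    have c: "?c \<in> carrier Z" "nrm Z ?c \<le> nrm Z T" by (intro blk_mem TZ)+
    have v: "T - ?c \<in> carrier Z" by (intro Z.diff_mem TZ c)
    have "nrm Z (T - ?c) \<le> 2 * M" using Z.nrm_diff_le[OF TZ c(1)] c(2) M(2)[OF T] by linarith
    moreover have "\<phi> (T - ?c) = 0" if "\<phi> \<in> ?G" for \<phi>
    proof -
      obtain \<phi>' where \<phi>': "\<phi>' \<in> carrier (dual Z)" "\<phi> = pull \<phi>' (- C) (- D)" using \<open>\<phi> \<in> ?G\<close> by blast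
      have "blk (- C) (- D) (T - ?c) = 0" by (simp only: blk_diff blk_blk Int_absorb diff_self)
      then show ?thesis using pull_apply[OF v, of \<phi>'] Z.dual_zero[OF \<phi>'(1)] \<phi>'(2) by simp
    qed
    ultimately obtain k where k: "k \<in> K" "nrm Z ((T - ?c) - k) = 0" using near[OF v] by blast
    have kZ: "k \<in> carrier Z" using k K by auto
    have "nrm Z (T - k) = nrm Z (((T - ?c) - k) + ?c)" by (rule arg_cong[where f = "nrm Z"]) simp
    also have "\<dots> \<le> nrm Z ((T - ?c) - k) + nrm Z ?c" by (intro Z.nrm_triangle Z.diff_mem v kZ c)
    finally have "nrm Z (T - k) \<le> d" using k(2) le[OF T] by linarith
    then show ?thesis using k(1) by blast
  qed
  have "pt_dist Z T K \<le> d" if T: "T \<in> A" for T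
  proof -
    obtain k where k: "k \<in> K" "nrm Z (T - k) \<le> d" using approx[OF T] by blast
    have "pt_dist Z T K \<le> nrm Z (T - k)" using T M K k by (intro Z.pt_dist_le) auto
    then show ?thesis using k(2) by linarith
  qed
  then have "dhat Z A K \<le> d" by (rule Z.dhat_le[OF A(2)])
  moreover have "K \<noteq> {}" using approx A(2) by blast
  ultimately show ?thesis using Z.omega_nc_le[OF A K] by linarith
qed

end

text \<open>One step of the gliding hump: an operator of A, a functional, and the rows and columns
  on which the functional is supported.\<close>

type_synonym ('l, 'j, 'k) hump =
  "(('l \<Rightarrow> 'k) \<Rightarrow> 'j \<Rightarrow> 'k) \<times> ((('l \<Rightarrow> 'k) \<Rightarrow> 'j \<Rightarrow> 'k) \<Rightarrow> 'k) \<times> 'j set \<times> 'l set"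

section \<open>Lower bounds for large corners by a gliding hump\<close>

context nuclear_ell
begin

lemma blk_union_Compl:
  "blk (- C) (- D) (blk (- C') (- D') T) = blk (- (C \<union> C')) (- (D \<union> D')) T"
  by (simp only: blk_blk Compl_Un)

lemma corner_mono:
  assumes T: "T \<in> carrier Z" and "C' \<subseteq> C" "D' \<subseteq> D"
  shows "nrm Z (blk (- C) (- D) T) \<le> nrm Z (blk (- C') (- D') T)"
proof -
  have "blk (- C) (- D) T = blk (- C) (- D) (blk (- C') (- D') T)"
    using assms(2,3) by (simp only: blk_union_Compl Un_absorb2)
  then have "nrm Z (blk (- C) (- D) T) = nrm Z (blk (- C) (- D) (blk (- C') (- D') T))" by (rule arg_cong)
  also have "\<dots> \<le> nrm Z (blk (- C') (- D') T)" by (intro blk_mem T)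
  finally show ?thesis .
qed

text \<open>By \<open>corner_mono\<close> the sets \<open>far (C, D)\<close> shrink as C and D grow,
  so compactness yields one \<psi> in all of their weak-star closures; S is its matrix. Finitely
  supported functionals cannot separate \<psi> from S, hence some operators with large corners look
  like S to them.\<close>

lemma corner_cluster:
  assumes A: "bounded_in Z A"
    and large: "\<And>C D. finite C \<Longrightarrow> C \<subseteq> J \<Longrightarrow> finite D \<Longrightarrow> D \<subseteq> L \<Longrightarrow> \<exists>T\<in>A. d < nrm Z (blk (- C) (- D) T)"
  obtains S where "S \<in> carrier Z"
    "\<And>C D \<Phi> \<delta>. finite C \<Longrightarrow> C \<subseteq> J \<Longrightarrow> finite D \<Longrightarrow> D \<subseteq> L \<Longrightarrow> finite \<Phi> \<Longrightarrow> 0 < \<delta> \<Longrightarrow>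
      (\<And>\<phi>. \<phi> \<in> \<Phi> \<Longrightarrow> \<phi> \<in> carrier (dual Z) \<and>
        (\<exists>C' D'. finite C' \<and> C' \<subseteq> J \<and> finite D' \<and> D' \<subseteq> L \<and> pull \<phi> C' D' = \<phi>)) \<Longrightarrow>
      \<exists>T\<in>A. d < nrm Z (blk (- C) (- D) T) \<and> (\<forall>\<phi>\<in>\<Phi>. norm (\<phi> (T - S)) < \<delta>)"
proof -
  let ?W = "weak_star_topology (dual Z)"
  obtain M where M: "A \<subseteq> carrier Z" "\<And>T. T \<in> A \<Longrightarrow> nrm Z T \<le> M" using A by (auto simp: bounded_in_def)
  define I where "I = {(C, D). finite C \<and> C \<subseteq> J \<and> finite D \<and> D \<subseteq> L}"
  define far where "far = (\<lambda>(C, D). {T \<in> A. d < nrm Z (blk (- C) (- D) T)})"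
  define cl where "cl i = ?W closure_of (canon Z ` far i)" for i
  define K where "K = {\<psi> \<in> carrier (dual (dual Z)). nrm (dual (dual Z)) \<psi> \<le> M}"
  have far_A: "far i \<subseteq> A" for i by (auto simp: far_def)
  have canon_K: "canon Z T \<in> K" if "T \<in> A" for T
    using Z.canon_mem[of T] M that unfolding K_def by fastforce
  have ne: "K \<inter> \<Inter>\<F> \<noteq> {}" if fin: "finite \<F>" and sub: "\<F> \<subseteq> cl ` I" for \<F>
  proof -
    obtain I' where I': "I' \<subseteq> I" "finite I'" "\<F> = cl ` I'" using finite_subset_image[OF fin sub] by blast
    \<comment> \<open>An operator with large corner beyond the union has, by monotonicity, large
      corners for all the finitely many pairs.\<close>
    define C D where "C = (\<Union>i\<in>I'. fst i)" and "D = (\<Union>i\<in>I'. snd i)"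
    have "finite (fst i) \<and> fst i \<subseteq> J \<and> finite (snd i) \<and> snd i \<subseteq> L" if "i \<in> I'" for i
    proof -
      have "i \<in> I" using I'(1) that by blast
      then show ?thesis by (cases i) (simp add: I_def)
    qed
    then have CD: "finite C" "C \<subseteq> J" "finite D" "D \<subseteq> L" using I'(2) by (auto simp: C_def D_def)
    obtain T where T: "T \<in> A" "d < nrm Z (blk (- C) (- D) T)" using large[OF CD] by blast
    have "canon Z T \<in> cl i" if i: "i \<in> I'" for i
    proof -
      have "nrm Z (blk (- C) (- D) T) \<le> nrm Z (blk (- fst i) (- snd i) T)"
        using i T(1) M by (intro corner_mono) (auto simp: C_def D_def)
      then have "T \<in> far i" using T by (cases i) (simp add: far_def)
      moreover have "canon Z ` far i \<subseteq> topspace ?W"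
        using far_A[of i] canon_K by (auto simp: Z'.topspace_weak_star K_def)
      ultimately show ?thesis unfolding cl_def using closure_of_subset by blast
    qed
    then show ?thesis using canon_K[OF T(1)] I'(3) by blast
  qed
  have "compactin ?W K" unfolding K_def by (rule Z'.banach_alaoglu)
  then have "K \<inter> \<Inter>(cl ` I) \<noteq> {}"
    by (rule compactin_fipD) (use ne in \<open>auto simp: cl_def\<close>)
  then obtain \<psi> where \<psi>: "\<psi> \<in> carrier (dual (dual Z))" "\<And>i. i \<in> I \<Longrightarrow> \<psi> \<in> cl i" by (auto simp: K_def)
  obtain S where S: "S \<in> carrier Z" and fin: "\<And>\<phi> C D. \<phi> \<in> carrier (dual Z) \<Longrightarrow> finite C \<Longrightarrow> C \<subseteq> J \<Longrightarrow>
      finite D \<Longrightarrow> D \<subseteq> L \<Longrightarrow> \<psi> (pull \<phi> C D) = \<phi> (blk C D S)"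
    using matrix_of_bidual[OF \<psi>(1)] by blast
  show ?thesis
  proof (rule that[OF S])
    fix C D \<Phi> and \<delta> :: real
    assume CD: "finite C" "C \<subseteq> J" "finite D" "D \<subseteq> L" and \<Phi>: "finite \<Phi>" and \<delta>: "0 < \<delta>"
      and finitary: "\<And>\<phi>. \<phi> \<in> \<Phi> \<Longrightarrow> \<phi> \<in> carrier (dual Z) \<and>
        (\<exists>C' D'. finite C' \<and> C' \<subseteq> J \<and> finite D' \<and> D' \<subseteq> L \<and> pull \<phi> C' D' = \<phi>)"
    have i: "(C, D) \<in> I" using CD by (simp add: I_def)
    have far_bdd: "bounded_in Z (far (C, D))"
      unfolding bounded_in_def
    proof (intro conjI exI[of _ M] ballI)
      show "far (C, D) \<subseteq> carrier Z" using far_A[of "(C, D)"] M(1) by (rule order_trans)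
      show "nrm Z T \<le> M" if "T \<in> far (C, D)" for T using far_A[of "(C, D)"] M(2) that by blast
    qed
    have far_ne: "far (C, D) \<noteq> {}" using large[OF CD] by (auto simp: far_def)
    have "\<psi> \<in> ?W closure_of (canon Z ` far (C, D))" using \<psi>(2)[OF i] by (simp add: cl_def)
    then obtain T where T: "T \<in> far (C, D)" "\<And>\<phi> e. (\<phi>, e) \<in> \<Phi> \<times> {\<delta>} \<Longrightarrow> norm (\<psi> \<phi> - \<phi> T) < e"
      by (rule Z.wcl_approx[OF far_bdd far_ne, where G = "\<Phi> \<times> {\<delta>}"]) (use \<Phi> \<delta> finitary in auto)
    have TA: "T \<in> A" "T \<in> carrier Z" using T(1) far_A M by auto
    have "norm (\<phi> (T - S)) < \<delta>" if \<phi>: "\<phi> \<in> \<Phi>" for \<phi>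
    proof -
      obtain C' D' where CD': "finite C'" "C' \<subseteq> J" "finite D'" "D' \<subseteq> L" and eq: "pull \<phi> C' D' = \<phi>"
        and mem: "\<phi> \<in> carrier (dual Z)"
        using finitary[OF \<phi>] by blast
      have "\<psi> \<phi> = \<phi> (blk C' D' S)" using fin[OF mem CD'] eq by simp
      also have "\<dots> = pull \<phi> C' D' S" by (simp only: pull_apply[OF S])
      finally have "\<psi> \<phi> = \<phi> S" using eq by simp
      then have "norm (\<phi> S - \<phi> T) < \<delta>" using T(2)[of \<phi> \<delta>] \<phi> by simp
      then show ?thesis
        by (simp only: Z.dual_diff[OF mem TA(2) S] norm_minus_commute)
    qed
    then show "\<exists>T\<in>A. d < nrm Z (blk (- C) (- D) T) \<and> (\<forall>\<phi>\<in>\<Phi>. norm (\<phi> (T - S)) < \<delta>)"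
      using T(1) by (auto simp: far_def)
  qed
qed

text \<open>The coordinates used before step n, on top of an initial set C0 that carries most of S;
  the index \<open>Suc n\<close> includes block n itself.\<close>

definition cumul :: "'x set \<Rightarrow> (nat \<Rightarrow> 'x set) \<Rightarrow> nat \<Rightarrow> 'x set" where
  "cumul C0 C n = C0 \<union> (\<Union>m<n. C m)"

text \<open>Choosing \<open>S\<close> as an entrywise cluster point of operators in \<open>A\<close> with large corners makes the
  effect of the earlier functionals \<open>\<phi> m\<close> on \<open>T n - S\<close> negligible.\<close>

lemma gliding_hump:
  assumes A: "bounded_in Z A" and e: "0 < e"
    and large: "\<And>C D. finite C \<Longrightarrow> C \<subseteq> J \<Longrightarrow> finite D \<Longrightarrow> D \<subseteq> L \<Longrightarrow> \<exists>T\<in>A. d < nrm Z (blk (- C) (- D) T)"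
  obtains S T \<phi> C D C0 D0 where "S \<in> carrier Z" "\<And>n::nat. T n \<in> A"
    "\<And>n. \<phi> n \<in> carrier (dual Z)" "\<And>n. nrm (dual Z) (\<phi> n) \<le> 1" "\<And>n. pull (\<phi> n) (C n) (D n) = \<phi> n"
    "\<And>m n. m < n \<Longrightarrow> C m \<inter> C n = {}" "\<And>m n. m < n \<Longrightarrow> D m \<inter> D n = {}" "\<And>n. C n \<inter> C0 = {}"
    "\<And>m n. m < n \<Longrightarrow> norm (\<phi> m (T n - S)) \<le> e / (real n + 1)"
    "\<And>n. \<exists>\<nu>\<ge>d - 2 * e. \<phi> n (T n - S) = of_real \<nu>"
    "\<And>n. nrm Z ((T n - S) - blk (cumul C0 C (Suc n)) (cumul D0 D (Suc n)) (T n - S)) \<le> e"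
proof -
  obtain S where S: "S \<in> carrier Z"
    and near: "\<And>C D \<Phi> \<delta>. finite C \<Longrightarrow> C \<subseteq> J \<Longrightarrow> finite D \<Longrightarrow> D \<subseteq> L \<Longrightarrow> finite \<Phi> \<Longrightarrow> 0 < \<delta> \<Longrightarrow>
      (\<And>\<phi>. \<phi> \<in> \<Phi> \<Longrightarrow> \<phi> \<in> carrier (dual Z) \<and>
        (\<exists>C' D'. finite C' \<and> C' \<subseteq> J \<and> finite D' \<and> D' \<subseteq> L \<and> pull \<phi> C' D' = \<phi>)) \<Longrightarrow>
      \<exists>T\<in>A. d < nrm Z (blk (- C) (- D) T) \<and> (\<forall>\<phi>\<in>\<Phi>. norm (\<phi> (T - S)) < \<delta>)"
    by (rule corner_cluster[OF A large]) blast+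
  have AZ: "T \<in> carrier Z" if "T \<in> A" for T using A that by (auto simp: bounded_in_def)
  \<comment> \<open>S is nuclear, hence concentrated on a finite block; beyond it subtracting S
    changes corners by at most e.\<close>
  obtain C0 D0 where CD0: "finite C0" "C0 \<subseteq> J" "finite D0" "D0 \<subseteq> L"
    and S_close: "\<And>C' D'. C0 \<subseteq> C' \<Longrightarrow> D0 \<subseteq> D' \<Longrightarrow> nrm Z (S - blk C' D' S) \<le> e"
    by (rule blk_approx[OF S e]) blast
  define T' \<phi>' C' D' where
    "T' = (fst :: (('l, 'j, 'k) hump) \<Rightarrow> _)"
    and "\<phi>' = (\<lambda>x :: ('l, 'j, 'k) hump. fst (snd x))"
    and "C' = (\<lambda>x :: ('l, 'j, 'k) hump. fst (snd (snd x)))"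
    and "D' = (\<lambda>x :: ('l, 'j, 'k) hump. snd (snd (snd x)))"
  define own where "own x \<longleftrightarrow> T' x \<in> A \<and> \<phi>' x \<in> carrier (dual Z) \<and> nrm (dual Z) (\<phi>' x) \<le> 1 \<and>
    pull (\<phi>' x) (C' x) (D' x) = \<phi>' x \<and> finite (C' x) \<and> C' x \<subseteq> J \<and> finite (D' x) \<and> D' x \<subseteq> L \<and>
    (\<exists>\<nu>\<ge>d - 2 * e. \<phi>' x (T' x - S) = of_real \<nu>)" for x
  define step where "step H G x \<longleftrightarrow> own x \<and> C' x \<inter> H = {} \<and> D' x \<inter> G = {} \<and>
    nrm Z ((T' x - S) - blk (H \<union> C' x) (G \<union> D' x) (T' x - S)) \<le> e" for H G x
  \<comment> \<open>The tolerance e / (n + 1) is small enough that the n earlier functionals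
    together contribute at most e. P depends on s only below n, as the recursive choice
    requires.\<close>
  define P where "P s n x \<longleftrightarrow> step (cumul C0 (C' \<circ> s) n) (cumul D0 (D' \<circ> s) n) x \<and>
    (\<forall>m<n. norm (\<phi>' (s m) (T' x - S)) \<le> e / (real n + 1))" for s and n :: nat and x
  have "\<exists>s. \<forall>n. P s n (s n)"
  proof (rule dependent_wellorder_choice)
    fix x and s t :: "nat \<Rightarrow> ('l, 'j, 'k) hump" and n :: nat assume eq: "\<And>m. m < n \<Longrightarrow> s m = t m"
    then have "cumul C0 (C' \<circ> s) n = cumul C0 (C' \<circ> t) n" "cumul D0 (D' \<circ> s) n = cumul D0 (D' \<circ> t) n"
      by (simp_all add: cumul_def)
    with eq show "P s n x = P t n x" by (simp add: P_def)
  next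
    fix s :: "nat \<Rightarrow> ('l, 'j, 'k) hump" and n :: nat assume prev: "\<And>m. m < n \<Longrightarrow> P s m (s m)"
    have own: "own (s m)" if "m < n" for m using prev[OF that] by (simp add: P_def step_def)
    let ?H = "cumul C0 (C' \<circ> s) n" and ?G = "cumul D0 (D' \<circ> s) n"
    have HG: "finite ?H" "?H \<subseteq> J" "finite ?G" "?G \<subseteq> L"
    proof -
      have "finite (C' (s m)) \<and> C' (s m) \<subseteq> J \<and> finite (D' (s m)) \<and> D' (s m) \<subseteq> L" if "m < n" for m
        using own[OF that] by (simp only: own_def)
      then have "finite (\<Union>m<n. C' (s m))" "(\<Union>m<n. C' (s m)) \<subseteq> J" "finite (\<Union>m<n. D' (s m))" "(\<Union>m<n. D' (s m)) \<subseteq> L"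
        by (simp_all, blast+)
      then show "finite ?H" "?H \<subseteq> J" "finite ?G" "?G \<subseteq> L"
        unfolding cumul_def o_apply using CD0 by simp_all
    qed
    have HG0: "C0 \<subseteq> ?H" "D0 \<subseteq> ?G" by (auto simp: cumul_def)
    have finitary: "\<phi> \<in> carrier (dual Z) \<and> (\<exists>C' D'. finite C' \<and> C' \<subseteq> J \<and> finite D' \<and> D' \<subseteq> L \<and> pull \<phi> C' D' = \<phi>)"
      if "\<phi> \<in> (\<lambda>m. \<phi>' (s m)) ` {..<n}" for \<phi>
      using that own by (force simp: own_def)
    have "0 < e / (real n + 1)" using e by simp
    then have "\<exists>T\<in>A. d < nrm Z (blk (- ?H) (- ?G) T) \<and>
        (\<forall>\<phi>\<in>(\<lambda>m. \<phi>' (s m)) ` {..<n}. norm (\<phi> (T - S)) < e / (real n + 1))"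
      by (intro near HG finitary finite_imageI finite_lessThan)
    then obtain T where T: "T \<in> A" "d < nrm Z (blk (- ?H) (- ?G) T)"
      and T_near': "\<forall>\<phi>\<in>(\<lambda>m. \<phi>' (s m)) ` {..<n}. norm (\<phi> (T - S)) < e / (real n + 1)"
      by blast
    have T_near: "norm (\<phi>' (s m) (T - S)) < e / (real n + 1)" if "m < n" for m
      by (rule bspec[OF T_near' imageI]) (use that in simp)
    have TZ: "T \<in> carrier Z" using AZ[OF T(1)] .
    define U where "U = T - S"
    have U: "U \<in> carrier Z" unfolding U_def by (intro Z.diff_mem TZ S)
    have corner_S: "nrm Z (blk (- ?H) (- ?G) S) \<le> e"
    proof -
      have "blk (- ?H) (- ?G) S = blk (- ?H) (- ?G) (S - blk ?H ?G S)"
        using corner_eq[OF S, of ?H ?G] by (simp only: blk_diff diff_zero)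
      then have "nrm Z (blk (- ?H) (- ?G) S) = nrm Z (blk (- ?H) (- ?G) (S - blk ?H ?G S))" by (rule arg_cong)
      also have "\<dots> \<le> nrm Z (S - blk ?H ?G S)" by (intro blk_mem Z.diff_mem S)
      also have "\<dots> \<le> e" by (intro S_close HG0)
      finally show ?thesis .
    qed
    have corner_U: "d - e < nrm Z (blk (- ?H) (- ?G) U)"
    proof -
      have "nrm Z (blk (- ?H) (- ?G) T) \<le> nrm Z (blk (- ?H) (- ?G) S) + nrm Z (blk (- ?H) (- ?G) T - blk (- ?H) (- ?G) S)"
        by (intro Z.nrm_triangle_sub blk_mem TZ S)
      then show ?thesis unfolding U_def blk_diff using T(2) corner_S by linarith
    qed
    obtain C1 D1 where CD1: "finite C1" "C1 \<subseteq> J" "finite D1" "D1 \<subseteq> L"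
      and U_close: "\<And>C' D'. C1 \<subseteq> C' \<Longrightarrow> D1 \<subseteq> D' \<Longrightarrow> nrm Z (U - blk C' D' U) \<le> e"
      by (rule blk_approx[OF U e]) blast
    \<comment> \<open>Deleting the used coordinates makes the new block disjoint from the earlier
      ones, while together with ?H and ?G it still covers C1 and D1.\<close>
    define C D where "C = C1 - ?H" and "D = D1 - ?G"
    have CD: "finite C" "C \<subseteq> J" "finite D" "D \<subseteq> L" using CD1 by (auto simp: C_def D_def)
    have V: "nrm Z (U - blk (?H \<union> C) (?G \<union> D) U) \<le> e" by (intro U_close) (auto simp: C_def D_def)
    have VZ: "U - blk (?H \<union> C) (?G \<union> D) U \<in> carrier Z" by (intro Z.diff_mem blk_mem U)
    \<comment> \<open>One e was spent on the corner of S, the other goes into cutting the corner of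
      U down to a finite block.\<close>
    have blk_U: "d - 2 * e \<le> nrm Z (blk C D U)"
    proof -
      have 1: "blk C D U = blk (- ?H) (- ?G) (blk (?H \<union> C) (?G \<union> D) U)"
      proof -
        have "- ?H \<inter> (?H \<union> C) = C" "- ?G \<inter> (?G \<union> D) = D" by (auto simp: C_def D_def)
        then show ?thesis by (simp only: blk_blk)
      qed
      have "nrm Z (blk (- ?H) (- ?G) U) \<le> nrm Z (blk C D U) + nrm Z (blk (- ?H) (- ?G) U - blk C D U)"
        by (intro Z.nrm_triangle_sub blk_mem U)
      also have "blk (- ?H) (- ?G) U - blk C D U = blk (- ?H) (- ?G) (U - blk (?H \<union> C) (?G \<union> D) U)"
        unfolding 1 by (simp only: blk_diff)
      also have "nrm Z \<dots> \<le> nrm Z (U - blk (?H \<union> C) (?G \<union> D) U)" by (intro blk_mem VZ)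
      finally show ?thesis using corner_U V by linarith
    qed
    have BU: "blk C D U \<in> carrier Z" by (intro blk_mem U)
    obtain f where f: "f \<in> carrier (dual Z)" "nrm (dual Z) f \<le> 1" "f (blk C D U) = of_real (nrm Z (blk C D U))"
      using Z.hahn_banach[OF BU] by blast
    \<comment> \<open>Cutting the norming functional down to the block keeps its value on U's block
      and its norm bound, and gives it the finite support demanded by
      \<open>corner_cluster\<close>.\<close>
    define \<phi> where "\<phi> = pull f C D"
    have \<phi>: "\<phi> \<in> carrier (dual Z)" unfolding \<phi>_def by (rule pull_mem[OF f(1)])
    have "nrm (dual Z) \<phi> \<le> 1" unfolding \<phi>_def
    proof (rule pull_nrm_le)
      fix T assume T: "T \<in> carrier Z"
      have "norm (f (blk C D T)) \<le> nrm (dual Z) f * nrm Z (blk C D T)"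
        by (intro Z.dual_bound f blk_mem T)
      also have "\<dots> \<le> 1 * nrm Z T" using f by (intro mult_mono blk_mem T Z.nrm_nonneg) auto
      finally show "norm (f (blk C D T)) \<le> 1 * nrm Z T" .
    qed simp
    moreover have "pull \<phi> C D = \<phi>"
    proof
      fix R
      show "pull \<phi> C D R = \<phi> R"
      proof (cases "R \<in> carrier Z")
        case True
        then show ?thesis unfolding \<phi>_def by (simp only: pull_apply blk_mem blk_blk Int_absorb)
      qed (simp add: \<phi>_def pull_def)
    qed
    moreover have "\<phi> U = of_real (nrm Z (blk C D U))" unfolding \<phi>_def by (simp only: pull_apply[OF U] f(3))
    ultimately have "own (T, \<phi>, C, D)"
      unfolding own_def T'_def \<phi>'_def C'_def D'_def U_def[symmetric] fst_conv snd_conv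
      using T(1) \<phi> CD blk_U by blast
    moreover have "C \<inter> ?H = {}" "D \<inter> ?G = {}" by (auto simp: C_def D_def)
    ultimately have "step ?H ?G (T, \<phi>, C, D)"
      unfolding step_def using V by (simp only: T'_def C'_def D'_def fst_conv snd_conv U_def simp_thms)
    then have "P s n (T, \<phi>, C, D)"
      unfolding P_def using T_near by (auto simp: T'_def intro: less_imp_le)
    then show "\<exists>x. P s n x" by blast
  qed
  then obtain s where s: "\<And>n. P s n (s n)" by blast
  have own: "own (s n)" for n using s[of n] by (simp add: P_def step_def)
  have disj: "C' (s n) \<inter> cumul C0 (C' \<circ> s) n = {}" "D' (s n) \<inter> cumul D0 (D' \<circ> s) n = {}" for n
    using s[of n] by (simp_all only: P_def step_def)
  have last: "nrm Z ((T' (s n) - S) - blk (cumul C0 (C' \<circ> s) n \<union> C' (s n)) (cumul D0 (D' \<circ> s) n \<union> D' (s n)) (T' (s n) - S)) \<le> e" for n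
    using s[of n] by (simp only: P_def step_def)
  show ?thesis
  proof (rule that[OF S, of "T' \<circ> s" "\<phi>' \<circ> s" "C' \<circ> s" "D' \<circ> s" C0 D0])
    fix m n :: nat assume mn: "m < n"
    show "(C' \<circ> s) m \<inter> (C' \<circ> s) n = {}" using disj(1)[of n] mn by (auto simp: cumul_def)
    show "(D' \<circ> s) m \<inter> (D' \<circ> s) n = {}" using disj(2)[of n] mn by (auto simp: cumul_def)
    show "norm ((\<phi>' \<circ> s) m ((T' \<circ> s) n - S)) \<le> e / (real n + 1)"
      using s[of n] mn by (simp only: P_def o_def)
  next
    fix n
    show "(C' \<circ> s) n \<inter> C0 = {}" using disj(1)[of n] by (auto simp: cumul_def)
    have "cumul C0 (C' \<circ> s) (Suc n) = cumul C0 (C' \<circ> s) n \<union> C' (s n)"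
      "cumul D0 (D' \<circ> s) (Suc n) = cumul D0 (D' \<circ> s) n \<union> D' (s n)"
      by (auto simp: cumul_def lessThan_Suc)
    then show "nrm Z (((T' \<circ> s) n - S) - blk (cumul C0 (C' \<circ> s) (Suc n)) (cumul D0 (D' \<circ> s) (Suc n)) ((T' \<circ> s) n - S)) \<le> e"
      using last[of n] by (simp only: o_apply)
  qed (use own in \<open>simp_all only: own_def o_apply\<close>)
qed

end

context nuclear_ell
begin

text \<open>For \<open>p \<le> q\<close> the functionals \<open>\<phi> m\<close> of the gliding hump span \<open>c\<^sub>0\<close> isometrically, so their
  tails \<open>\<Phi> N\<close> have norm at most one. Each \<open>\<Phi> N\<close> is at least \<open>d - 4 e\<close> in modulus on almost all
  \<open>T n - S\<close>, while \<open>\<Phi> N V \<rightarrow> 0\<close> for each fixed \<open>V\<close> in \<open>Z\<close>.\<close>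

lemma corner_le_wck:
  assumes pq: "p \<le> q" and A: "bounded_in Z A" "A \<noteq> {}" and e: "0 < e"
    and large: "\<And>C D. finite C \<Longrightarrow> C \<subseteq> J \<Longrightarrow> finite D \<Longrightarrow> D \<subseteq> L \<Longrightarrow> \<exists>T\<in>A. d < nrm Z (blk (- C) (- D) T)"
  shows "d - 5 * e \<le> wck_nc Z A"
proof -
  obtain S T \<phi> C D C0 D0 where S: "S \<in> carrier Z" and TA: "\<And>n::nat. T n \<in> A"
    and \<phi>: "\<And>n. \<phi> n \<in> carrier (dual Z)" "\<And>n. nrm (dual Z) (\<phi> n) \<le> 1"
    and \<phi>_blk: "\<And>n. pull (\<phi> n) (C n) (D n) = \<phi> n"
    and disj: "\<And>m n. m < n \<Longrightarrow> C m \<inter> C n = {}" "\<And>m n. m < n \<Longrightarrow> D m \<inter> D n = {}" "\<And>n. C n \<inter> C0 = {}"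
    and before: "\<And>m n. m < n \<Longrightarrow> norm (\<phi> m (T n - S)) \<le> e / (real n + 1)"
    and diag: "\<And>n. \<exists>\<nu>\<ge>d - 2 * e. \<phi> n (T n - S) = of_real \<nu>"
    and after: "\<And>n. nrm Z ((T n - S) - blk (cumul C0 C (Suc n)) (cumul D0 D (Suc n)) (T n - S)) \<le> e"
    by (rule gliding_hump[OF A(1) e large]) blast+
  define U where "U n = T n - S" for n
  have TZ: "T n \<in> carrier Z" for n using TA A(1) by (auto simp: bounded_in_def)
  have U: "U n \<in> carrier Z" for n unfolding U_def by (intro Z.diff_mem TZ S)
  have \<phi>_le: "norm (\<phi> m V) \<le> nrm Z (blk (C m) (D m) V)" if V: "V \<in> carrier Z" for m V
  proof -
    have "\<phi> m V = \<phi> m (blk (C m) (D m) V)" using \<phi>_blk[of m] pull_apply[OF V, of "\<phi> m"] by metis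
    also have "norm \<dots> \<le> nrm (dual Z) (\<phi> m) * nrm Z (blk (C m) (D m) V)"
      by (intro Z.dual_bound \<phi> blk_mem V)
    also have "\<dots> \<le> 1 * nrm Z (blk (C m) (D m) V)"
      by (intro mult_right_mono \<phi> Z.nrm_nonneg blk_mem V)
    finally show ?thesis by simp
  qed
  \<comment> \<open>The disjoint-block estimate for p \<le> q makes the series of the \<phi> m
    converge absolutely at every V, with constant 1.\<close>
  have partial: "(\<Sum>m<M. norm (\<phi> m V)) \<le> nrm Z V" if V: "V \<in> carrier Z" for M V
  proof -
    have "(\<Sum>m<M. norm (\<phi> m V)) \<le> (\<Sum>m<M. nrm Z (blk (C m) (D m) V))" by (intro sum_mono \<phi>_le V)
    also have "\<dots> \<le> nrm Z V" by (rule sum_nrm_blk_le[OF pq V disj(1,2)])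
    finally show ?thesis .
  qed
  have abs_sm: "summable (\<lambda>m. norm (\<phi> m V))" if V: "V \<in> carrier Z" for V
    by (rule summableI_nonneg_bounded[where x = "nrm Z V"]) (simp_all add: partial V)
  have sm: "summable (\<lambda>m. \<phi> (m + N) V)" if V: "V \<in> carrier Z" for V N
    using summable_norm_cancel[OF abs_sm[OF V]] by (rule summable_ignore_initial_segment)
  define \<Phi> where "\<Phi> N V = (if V \<in> carrier Z then \<Sum>m. \<phi> (m + N) V else 0)" for N V
  have \<Phi>_eq: "\<Phi> N V = (\<Sum>m. \<phi> (m + N) V)" if "V \<in> carrier Z" for N V
    using that by (simp only: \<Phi>_def if_True)
  have \<Phi>_le: "norm (\<Phi> N V) \<le> nrm Z V" if V: "V \<in> carrier Z" for N V
  proof -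
    have sn: "summable (\<lambda>m. norm (\<phi> (m + N) V))" by (rule summable_ignore_initial_segment[OF abs_sm[OF V]])
    have "norm (\<Phi> N V) \<le> (\<Sum>m. norm (\<phi> (m + N) V))" unfolding \<Phi>_eq[OF V] by (rule summable_norm[OF sn])
    also have "\<dots> \<le> (\<Sum>m. norm (\<phi> m V))"
      using suminf_split_initial_segment[OF abs_sm[OF V], of N] sum_nonneg[of "{..<N}" "\<lambda>m. norm (\<phi> m V)"] by simp
    also have "\<dots> \<le> nrm Z V" by (rule suminf_le_const[OF abs_sm[OF V] partial[OF V]])
    finally show ?thesis .
  qed
  have \<Phi>: "\<Phi> N \<in> carrier (dual Z)" for N
  proof (rule Z.dualI[where M = 1])
    show "norm (\<Phi> N V) \<le> 1 * nrm Z V" if "V \<in> carrier Z" for V using \<Phi>_le[OF that] by simp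
  next
    fix V W assume V: "V \<in> carrier Z" and W: "W \<in> carrier Z"
    have "(\<Sum>m. \<phi> (m + N) (V + W)) = (\<Sum>m. \<phi> (m + N) V + \<phi> (m + N) W)"
      by (simp only: Z.dual_add[OF \<phi>(1) V W])
    then show "\<Phi> N (V + W) = \<Phi> N V + \<Phi> N W"
      by (simp only: \<Phi>_eq V W Z.add_mem suminf_add[OF sm[OF V] sm[OF W]])
  next
    fix c V assume V: "V \<in> carrier Z"
    have "(\<Sum>m. \<phi> (m + N) (smul Z c V)) = (\<Sum>m. c * \<phi> (m + N) V)"
      by (simp only: Z.dual_smul[OF \<phi>(1) V])
    then show "\<Phi> N (smul Z c V) = c * \<Phi> N V"
      by (simp only: \<Phi>_eq V Z.smul_mem suminf_mult[OF sm[OF V]])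
  qed (simp only: \<Phi>_def if_False)
  have \<Phi>_nrm: "nrm (dual Z) (\<Phi> N) \<le> 1" for N
    by (rule Z.dual_nrm_le) (use \<Phi>_le in simp_all)
  have \<Phi>_split: "\<Phi> N V = \<Phi> (Suc n) V + (\<Sum>m\<in>{N..<n}. \<phi> m V) + \<phi> n V" if V: "V \<in> carrier Z" and N: "N \<le> n" for N n V
  proof -
    have "\<Phi> N V = (\<Sum>m. \<phi> (m + (Suc n - N) + N) V) + (\<Sum>m<Suc n - N. \<phi> (m + N) V)"
      unfolding \<Phi>_eq[OF V] by (rule suminf_split_initial_segment[OF sm[OF V]])
    also have "(\<Sum>m. \<phi> (m + (Suc n - N) + N) V) = \<Phi> (Suc n) V"
      unfolding \<Phi>_eq[OF V] using N by (simp add: add.assoc)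
    also have "(\<Sum>m<Suc n - N. \<phi> (m + N) V) = (\<Sum>m\<in>{N..<Suc n}. \<phi> m V)"
      by (rule sum.reindex_bij_witness[of _ "\<lambda>m. m - N" "\<lambda>m. m + N"]) auto
    also have "\<dots> = (\<Sum>m\<in>{N..<n}. \<phi> m V) + \<phi> n V" using N by simp
    finally show ?thesis by (simp add: add.assoc)
  qed
  \<comment> \<open>The diagonal term gives d - 2 e; the functionals after n and those before n cost
    e each.\<close>
  have \<Phi>_large: "d - 4 * e \<le> norm (\<Phi> N (U n))" if N: "N \<le> n" for N n
  proof -
    let ?H = "cumul C0 C (Suc n)" and ?G = "cumul D0 D (Suc n)"
    have B: "blk ?H ?G (U n) \<in> carrier Z" by (intro blk_mem U)
    \<comment> \<open>Later functionals live on rows disjoint from all rows used up to step n, so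
      they see only the remainder of U n, which is small by \<open>after\<close>.\<close>
    have "\<phi> (m + Suc n) (blk ?H ?G (U n)) = 0" for m
    proof -
      have "C (m + Suc n) \<inter> C k = {}" if "k < Suc n" for k
        using disj(1)[of k "m + Suc n"] that by (auto simp: Int_commute)
      then have "C (m + Suc n) \<inter> ?H = {}" using disj(3)[of "m + Suc n"] by (auto simp: cumul_def)
      then have "blk (C (m + Suc n)) (D (m + Suc n)) (blk ?H ?G (U n)) = 0"
        unfolding blk_blk using blk_empty[OF U] by blast
      then have "nrm Z (blk (C (m + Suc n)) (D (m + Suc n)) (blk ?H ?G (U n))) = 0"
        by (simp only: Z.nrm_zero)
      then show ?thesis using \<phi>_le[OF B, of "m + Suc n"] by simp
    qed
    then have "\<Phi> (Suc n) (blk ?H ?G (U n)) = 0" by (simp only: \<Phi>_eq[OF B] suminf_zero)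
    then have "\<Phi> (Suc n) (U n) = \<Phi> (Suc n) (U n - blk ?H ?G (U n))"
      by (simp only: Z.dual_diff[OF \<Phi> U B] diff_zero)
    also have "norm \<dots> \<le> nrm Z (U n - blk ?H ?G (U n))" by (intro \<Phi>_le Z.diff_mem U B)
    also have "\<dots> \<le> e" using after[of n] by (simp only: U_def)
    finally have 1: "norm (\<Phi> (Suc n) (U n)) \<le> e" .
    have "norm (\<Sum>m\<in>{N..<n}. \<phi> m (U n)) \<le> (\<Sum>m\<in>{N..<n}. e / (real n + 1))"
      by (rule sum_norm_le) (use before[of _ n] in \<open>simp only: U_def atLeastLessThan_iff\<close>)
    also have "\<dots> \<le> e"
    proof -
      have "real (n - N) * e \<le> e * (real n + 1)"
        using e by (simp add: mult.commute mult_left_mono)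
      then show ?thesis using e by (simp add: divide_le_eq)
    qed
    finally have 2: "norm (\<Sum>m\<in>{N..<n}. \<phi> m (U n)) \<le> e" .
    obtain \<nu> where \<nu>: "d - 2 * e \<le> \<nu>" "\<phi> n (U n) = of_real \<nu>" using diag[of n] by (auto simp only: U_def)
    have "\<nu> \<le> norm (\<phi> n (U n))" by (simp add: \<nu>(2))
    also have "\<phi> n (U n) = \<Phi> N (U n) - \<Phi> (Suc n) (U n) - (\<Sum>m\<in>{N..<n}. \<phi> m (U n))"
      using \<Phi>_split[OF U N, of n] by simp
    also have "norm \<dots> \<le> norm (\<Phi> N (U n)) + norm (\<Phi> (Suc n) (U n)) + norm (\<Sum>m\<in>{N..<n}. \<phi> m (U n))"
      using norm_triangle_ineq4[of "\<Phi> N (U n) - \<Phi> (Suc n) (U n)" "\<Sum>m\<in>{N..<n}. \<phi> m (U n)"]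
        norm_triangle_ineq4[of "\<Phi> N (U n)" "\<Phi> (Suc n) (U n)"] by linarith
    finally show ?thesis using \<nu>(1) 1 2 by linarith
  qed
  have \<Phi>_lim: "(\<lambda>N. \<Phi> N V) \<longlonglongrightarrow> 0" if V: "V \<in> carrier Z" for V
    unfolding \<Phi>_eq[OF V] by (rule suminf_exist_split2[OF summable_norm_cancel[OF abs_sm[OF V]]])
  show ?thesis
  proof (rule Z.wck_nc_ge[OF A, of T, OF TA])
    fix \<psi> x assume \<psi>: "\<psi> \<in> cluster_points (weak_star_topology (dual Z)) (\<lambda>n. canon Z (T n))" and x: "x \<in> carrier Z"
    have \<psi>_mem: "\<psi> \<in> carrier (dual (dual Z))"
      using \<psi> by (simp add: cluster_points_def Z'.topspace_weak_star)
    \<comment> \<open>N may depend on x: replacing S by an arbitrary x then costs the fifth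
      e.\<close>
    have "\<forall>\<^sub>F N in sequentially. norm (\<Phi> N (S - x)) < e"
      using \<Phi>_lim[OF Z.diff_mem[OF S x]] e by (auto simp only: tendsto_iff dist_norm diff_zero)
    then obtain N where N: "norm (\<Phi> N (S - x)) < e" by (auto simp: eventually_sequentially)
    have far: "d - 4 * e \<le> norm (\<psi> (\<Phi> N) - \<Phi> N S)"
    proof (rule ccontr)
      assume neg: "\<not> ?thesis"
      \<comment> \<open>The radius is the gap to be refuted. The sequence visits this neighbourhood
        for some n \<ge> N, where \<open>\<Phi>_large\<close> contradicts it.\<close>
      define \<rho> where "\<rho> = d - 4 * e - norm (\<psi> (\<Phi> N) - \<Phi> N S)"
      have \<rho>: "0 < \<rho>" using neg by (simp add: \<rho>_def)
      define O' where "O' = {\<psi>' \<in> carrier (dual (dual Z)). \<psi>' (\<Phi> N) \<in> ball (\<psi> (\<Phi> N)) \<rho>}"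
      have "openin (weak_star_topology (dual Z)) O'"
        unfolding O'_def by (rule Z'.openin_weak_star[OF \<Phi> open_ball])
      moreover have "\<psi> \<in> O'" using \<psi>_mem \<rho> by (simp add: O'_def)
      ultimately have "\<exists>\<^sub>\<infinity>n. canon Z (T n) \<in> O'" using \<psi> by (auto simp: cluster_points_def)
      then obtain n where n: "N \<le> n" "canon Z (T n) \<in> O'" by (auto simp: INFM_nat_le)
      then have "dist (\<psi> (\<Phi> N)) (\<Phi> N (T n)) < \<rho>"
        by (simp only: O'_def mem_Collect_eq Z.canon_apply[OF \<Phi>] mem_ball)
      then have "norm (\<Phi> N (T n) - \<Phi> N S) < d - 4 * e"
        using norm_triangle_ineq[of "\<Phi> N (T n) - \<psi> (\<Phi> N)" "\<psi> (\<Phi> N) - \<Phi> N S"]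
        by (simp add: \<rho>_def dist_norm norm_minus_commute)
      moreover have "\<Phi> N (T n) - \<Phi> N S = \<Phi> N (U n)" by (simp only: U_def Z.dual_diff[OF \<Phi> TZ S])
      ultimately show False using \<Phi>_large[OF n(1)] by simp
    qed
    have mem: "\<psi> - canon Z x \<in> carrier (dual (dual Z))" by (intro Z''.diff_mem \<psi>_mem Z.canon_mem x)
    have "norm ((\<psi> - canon Z x) (\<Phi> N)) \<le> nrm (dual (dual Z)) (\<psi> - canon Z x) * nrm (dual Z) (\<Phi> N)"
      by (intro Z'.dual_bound mem \<Phi>)
    also have "\<dots> \<le> nrm (dual (dual Z)) (\<psi> - canon Z x)"
      using \<Phi>_nrm Z'.dual_nrm_nonneg[OF mem] by (intro mult_left_le)
    finally have "norm (\<psi> (\<Phi> N) - \<Phi> N x) \<le> nrm (dual (dual Z)) (\<psi> - canon Z x)"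
      by (simp only: fun_diff_def Z.canon_apply[OF \<Phi>])
    moreover have "(\<psi> (\<Phi> N) - \<Phi> N S) + \<Phi> N (S - x) = \<psi> (\<Phi> N) - \<Phi> N x"
      by (simp only: Z.dual_diff[OF \<Phi> S x]) simp
    then have "norm (\<psi> (\<Phi> N) - \<Phi> N S) - norm (\<Phi> N (S - x)) \<le> norm (\<psi> (\<Phi> N) - \<Phi> N x)"
      using norm_diff_ineq[of "\<psi> (\<Phi> N) - \<Phi> N S" "\<Phi> N (S - x)"] by (simp only:)
    ultimately show "d - 5 * e \<le> nrm (dual (dual Z)) (\<psi> - canon Z x)" using far N by linarith
  qed
qed

subsection \<open>The infimum over finite sets\<close>

definition finpairs :: "('j set \<times> 'l set) set" where
  "finpairs = {(C, D). C \<subseteq> J \<and> finite C \<and> D \<subseteq> L \<and> finite D}"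

lemma finpairs_iff: "(C, D) \<in> finpairs \<longleftrightarrow> C \<subseteq> J \<and> finite C \<and> D \<subseteq> L \<and> finite D"
  by (simp add: finpairs_def)

text \<open>Common shape of the two formulas in the theorem, for h the corner norm or the norm of
  the remainder.\<close>

definition infsup :: "('j set \<times> 'l set \<Rightarrow> (('l \<Rightarrow> 'k) \<Rightarrow> 'j \<Rightarrow> 'k) \<Rightarrow> real) \<Rightarrow> (('l \<Rightarrow> 'k) \<Rightarrow> 'j \<Rightarrow> 'k) set \<Rightarrow> real" where
  "infsup h A = (INF i\<in>finpairs. SUP T\<in>A. h i T)"

lemma infsup_le:
  assumes "A \<noteq> {}" "\<And>i T. T \<in> A \<Longrightarrow> 0 \<le> h i T" "\<And>i T. T \<in> A \<Longrightarrow> h i T \<le> M"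
    and "i \<in> finpairs" "\<And>T. T \<in> A \<Longrightarrow> h i T \<le> c"
  shows "infsup h A \<le> c"
proof -
  have nonneg: "0 \<le> (SUP T\<in>A. h i T)" for i
  proof -
    obtain T where "T \<in> A" using assms(1) by auto
    then have "h i T \<le> (SUP T\<in>A. h i T)" using assms(3) by (intro cSUP_upper bdd_aboveI2)
    then show ?thesis using assms(2)[OF \<open>T \<in> A\<close>, of i] by linarith
  qed
  have "infsup h A \<le> (SUP T\<in>A. h i T)"
    unfolding infsup_def using assms(4) nonneg by (intro cINF_lower bdd_belowI2)
  also have "\<dots> \<le> c" using assms(1,5) by (rule cSUP_least)
  finally show ?thesis .
qed

lemma infsup_ge:
  assumes "\<And>i T. T \<in> A \<Longrightarrow> h i T \<le> M"
    and "\<And>i c. i \<in> finpairs \<Longrightarrow> (\<And>T. T \<in> A \<Longrightarrow> h i T \<le> c) \<Longrightarrow> b \<le> c"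
  shows "b \<le> infsup h A"
  unfolding infsup_def
proof (rule cINF_greatest)
  show "finpairs \<noteq> {}" using finpairs_iff[of "{}" "{}"] by auto
  show "b \<le> (SUP T\<in>A. h i T)" if "i \<in> finpairs" for i
    using that
  proof (rule assms(2))
    show "h i T \<le> (SUP T\<in>A. h i T)" if "T \<in> A" for T
      using that assms(1) by (intro cSUP_upper bdd_aboveI2)
  qed
qed

definition corner :: "'j set \<times> 'l set \<Rightarrow> (('l \<Rightarrow> 'k) \<Rightarrow> 'j \<Rightarrow> 'k) \<Rightarrow> real" where
  "corner i T = nrm Z (blk (- fst i) (- snd i) T)"

definition remainder :: "'j set \<times> 'l set \<Rightarrow> (('l \<Rightarrow> 'k) \<Rightarrow> 'j \<Rightarrow> 'k) \<Rightarrow> real" where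
  "remainder i T = nrm Z (T - blk (fst i) (snd i) T)"

lemma corner_bounds: "T \<in> carrier Z \<Longrightarrow> 0 \<le> corner i T" "T \<in> carrier Z \<Longrightarrow> corner i T \<le> nrm Z T"
  unfolding corner_def by (intro Z.nrm_nonneg blk_mem; assumption)+

lemma remainder_bounds:
  assumes T: "T \<in> carrier Z" shows "0 \<le> remainder i T" "remainder i T \<le> 2 * nrm Z T"
proof -
  show "0 \<le> remainder i T" unfolding remainder_def by (intro Z.nrm_nonneg Z.diff_mem blk_mem T)
  have "remainder i T \<le> nrm Z T + nrm Z (blk (fst i) (snd i) T)"
    unfolding remainder_def by (intro Z.nrm_diff_le blk_mem T)
  then show "remainder i T \<le> 2 * nrm Z T" using blk_mem(2)[OF T, of "fst i" "snd i"] by linarith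
qed

text \<open>Passing from an operator to its remainder at most doubles the norm; the constant 2 in
  front of \<chi> has its origin here.\<close>

lemma remainder_diff_le:
  assumes S: "S \<in> carrier Z" and T: "T \<in> carrier Z"
  shows "remainder i T \<le> 2 * nrm Z (T - S) + remainder i S"
proof -
  have mem: "T - S \<in> carrier Z" "S - blk (fst i) (snd i) S \<in> carrier Z" "(T - S) - blk (fst i) (snd i) (T - S) \<in> carrier Z"
    by (intro Z.diff_mem blk_mem S T)+
  have "T - blk (fst i) (snd i) T = ((T - S) - blk (fst i) (snd i) (T - S)) + (S - blk (fst i) (snd i) S)"
    by (simp add: blk_diff)
  then have "remainder i T = nrm Z (((T - S) - blk (fst i) (snd i) (T - S)) + (S - blk (fst i) (snd i) S))"
    unfolding remainder_def by (rule arg_cong)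
  also have "\<dots> \<le> remainder i (T - S) + remainder i S"
    unfolding remainder_def by (intro Z.nrm_triangle mem)
  finally show ?thesis using remainder_bounds(2)[OF mem(1), of i] by linarith
qed

section \<open>Evaluation of the measures of non-compactness\<close>

context
  fixes A assumes A: "bounded_in Z A" "A \<noteq> {}"
begin

text \<open>The inequalities close up in a cycle: \<omega> is at most the corner quantity, that is
  at most wck, then wk, then \<omega>.\<close>

lemma infsup_corner_eq:
  assumes pq: "p \<le> q"
  shows "omega_nc Z A = infsup corner A" "wk_nc Z A = infsup corner A" "wck_nc Z A = infsup corner A"
proof -
  obtain M where M: "A \<subseteq> carrier Z" "\<And>T. T \<in> A \<Longrightarrow> nrm Z T \<le> M" using A(1) by (auto simp: bounded_in_def)
  have cb: "0 \<le> corner i T" "corner i T \<le> M" if "T \<in> A" for i T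
    using corner_bounds[of T i] M that by (auto intro: order_trans)
  have 1: "omega_nc Z A \<le> infsup corner A"
  proof (rule infsup_ge[OF cb(2)])
    fix i c assume i: "i \<in> finpairs" and le: "\<And>T. T \<in> A \<Longrightarrow> corner i T \<le> c"
    have "finite (fst i)" "fst i \<subseteq> J" "finite (snd i)" "snd i \<subseteq> L" using i by (auto simp: finpairs_def)
    then show "omega_nc Z A \<le> c" by (rule omega_le_corner[OF A]) (use le in \<open>simp only: corner_def\<close>)
  qed
  have 2: "infsup corner A \<le> wck_nc Z A"
  proof (rule field_le_epsilon)
    fix e :: real assume e: "0 < e"
    \<comment> \<open>One sixth makes d strictly smaller than the infimum; the other five are the
      loss in \<open>corner_le_wck\<close>.\<close>
    define d where "d = infsup corner A - e / 6"
    have "\<exists>T\<in>A. d < nrm Z (blk (- C) (- D) T)" if CD: "finite C" "C \<subseteq> J" "finite D" "D \<subseteq> L" for C D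
    proof (rule ccontr)
      assume none: "\<not> ?thesis"
      have "corner (C, D) T \<le> d" if "T \<in> A" for T
        using none that unfolding corner_def fst_conv snd_conv by (meson not_less)
      then have "infsup corner A \<le> d"
        using CD by (intro infsup_le[OF A(2) cb, where i = "(C, D)"]) (auto simp: finpairs_iff)
      then show False using e by (simp add: d_def)
    qed
    then have "d - 5 * (e / 6) \<le> wck_nc Z A" using e by (intro corner_le_wck[OF pq A]) auto
    then show "infsup corner A \<le> wck_nc Z A + e" by (simp add: d_def)
  qed
  show "omega_nc Z A = infsup corner A" "wk_nc Z A = infsup corner A" "wck_nc Z A = infsup corner A"
    using 1 2 Z.wck_le_wk[OF A] Z.wk_le_omega[OF A] by linarith+
qed

text \<open>Blocks over finite sets range over a bounded subset of a finite-dimensional space.\<close>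

lemma chi_le_infsup: "chi_nc Z A \<le> infsup remainder A"
proof -
  obtain M where M: "A \<subseteq> carrier Z" "\<And>T. T \<in> A \<Longrightarrow> nrm Z T \<le> M" using A(1) by (auto simp: bounded_in_def)
  have rb: "remainder i T \<le> 2 * M" if "T \<in> A" for i T
  proof -
    have "remainder i T \<le> 2 * nrm Z T" using M that by (intro remainder_bounds) auto
    then show ?thesis using M(2)[OF that] by linarith
  qed
  show ?thesis
  proof (rule infsup_ge[OF rb])
    fix i c assume i: "i \<in> finpairs" and le: "\<And>T. T \<in> A \<Longrightarrow> remainder i T \<le> c"
    define C D where "C = fst i" and "D = snd i"
    have CD: "finite C" "C \<subseteq> J" "finite D" "D \<subseteq> L" using i by (auto simp: finpairs_def C_def D_def)
    have "chi_nc Z A \<le> c + e" if e: "0 < e" for e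
    proof -
      \<comment> \<open>Each entry is approximated up to \<delta>, and matrix units have norm at
        most one, so the total error over the block is at most e.\<close>
      define \<delta> where "\<delta> = e / (real (card (C \<times> D)) + 1)"
      have \<delta>: "0 < \<delta>" using e by (simp add: \<delta>_def add_nonneg_pos)
      \<comment> \<open>Entries of operators in A are bounded by M; the candidates are the finitely
        many matrices on C \<times> D with entries from this net of scalars.\<close>
      obtain G where G: "finite G" "cball (0::'k) M \<subseteq> (\<Union>g\<in>G. ball g \<delta>)"
        using compact_cball_rc_scalar[of M, where 'k = 'k] \<delta> unfolding compact_eq_totally_bounded by meson
      define lin where "lin g = (\<Sum>i\<in>C \<times> D. smul Z (g i) (etens i))" for g
      have lin: "lin g \<in> carrier Z" for g
        unfolding lin_def by (intro Z.sum_mem Z.smul_mem etens_mem CD_sub[OF CD])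
      define F where "F = lin ` (PiE (C \<times> D) (\<lambda>_. G))"
      have F: "finite F" "F \<subseteq> carrier Z" unfolding F_def using CD G(1) lin by (auto intro: finite_PiE)
      have near: "\<exists>S\<in>F. nrm Z (T - S) \<le> c + e" if T: "T \<in> A" for T
      proof -
        have TZ: "T \<in> carrier Z" using T M by auto
        have "\<exists>g\<in>G. norm (ent i T - g) < \<delta>" if "i \<in> C \<times> D" for i
        proof -
          have "norm (ent i T) \<le> M" using ent_bound[OF CD_sub[OF CD that] TZ] M(2)[OF T] by linarith
          then have "ent i T \<in> cball 0 M" by simp
          then have "ent i T \<in> (\<Union>g\<in>G. ball g \<delta>)" using G(2) by (rule_tac subsetD)
          then show ?thesis by (auto simp: dist_norm norm_minus_commute)
        qed
        then have "\<forall>i\<in>C \<times> D. \<exists>g. g \<in> G \<and> norm (ent i T - g) < \<delta>" by blast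
        from bchoice[OF this] obtain g0 where "\<forall>i\<in>C \<times> D. g0 i \<in> G \<and> norm (ent i T - g0 i) < \<delta>" ..
        note g0 = this[rule_format]
        define g where "g = restrict g0 (C \<times> D)"
        have "g \<in> PiE (C \<times> D) (\<lambda>_. G)"
          unfolding g_def by (rule PiE_I) (simp_all only: restrict_apply if_True if_False g0)
        then have g: "lin g \<in> F" unfolding F_def by (rule imageI)
        have "lin g = (\<Sum>i\<in>C \<times> D. smul Z (g0 i) (etens i))"
          unfolding lin_def g_def by (intro sum.cong refl) (simp only: restrict_apply')
        then have diff: "blk C D T - lin g = (\<Sum>i\<in>C \<times> D. smul Z (ent i T) (etens i) - smul Z (g0 i) (etens i))"
          by (simp only: blk_expand_etens[OF CD TZ] sum_subtractf)
        have est: "nrm Z (smul Z (ent i T) (etens i) - smul Z (g0 i) (etens i)) \<le> \<delta>" if i: "i \<in> C \<times> D" for i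
        proof -
          note E = etens_mem[OF CD_sub[OF CD i]]
          have "smul Z (ent i T) (etens i) - smul Z (g0 i) (etens i) = smul Z (ent i T - g0 i) (etens i)"
            using Z.smul_add_left[OF E, of "ent i T - g0 i" "g0 i"] by (simp only: diff_add_cancel add_diff_cancel_right')
          then have "nrm Z (smul Z (ent i T) (etens i) - smul Z (g0 i) (etens i)) = norm (ent i T - g0 i) * nrm Z (etens i)"
            by (simp only: Z.nrm_smul[OF E])
          also have "\<dots> \<le> \<delta> * 1"
            using g0[OF i] \<delta> by (intro mult_mono etens_nrm CD_sub[OF CD i] Z.nrm_nonneg E) auto
          finally show ?thesis by simp
        qed
        have "nrm Z (blk C D T - lin g) \<le> (\<Sum>i\<in>C \<times> D. nrm Z (smul Z (ent i T) (etens i) - smul Z (g0 i) (etens i)))"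
          unfolding diff by (intro Z.nrm_sum Z.diff_mem Z.smul_mem etens_mem CD_sub[OF CD])
        also have "\<dots> \<le> (\<Sum>i\<in>C \<times> D. \<delta>)" by (intro sum_mono est)
        also have "\<dots> = real (card (C \<times> D)) * \<delta>" by simp
        also have "\<dots> \<le> e" using e by (simp add: \<delta>_def divide_le_eq add_nonneg_pos algebra_simps)
        finally have 1: "nrm Z (blk C D T - lin g) \<le> e" .
        have B: "blk C D T \<in> carrier Z" by (intro blk_mem TZ)
        have "nrm Z (T - lin g) = nrm Z ((T - blk C D T) + (blk C D T - lin g))" by (rule arg_cong[where f = "nrm Z"]) simp
        also have "\<dots> \<le> nrm Z (T - blk C D T) + nrm Z (blk C D T - lin g)" by (intro Z.nrm_triangle Z.diff_mem TZ B lin)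
        finally have "nrm Z (T - lin g) \<le> c + e" using 1 le[OF T] unfolding remainder_def C_def D_def by linarith
        then show ?thesis using g by blast
      qed
      have Fne: "F \<noteq> {}" using near A(2) by blast
      have "pt_dist Z T F \<le> c + e" if T: "T \<in> A" for T
      proof -
        obtain S where S: "S \<in> F" "nrm Z (T - S) \<le> c + e" using near[OF T] by blast
        have "pt_dist Z T F \<le> nrm Z (T - S)" using T M F S by (intro Z.pt_dist_le) auto
        then show ?thesis using S(2) by linarith
      qed
      then have "dhat Z A F \<le> c + e" by (rule Z.dhat_le[OF A(2)])
      moreover have "chi_nc Z A \<le> dhat Z A F"
        unfolding chi_nc_def using F Fne A by (intro cINF_lower bdd_belowI2[where m = 0]) (auto intro!: Z.dhat_nonneg)
      ultimately show ?thesis by linarith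
    qed
    then show "chi_nc Z A \<le> c" by (rule field_le_epsilon)
  qed
qed

text \<open>Given a finite set F of centres, one block serves all of them; the remainder of T is
  then at most twice its distance to a centre plus a small error.\<close>

lemma infsup_le_chi: "infsup remainder A \<le> 2 * chi_nc Z A"
proof -
  obtain M where M: "A \<subseteq> carrier Z" "\<And>T. T \<in> A \<Longrightarrow> nrm Z T \<le> M" using A(1) by (auto simp: bounded_in_def)
  have rb: "0 \<le> remainder i T" "remainder i T \<le> 2 * M" if "T \<in> A" for i T
  proof -
    have T: "T \<in> carrier Z" using M that by auto
    show "0 \<le> remainder i T" by (rule remainder_bounds(1)[OF T])
    show "remainder i T \<le> 2 * M" using remainder_bounds(2)[OF T, of i] M(2)[OF that] by linarith
  qed
  have "infsup remainder A / 2 \<le> dhat Z A F" if F: "F \<subseteq> carrier Z" "finite F" "F \<noteq> {}" for F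
  proof (rule field_le_epsilon)
    fix e :: real assume e: "0 < e"
    have e2: "0 < e / 2" using e by simp
    have "\<exists>i\<in>finpairs. \<forall>C' D'. fst i \<subseteq> C' \<longrightarrow> snd i \<subseteq> D' \<longrightarrow> remainder (C', D') S \<le> e / 2" if S: "S \<in> F" for S
    proof -
      have "S \<in> carrier Z" using S F by auto
      then obtain C D where CD: "finite C" "C \<subseteq> J" "finite D" "D \<subseteq> L"
        "\<And>C' D'. C \<subseteq> C' \<Longrightarrow> D \<subseteq> D' \<Longrightarrow> nrm Z (S - blk C' D' S) \<le> e / 2"
        by (rule blk_approx[OF _ e2]) blast
      have "remainder (C', D') S \<le> e / 2" if "C \<subseteq> C'" "D \<subseteq> D'" for C' D'
        using CD(5)[OF that] by (simp only: remainder_def fst_conv snd_conv)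
      then show ?thesis using CD(1-4) by (intro bexI[of _ "(C, D)"]) (auto simp: finpairs_iff)
    qed
    then obtain i where i: "\<And>S. S \<in> F \<Longrightarrow> i S \<in> finpairs"
      "\<And>S C' D'. S \<in> F \<Longrightarrow> fst (i S) \<subseteq> C' \<Longrightarrow> snd (i S) \<subseteq> D' \<Longrightarrow> remainder (C', D') S \<le> e / 2"
      by metis
    define C D where "C = (\<Union>S\<in>F. fst (i S))" and "D = (\<Union>S\<in>F. snd (i S))"
    have "fst (i S) \<subseteq> J \<and> finite (fst (i S)) \<and> snd (i S) \<subseteq> L \<and> finite (snd (i S))" if "S \<in> F" for S
      using i(1)[OF that] finpairs_iff[of "fst (i S)" "snd (i S)"] by simp
    then have CD: "(C, D) \<in> finpairs" unfolding finpairs_iff C_def D_def using F(2) by (simp add: UN_least)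
    have small: "remainder (C, D) S \<le> e / 2" if "S \<in> F" for S
      using that by (intro i(2)) (auto simp: C_def D_def)
    have "infsup remainder A \<le> 2 * (dhat Z A F + e)"
    proof (rule infsup_le[OF A(2) rb CD])
      fix T assume T: "T \<in> A"
      have TZ: "T \<in> carrier Z" using T M by auto
      have "pt_dist Z T F < dhat Z A F + e / 2" using Z.pt_dist_le_dhat[OF A(1) F(1,3) T] e by linarith
      then obtain S where S: "S \<in> F" "nrm Z (T - S) < dhat Z A F + e / 2" using Z.pt_dist_less[OF TZ F(1,3)] by blast
      have "S \<in> carrier Z" using S F by auto
      then show "remainder (C, D) T \<le> 2 * (dhat Z A F + e)"
        using remainder_diff_le[OF _ TZ, of S "(C, D)"] small[OF S(1)] S(2) e by (auto simp: algebra_simps)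
    qed
    then show "infsup remainder A / 2 \<le> dhat Z A F + e" by simp
  qed
  then have "infsup remainder A / 2 \<le> chi_nc Z A"
    unfolding chi_nc_def using Z.zero_mem by (intro cINF_greatest) (auto intro!: exI[of _ "{0}"])
  then show ?thesis by simp
qed

end

text \<open>For infinite J and L the corner beyond any finite sets still contains a matrix unit, so
  the bounded set of all matrix units has \<omega> at least 1, whereas \<omega> vanishes in a
  reflexive space.\<close>

lemma not_reflexive:
  assumes pq: "p \<le> q" and J: "infinite J" and L: "infinite L"
  shows "\<not> reflexive Z"
proof
  assume refl: "reflexive Z"
  define A where "A = etens ` (J \<times> L)"
  have A: "bounded_in Z A" unfolding bounded_in_def A_def using etens_mem etens_nrm by blast
  have "J \<times> L \<noteq> {}" using J L by auto
  then have ne: "A \<noteq> {}" by (simp add: A_def)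
  have "1 \<le> infsup corner A"
  proof (rule infsup_ge[where M = 1])
    fix i T assume "T \<in> A"
    then obtain j where j: "j \<in> J \<times> L" "T = etens j" by (auto simp: A_def)
    then show "corner i T \<le> 1" using corner_bounds(2)[OF etens_mem[OF j(1)], of i] etens_nrm[OF j(1)] by simp
  next
    fix i c assume i: "i \<in> finpairs" and le: "\<And>T. T \<in> A \<Longrightarrow> corner i T \<le> c"
    have "finite (fst i)" "finite (snd i)" using i by (auto simp: finpairs_def)
    then obtain j l where jl: "j \<in> J" "j \<notin> fst i" "l \<in> L" "l \<notin> snd i"
      using J L by (metis finite_subset subsetI)
    have mem: "(j, l) \<in> J \<times> L" using jl by simp
    have "blk (- fst i) (- snd i) (etens (j, l)) = etens (j, l)" using jl by (simp add: blk_etens)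
    then have "corner i (etens (j, l)) = nrm Z (etens (j, l))" by (simp only: corner_def)
    \<comment> \<open>The entry functional at (j, l) has norm at most one and takes the value 1
      there.\<close>
    moreover have "1 \<le> nrm Z (etens (j, l))"
      using ent_bound[OF mem etens_mem[OF mem]] etens_entry[OF mem] by simp
    moreover have "etens (j, l) \<in> A" using mem by (auto simp: A_def)
    ultimately show "1 \<le> c" using le[of "etens (j, l)"] by linarith
  qed
  then show False
    using Z.omega_nc_reflexive[OF A ne refl] infsup_corner_eq(1)[OF A ne pq] by linarith
qed

end

theorem theorem2p1:
  fixes J :: "'j set" and L :: "'l set" and p q :: real
    and P :: "'j set \<Rightarrow> ('j \<Rightarrow> 'k::rc_scalar) \<Rightarrow> ('j \<Rightarrow> 'k)"
    and Q :: "'l set \<Rightarrow> ('l \<Rightarrow> 'k) \<Rightarrow> ('l \<Rightarrow> 'k)"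
    and IJ :: "('j \<Rightarrow> 'k) \<Rightarrow> ('j \<Rightarrow> 'k)"
    and IL :: "('l \<Rightarrow> 'k) \<Rightarrow> ('l \<Rightarrow> 'k)"
    and Z :: "('k, ('l \<Rightarrow> 'k) \<Rightarrow> ('j \<Rightarrow> 'k)) nspace"
  assumes "infinite J" and "infinite L" and "1 < p" and "1 < q"
    and "P = coord_proj p J" and "Q = coord_proj q L"
    and "IJ = id_op (ell p J)" and "IL = id_op (ell q L)"
    and "Z = nuclear_space (ell q L) (ell p J)"
  shows
    "(p > q \<longrightarrow>
        reflexive Z \<and>
        (\<forall>A. A \<noteq> {} \<and> bounded_in Z A \<longrightarrow> omega_nc Z A = 0 \<and> wk_nc Z A = 0 \<and> wck_nc Z A = 0))
     \<and> (p \<le> q \<longrightarrow>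
        \<not> reflexive Z \<and>
        (\<forall>A. A \<noteq> {} \<and> bounded_in Z A \<longrightarrow>
           omega_nc Z A = wk_nc Z A \<and> wk_nc Z A = wck_nc Z A \<and>
           wck_nc Z A =
             (INF (C, D)\<in>{(C, D). C \<subseteq> J \<and> finite C \<and> D \<subseteq> L \<and> finite D}.
                SUP T\<in>A. nrm Z ((IJ - P C) \<circ> T \<circ> (IL - Q D)))))
     \<and> (\<forall>A. A \<noteq> {} \<and> bounded_in Z A \<longrightarrow>
           chi_nc Z A \<le>
             (INF (C, D)\<in>{(C, D). C \<subseteq> J \<and> finite C \<and> D \<subseteq> L \<and> finite D}.
                SUP T\<in>A. nrm Z (T - (P C \<circ> T \<circ> Q D))) \<and>
           (INF (C, D)\<in>{(C, D). C \<subseteq> J \<and> finite C \<and> D \<subseteq> L \<and> finite D}.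
                SUP T\<in>A. nrm Z (T - (P C \<circ> T \<circ> Q D))) \<le> 2 * chi_nc Z A)"
proof -
  interpret nuclear_ell "q / (q - 1)" q p J L Z
    by unfold_locales (use assms in \<open>auto simp: field_simps\<close>)
  \<comment> \<open>Projections and identities vanish outside their carriers, so there the
    composites evaluate T at 0.\<close>
  have T0: "T 0 = 0" if "T \<in> carrier Z" for T
    using Z_apply_add[OF that X.zero_mem X.zero_mem] by simp
  have compress: "P C \<circ> T \<circ> Q D = blk C D T" if T: "T \<in> carrier Z" for C D T
  proof
    fix x
    have "coord_proj p J C (T (coord_proj q L D x)) = blk C D T x"
    proof (cases "x \<in> carrier X")
      case True
      then show ?thesis
        using Z_apply_mem[OF T X_res(1)[OF True, of D]] by (simp only: coord_proj_eq blk_def if_True)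
    next
      case False
      have "res C (0 :: 'j \<Rightarrow> 'k) = 0" by (auto simp: res_def)
      moreover have "coord_proj q L D x = 0" using False by (simp only: coord_proj_def if_False)
      ultimately show ?thesis
        using False coord_proj_eq[OF Y.zero_mem, of C] T0[OF T] by (simp only: blk_def if_False)
    qed
    then show "(P C \<circ> T \<circ> Q D) x = blk C D T x" by (simp only: assms(5,6) o_apply)
  qed
  have cut: "(IJ - P C) \<circ> T \<circ> (IL - Q D) = blk (- C) (- D) T" if T: "T \<in> carrier Z" for C D T
  proof
    fix x
    have IJ: "(IJ - P C) y = res (- C) y" if "y \<in> carrier Y" for y
      using that res_diff_set[of y C] by (simp only: assms(5,7) fun_diff_def coord_proj_eq id_op_def if_True)
    show "((IJ - P C) \<circ> T \<circ> (IL - Q D)) x = blk (- C) (- D) T x"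
    proof (cases "x \<in> carrier X")
      case True
      have "(IL - Q D) x = res (- D) x"
        using True res_diff_set[of x D] by (simp only: assms(6,8) fun_diff_def coord_proj_eq id_op_def if_True)
      then show ?thesis
        using True IJ[OF Z_apply_mem[OF T X_res(1)[OF True, of "- D"]]] by (simp only: o_apply blk_def if_True)
    next
      case False
      have "(IL - Q D) x = 0"
        using False by (simp only: assms(6,8) minus_apply coord_proj_def id_op_def if_False diff_self)
      moreover have "res (- C) (0 :: 'j \<Rightarrow> 'k) = 0" by (auto simp: res_def)
      ultimately show ?thesis
        using False IJ[OF Y.zero_mem] T0[OF T] by (simp only: o_apply blk_def if_False)
    qed
  qed
  have inf_corner: "(INF (C, D)\<in>{(C, D). C \<subseteq> J \<and> finite C \<and> D \<subseteq> L \<and> finite D}.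
      SUP T\<in>A. nrm Z ((IJ - P C) \<circ> T \<circ> (IL - Q D))) = infsup corner A" if "bounded_in Z A" for A
  proof -
    have "T \<in> carrier Z" if "T \<in> A" for T using \<open>bounded_in Z A\<close> that by (auto simp: bounded_in_def)
    then have "(SUP T\<in>A. nrm Z ((IJ - P C) \<circ> T \<circ> (IL - Q D))) = (SUP T\<in>A. corner (C, D) T)" for C D
      by (intro SUP_cong refl) (simp only: cut corner_def fst_conv snd_conv)
    then show ?thesis unfolding infsup_def finpairs_def by (intro INF_cong refl) (simp only: split_paired_all prod.case)
  qed
  have inf_remainder: "(INF (C, D)\<in>{(C, D). C \<subseteq> J \<and> finite C \<and> D \<subseteq> L \<and> finite D}.
      SUP T\<in>A. nrm Z (T - (P C \<circ> T \<circ> Q D))) = infsup remainder A" if "bounded_in Z A" for A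
  proof -
    have "T \<in> carrier Z" if "T \<in> A" for T using \<open>bounded_in Z A\<close> that by (auto simp: bounded_in_def)
    then have "(SUP T\<in>A. nrm Z (T - (P C \<circ> T \<circ> Q D))) = (SUP T\<in>A. remainder (C, D) T)" for C D
      by (intro SUP_cong refl) (simp only: compress remainder_def fst_conv snd_conv)
    then show ?thesis unfolding infsup_def finpairs_def by (intro INF_cong refl) (simp only: split_paired_all prod.case)
  qed
  show ?thesis
  proof (intro conjI impI allI)
    assume "q < p"
    then show refl: "reflexive Z" by (rule nuclear_reflexive)
    fix A assume A: "A \<noteq> {} \<and> bounded_in Z A"
    have "omega_nc Z A \<le> 0" "0 \<le> wck_nc Z A" "wck_nc Z A \<le> wk_nc Z A" "wk_nc Z A \<le> omega_nc Z A"
      using A by (auto intro: Z.omega_nc_reflexive[OF _ _ refl] Z.wck_nc_nonneg Z.wck_le_wk Z.wk_le_omega)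
    then show "omega_nc Z A = 0" "wk_nc Z A = 0" "wck_nc Z A = 0" by linarith+
  next
    assume "p \<le> q"
    then show "\<not> reflexive Z" using not_reflexive assms(1,2) by blast
  next
    fix A assume pq: "p \<le> q" and A: "A \<noteq> {} \<and> bounded_in Z A"
    then have A': "bounded_in Z A" "A \<noteq> {}" by auto
    note eqs = infsup_corner_eq[OF A' pq]
    show "omega_nc Z A = wk_nc Z A" "wk_nc Z A = wck_nc Z A" using eqs by linarith+
    show "wck_nc Z A = (INF (C, D)\<in>{(C, D). C \<subseteq> J \<and> finite C \<and> D \<subseteq> L \<and> finite D}.
        SUP T\<in>A. nrm Z ((IJ - P C) \<circ> T \<circ> (IL - Q D)))"
      unfolding inf_corner[OF A'(1)] by (rule eqs(3))
  next
    fix A assume "A \<noteq> {} \<and> bounded_in Z A"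
    then have A': "bounded_in Z A" "A \<noteq> {}" by auto
    show "chi_nc Z A \<le> (INF (C, D)\<in>{(C, D). C \<subseteq> J \<and> finite C \<and> D \<subseteq> L \<and> finite D}.
        SUP T\<in>A. nrm Z (T - (P C \<circ> T \<circ> Q D)))"
      unfolding inf_remainder[OF A'(1)] by (rule chi_le_infsup[OF A'])
    show "(INF (C, D)\<in>{(C, D). C \<subseteq> J \<and> finite C \<and> D \<subseteq> L \<and> finite D}.
        SUP T\<in>A. nrm Z (T - (P C \<circ> T \<circ> Q D))) \<le> 2 * chi_nc Z A"
      unfolding inf_remainder[OF A'(1)] by (rule infsup_le_chi[OF A'])
  qed
qed

end
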